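(* Let $K=\mathbb{Q}(\sqrt{d_1},\ldots,\sqrt{d_m})$ be a multiquadratic field of degree $n=2^m$ over $\mathbb{Q}$ with $m\ge 3$, and suppose the class number of $K$ is odd. Then $K$ contains no unit $\varepsilon\in\mathcal{O}_K^\times$ with $N_{K/\mathbb{Q}}(\varepsilon)=-1$.
   Context: A multiquadratic field of degree $2^m$ is a field $K=\mathbb{Q}(\sqrt{d_1},\ldots,\sqrt{d_m})$ with $d_i$ integers such that $[K:\mathbb{Q}]=2^m$ (so $\mathrm{Gal}(K/\mathbb{Q})\cong(\mathbb{Z}/2\mathbb{Z})^m$). *)

theory Defs
  imports
    "HOL-Algebra.Algebraic_Closure_Type"
    "HOL-Algebra.Embedded_Algebras"
    "HOL-Algebra.Generated_Fields"
    "HOL-Algebra.Ideal_Product"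
    "HOL-Algebra.Coset"
begin

text \<open>
  Number fields are represented as subsets \<open>K\<close> of the complex numbers, so that the
  tools of HOL-Algebra for subfields of an ambient ring apply.
\<close>

abbreviation complex_field :: "complex ring" where
  "complex_field \<equiv> ring_of_type_algebra"

definition rat_adjoin :: "complex set \<Rightarrow> complex set" where
  "rat_adjoin S = generate_field complex_field (\<rat> \<union> S)"

text \<open>
  \<open>rat_degree K n\<close> states that \<open>K\<close> has finite dimension exactly \<open>n\<close> over the rationals.
\<close>

definition rat_degree :: "complex set \<Rightarrow> nat \<Rightarrow> bool" where
  "rat_degree K n \<longleftrightarrow> ring.dimension complex_field n \<rat> K"

text \<open>
  The integers \<open>d i\<close> may be negative, hence the complex square root; the choice of the
  root does not affect the generated field.
\<close>

definition multiquadratic_field :: "nat \<Rightarrow> (nat \<Rightarrow> int) \<Rightarrow> complex set \<Rightarrow> bool" where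
  "multiquadratic_field m d K \<longleftrightarrow>
     K = rat_adjoin ((\<lambda>i. csqrt (of_int (d i))) ` {1..m}) \<and> rat_degree K (2 ^ m)"

definition ring_of_integers :: "complex set \<Rightarrow> complex ring" where
  "ring_of_integers K = complex_field\<lparr>carrier := {x \<in> K. algebraic_int x}\<rparr>"

text \<open>
  The embeddings are made undefined outside \<open>K\<close>, so that each field embedding of \<open>K\<close>
  is represented by exactly one HOL function.
\<close>

definition embeddings :: "complex set \<Rightarrow> (complex \<Rightarrow> complex) set" where
  "embeddings K = ring_hom (complex_field\<lparr>carrier := K\<rparr>) complex_field \<inter> extensional K"

definition rat_norm :: "complex set \<Rightarrow> complex \<Rightarrow> complex" where
  "rat_norm K x = (\<Prod>\<sigma>\<in>embeddings K. \<sigma> x)"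

definition fractional_ideals :: "complex set \<Rightarrow> complex set set" where
  "fractional_ideals K =
     {(\<lambda>x. x / a) ` J | a J.
        a \<in> carrier (ring_of_integers K) \<and> a \<noteq> 0 \<and> ideal J (ring_of_integers K) \<and> J \<noteq> {0}}"

definition principal_fractional_ideals :: "complex set \<Rightarrow> complex set set" where
  "principal_fractional_ideals K =
     {(\<lambda>x. c * x) ` carrier (ring_of_integers K) | c. c \<in> K \<and> c \<noteq> 0}"

text \<open>
  The library constant \<open>ideal_prod\<close> forms all nonempty finite sums of products of two elements,
  so it also gives the product of fractional ideals.
\<close>

definition fractional_ideal_group :: "complex set \<Rightarrow> complex set monoid" where
  "fractional_ideal_group K =
     \<lparr>carrier = fractional_ideals K, monoid.mult = ideal_prod (ring_of_integers K),
      one = carrier (ring_of_integers K)\<rparr>"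

definition class_group :: "complex set \<Rightarrow> complex set set monoid" where
  "class_group K = fractional_ideal_group K Mod principal_fractional_ideals K"

definition class_number :: "complex set \<Rightarrow> nat" where
  "class_number K = Coset.order (class_group K)"

end

theory Submission
  imports
    Defs
    "Jordan_Normal_Form.Char_Poly"
    "HOL-Number_Theory.Quadratic_Reciprocity"
begin

text \<open>
  Suppose that \<open>\<epsilon>\<close> is a unit of norm \<open>-1\<close>. Then \<open>K\<close> is totally real. In the group ring of the Galois
  group \<open>G\<close> over the field with two elements, the sign pattern of \<open>\<epsilon>\<close> is invertible, so the products of
  distinct conjugates of \<open>\<epsilon>\<close> have different signatures. There are at most \<open>2 ^ |G|\<close> square classes of
  units, hence these products represent all of them. It follows that for every \<open>1 \<noteq> \<sigma> \<in> G\<close> a unit \<open>u\<close>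
  with \<open>u \<cdot> \<sigma> u = 1\<close> has the form \<open>\<plusminus> \<sigma> w / w\<close> with a unit \<open>w\<close>.

  Some odd prime \<open>p\<close> ramifies in \<open>K\<close>; let \<open>\<sigma>\<close> generate its inertia group, with fixed field \<open>k\<close>. As
  \<open>m \<ge> 3\<close>, the prime \<open>p\<close> splits in some quadratic subfield of \<open>k\<close>, say into \<open>\<pp>\<close> and \<open>\<pp>'\<close>, and \<open>\<pp>\<close> is
  the square of a \<open>\<sigma>\<close>-invariant ideal of \<open>K\<close>. Since the class number is odd, an odd power of that ideal is
  principal, and by the previous paragraph it has, up to a factor \<open>\<surd>p\<close>, a generator in \<open>k\<close>. This is
  impossible because \<open>k\<close> is unramified at \<open>p\<close>.
\<close>

subsection \<open>Algebraic integers\<close>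

text \<open>The bound on square classes and the count of signatures meet exactly, so the units
  modulo squares form a free module of rank one over the group ring; for an involution this leaves
  only the signs \<open>1\<close> and \<open>- 1\<close> as a defect in Hilbert's theorem 90 for
  units. That sign is the reason for the factor \<surd>p, which \<sigma> negates. Inertia at an odd
  prime is tame, hence cyclic, hence of order two in an elementary abelian 2-group. The bound on
  \<open>m\<close> is spent on one square root that is ramified at \<open>p\<close> and two
  independent ones that can be made unramified; since Legendre symbols multiply, one of the three
  radicands obtained from these two is a residue. The final conflict is one of parity: an element of
  \<open>k\<close> would have a square with odd valuation, while valuations above \<open>p\<close>
  in \<open>k\<close> are normalized by \<open>p\<close> itself. Ideals enter through explicit
  generators, paired with a complementary ideal so that the product is principal; ideal classes
  enter as a set of odd size permuted by such an ideal; valuations above \<open>p\<close> enter as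
  integrality after multiplication by an integer prime to \<open>p\<close>.\<close>

definition zspan :: "'a :: field_char_0 set \<Rightarrow> 'a set" where
  "zspan V = range (\<lambda>c :: 'a \<Rightarrow> int. \<Sum>v\<in>V. of_int (c v) * v)"

lemma zspanI: "x = (\<Sum>v\<in>V. of_int (c v) * v) \<Longrightarrow> x \<in> zspan V"
  unfolding zspan_def by blast

lemma zspanE:
  assumes "x \<in> zspan V"
  obtains c where "x = (\<Sum>v\<in>V. of_int (c v) * v)"
  using assms unfolding zspan_def by blast

lemma zspan_base:
  assumes "finite V" "v \<in> V" shows "v \<in> zspan V"
proof (rule zspanI)
  show "v = (\<Sum>w\<in>V. of_int (if w = v then 1 else 0) * w)"
    using assms by (simp add: if_distrib[of "\<lambda>k. of_int k * _"] cong: if_cong)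
qed

lemma zspan_0: "0 \<in> zspan V"
  by (rule zspanI[where c = "\<lambda>_. 0"]) simp

lemma zspan_add: "x \<in> zspan V \<Longrightarrow> y \<in> zspan V \<Longrightarrow> x + y \<in> zspan V"
proof (elim zspanE)
  fix c d assume "x = (\<Sum>v\<in>V. of_int (c v) * v)" "y = (\<Sum>v\<in>V. of_int (d v) * v)"
  then show ?thesis
    by (intro zspanI[where c = "\<lambda>v. c v + d v"]) (simp add: algebra_simps sum.distrib)
qed

lemma zspan_int_mult: "x \<in> zspan V \<Longrightarrow> of_int k * x \<in> zspan V"
proof (elim zspanE)
  fix c assume "x = (\<Sum>v\<in>V. of_int (c v) * v)"
  then show ?thesis
    by (intro zspanI[where c = "\<lambda>v. k * c v"]) (simp add: sum_distrib_left mult_ac)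
qed

lemma zspan_sum: "(\<And>i. i \<in> J \<Longrightarrow> f i \<in> zspan V) \<Longrightarrow> (\<Sum>i\<in>J. f i) \<in> zspan V"
  by (induction J rule: infinite_finite_induct) (auto intro: zspan_0 zspan_add)

lemma zspan_diff: "x \<in> zspan V \<Longrightarrow> y \<in> zspan V \<Longrightarrow> x - y \<in> zspan V"
  using zspan_add[of x V "of_int (-1) * y"] zspan_int_mult[of y V "-1"] by simp

lemma zspan_mult:
  assumes "\<And>v. v \<in> V \<Longrightarrow> x * v \<in> zspan W" "y \<in> zspan V"
  shows "x * y \<in> zspan W"
proof -
  obtain c where "y = (\<Sum>v\<in>V. of_int (c v) * v)" using assms(2) by (rule zspanE)
  then have "x * y = (\<Sum>v\<in>V. of_int (c v) * (x * v))" by (simp add: sum_distrib_left mult_ac)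
  then show ?thesis using assms(1) by (auto intro!: zspan_sum zspan_int_mult)
qed

text \<open>Determinant trick: multiplication by \<open>x\<close> acts on the generators through an
  integer matrix, the vector of generators is an eigenvector for \<open>x\<close>, and the
  characteristic polynomial is monic and integral. The nonzero \<open>w\<close> keeps the
  eigenvector from vanishing.\<close>

lemma algebraic_int_if_stable:
  fixes x :: "'a :: field_char_0"
  assumes fin: "finite V" and nz: "w \<in> V" "w \<noteq> 0" and st: "\<And>v. v \<in> V \<Longrightarrow> x * v \<in> zspan V"
  shows "algebraic_int x"
proof -
  obtain h n where h: "bij_betw h {0..<n::nat} V"
    using ex_bij_betw_nat_finite[OF fin] by blast
  have "\<forall>v\<in>V. \<exists>c. x * v = (\<Sum>u\<in>V. of_int (c u) * u)" 
    using st by (auto simp: zspan_def)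
  then obtain c where c: "\<And>v. v \<in> V \<Longrightarrow> x * v = (\<Sum>u\<in>V. of_int (c v u :: int) * u)" by metis
  define A where "A = mat n n (\<lambda>(i, j). c (h i) (h j))"
  define B :: "'a mat" where "B = map_mat of_int A"
  define b where "b = vec n h"
  have A: "A \<in> carrier_mat n n" and B: "B \<in> carrier_mat n n" by (auto simp: A_def B_def)
  have hV: "h i \<in> V" if "i < n" for i using h that by (auto simp: bij_betw_def)
  have "B *\<^sub>v b = x \<cdot>\<^sub>v b"
  proof (rule eq_vecI)
    fix i assume "i < dim_vec (x \<cdot>\<^sub>v b)"
    then have i: "i < n" by (simp add: b_def)
    have "(B *\<^sub>v b) $ i = (\<Sum>j\<in>{0..<n}. of_int (c (h i) (h j)) * h j)"
      using i by (simp add: B_def A_def b_def scalar_prod_def)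
    also have "\<dots> = (\<Sum>u\<in>V. of_int (c (h i) u) * u)"
      using sum.reindex_bij_betw[OF h, of "\<lambda>u. of_int (c (h i) u) * u"] .
    also have "\<dots> = (x \<cdot>\<^sub>v b) $ i" using c[OF hV[OF i]] i by (simp add: b_def)
    finally show "(B *\<^sub>v b) $ i = (x \<cdot>\<^sub>v b) $ i" .
  qed (auto simp: B_def A_def b_def)
  moreover have "b \<noteq> 0\<^sub>v n"
  proof
    assume b0: "b = 0\<^sub>v n"
    obtain i where i: "i < n" "h i = w" using h nz(1) by (auto simp: bij_betw_def)
    then have "b $ i = w" by (simp add: b_def)
    with b0 i nz show False by simp
  qed
  ultimately have "eigenvalue B x"
    unfolding eigenvalue_def eigenvector_def using B by (intro exI[of _ b]) (auto simp: b_def)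
  then have "poly (map_poly of_int (char_poly A)) x = 0"
    using eigenvalue_root_char_poly[OF B] of_int_hom.char_poly_hom[OF A]
    unfolding B_def by metis
  moreover have "lead_coeff (char_poly A) = 1" using degree_monic_char_poly[OF A] by auto
  ultimately show ?thesis by (auto simp: algebraic_int_altdef_ipoly)
qed

text \<open>Converse of the determinant trick, with the powers of \<open>a\<close> below the degree
  of a monic equation as generators. The generator \<open>1\<close> is the nonzero element that the
  criterion asks for.\<close>

lemma algebraic_int_stable_set:
  fixes a :: "'a :: field_char_0"
  assumes "algebraic_int a"
  shows "\<exists>V. finite V \<and> 1 \<in> V \<and> (\<forall>v\<in>V. a * v \<in> zspan V)"
proof -
  obtain p where p: "poly (map_poly of_int p) a = 0" "lead_coeff p = 1"
    using assms by (auto simp: algebraic_int_altdef_ipoly)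
  define n where "n = degree p"
  have n: "n > 0"
  proof (rule ccontr)
    assume "\<not> n > 0"
    then obtain k where "p = [:k:]" unfolding n_def by (metis degree_eq_zeroE neq0_conv)
    with p show False by (simp add: map_poly_pCons)
  qed
  define V where "V = (\<lambda>i. a ^ i) ` {..<n}"
  have V: "finite V" "1 \<in> V" using n by (auto simp: V_def intro: image_eqI[of _ _ 0])
  have pw: "a ^ i \<in> zspan V" if "i < n" for i using that V by (auto simp: V_def intro!: zspan_base)
  have "(\<Sum>i\<le>n. of_int (coeff p i) * a ^ i) = 0"
    using p(1) by (simp add: poly_altdef degree_map_poly coeff_map_poly n_def)
  then have "a ^ n = - (\<Sum>i<n. of_int (coeff p i) * a ^ i)"
    using p(2) n by (simp add: n_def lessThan_Suc_atMost[symmetric] add_eq_0_iff2)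
  also have "\<dots> \<in> zspan V" 
    using zspan_diff[OF zspan_0, of "\<Sum>i<n. of_int (coeff p i) * a ^ i" V]
    by (auto intro!: zspan_sum zspan_int_mult pw)
  finally have an: "a ^ n \<in> zspan V" .
  have "a * v \<in> zspan V" if v: "v \<in> V" for v
  proof -
    obtain i where i: "v = a ^ i" "i < n" using v by (auto simp: V_def)
    show ?thesis
    proof (cases "Suc i = n")
      case True then show ?thesis using an i by auto
    next
      case False then have "Suc i < n" using i by simp
      then show ?thesis using pw[of "Suc i"] i by simp
    qed
  qed
  with V show ?thesis by blast
qed

text \<open>Products of generators are stable under both elements at once, so sums and products fall
  under the same criterion.\<close>

lemma algebraic_int_stable_set2:
  fixes a b :: "'a :: field_char_0"
  assumes "algebraic_int a" "algebraic_int b"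
  obtains V where "finite V" "1 \<in> V" "\<And>v. v \<in> zspan V \<Longrightarrow> a * v \<in> zspan V"
    "\<And>v. v \<in> zspan V \<Longrightarrow> b * v \<in> zspan V"
proof -
  obtain V W where V: "finite V" "1 \<in> V" "\<And>v. v \<in> V \<Longrightarrow> a * v \<in> zspan V"
    and W: "finite W" "1 \<in> W" "\<And>v. v \<in> W \<Longrightarrow> b * v \<in> zspan W"
    using assms algebraic_int_stable_set by meson
  define U where "U = (\<lambda>(v, w). v * w) ` (V \<times> W)"
  have U: "finite U" "1 \<in> U" "\<And>v w. v \<in> V \<Longrightarrow> w \<in> W \<Longrightarrow> v * w \<in> U"
    using V W by (auto simp: U_def intro: image_eqI[of _ _ "(1, 1)"])
  have "a * u \<in> zspan U" "b * u \<in> zspan U" if u: "u \<in> U" for u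
  proof -
    obtain v w where vw: "u = v * w" "v \<in> V" "w \<in> W" using u by (auto simp: U_def)
    have "w * (a * v) \<in> zspan U"
      by (rule zspan_mult[OF _ V(3)[OF vw(2)]]) (metis U(1,3) vw(3) mult.commute zspan_base)
    moreover have "v * (b * w) \<in> zspan U"
      by (rule zspan_mult[OF _ W(3)[OF vw(3)]]) (metis U(1,3) vw(2) zspan_base)
    ultimately show "a * u \<in> zspan U" "b * u \<in> zspan U" by (simp_all add: vw(1) mult_ac)
  qed
  then show ?thesis using that[OF U(1,2)] zspan_mult[of U] by blast
qed

lemma algebraic_int_add:
  fixes a b :: "'a :: field_char_0"
  assumes "algebraic_int a" "algebraic_int b"
  shows "algebraic_int (a + b)"
proof -
  obtain V where V: "finite V" "1 \<in> V" "\<And>v. v \<in> zspan V \<Longrightarrow> a * v \<in> zspan V"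
    "\<And>v. v \<in> zspan V \<Longrightarrow> b * v \<in> zspan V" using algebraic_int_stable_set2[OF assms] by metis
  show ?thesis
    by (rule algebraic_int_if_stable[OF V(1,2)])
       (use V in \<open>auto simp: algebra_simps intro!: zspan_add intro: zspan_base\<close>)
qed

lemma algebraic_int_mult:
  fixes a b :: "'a :: field_char_0"
  assumes "algebraic_int a" "algebraic_int b"
  shows "algebraic_int (a * b)"
proof -
  obtain V where V: "finite V" "1 \<in> V" "\<And>v. v \<in> zspan V \<Longrightarrow> a * v \<in> zspan V"
    "\<And>v. v \<in> zspan V \<Longrightarrow> b * v \<in> zspan V" using algebraic_int_stable_set2[OF assms] by metis
  show ?thesis
    by (rule algebraic_int_if_stable[OF V(1,2)])
       (use V in \<open>auto simp: mult.assoc intro: zspan_base\<close>)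
qed

lemma algebraic_int_of_int_mult:
  fixes a :: "'a :: field_char_0"
  shows "algebraic_int a \<Longrightarrow> algebraic_int (of_int k * a)"
  by (rule algebraic_int_mult) simp

lemma algebraic_int_sum:
  fixes f :: "'b \<Rightarrow> 'a :: field_char_0"
  shows "(\<And>i. i \<in> J \<Longrightarrow> algebraic_int (f i)) \<Longrightarrow> algebraic_int (\<Sum>i\<in>J. f i)"
  by (induction J rule: infinite_finite_induct) (auto intro: algebraic_int_add)

lemma algebraic_int_prod:
  fixes f :: "'b \<Rightarrow> 'a :: field_char_0"
  shows "(\<And>i. i \<in> J \<Longrightarrow> algebraic_int (f i)) \<Longrightarrow> algebraic_int (\<Prod>i\<in>J. f i)"
  by (induction J rule: infinite_finite_induct) (auto intro: algebraic_int_mult)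

lemma algebraic_int_power:
  fixes a :: "'a :: field_char_0"
  shows "algebraic_int a \<Longrightarrow> algebraic_int (a ^ n)"
  by (induction n) (auto intro: algebraic_int_mult)

text \<open>Adjoining \<open>z * v\<close> for all generators \<open>v\<close> keeps the module
  stable, because the equation folds \<open>z * z\<close> back. This is transitivity of integrality
  in degree two, enough for square roots and for descent through quadratic towers.\<close>

lemma algebraic_int_monic_quadratic:
  fixes z :: "'a :: field_char_0"
  assumes "algebraic_int a" "algebraic_int b" and z: "z * z = a * z - b"
  shows "algebraic_int z"
proof -
  obtain V where V: "finite V" "1 \<in> V" "\<And>v. v \<in> zspan V \<Longrightarrow> a * v \<in> zspan V"
    "\<And>v. v \<in> zspan V \<Longrightarrow> b * v \<in> zspan V" using algebraic_int_stable_set2[OF assms(1,2)] by metis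
  define U where "U = V \<union> (\<lambda>v. z * v) ` V"
  have U: "finite U" "1 \<in> U" using V by (auto simp: U_def)
  have *: "y \<in> zspan U" "z * y \<in> zspan U" if "y \<in> zspan V" for y
    using zspan_mult[of V 1 U y] zspan_mult[of V z U y] that U(1)
    by (auto simp: U_def intro: zspan_base)
  have "z * u \<in> zspan U" if u: "u \<in> U" for u
  proof (cases "u \<in> V")
    case True then show ?thesis using *(2) zspan_base[OF V(1)] by simp
  next
    case False
    then obtain v where v: "u = z * v" "v \<in> V" using u by (auto simp: U_def)
    have "z * u = (z * z) * v" using v by simp
    also have "\<dots> = z * (a * v) - b * v" unfolding z by (simp only: left_diff_distrib mult.assoc mult.left_commute)
    finally have "z * u = z * (a * v) - b * v" .
    moreover have "z * (a * v) \<in> zspan U" "b * v \<in> zspan U"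
      using *(1)[OF V(4)] *(2)[OF V(3)] zspan_base[OF V(1) v(2)] by simp_all
    ultimately show ?thesis by (simp add: zspan_diff)
  qed
  then show ?thesis using algebraic_int_if_stable[OF U, of z] by simp
qed

lemma algebraic_int_power_imp:
  fixes z :: "'a :: field_char_0"
  assumes "algebraic_int (z ^ 2)" shows "algebraic_int z"
proof (rule algebraic_int_monic_quadratic[of 0 "- (z ^ 2)"])
  show "algebraic_int (- (z ^ 2))" using assms by blast
  show "z * z = 0 * z - - (z ^ 2)" unfolding power2_eq_square by simp
qed simp

subsection \<open>Integrality at a prime\<close>

text \<open>Membership in the integral closure of the integers localized at \<open>p\<close>:
  nonnegativity of all valuations above \<open>p\<close>, without naming a prime ideal.\<close>

definition p_integral :: "int \<Rightarrow> 'a :: field_char_0 \<Rightarrow> bool" where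
  "p_integral p z \<longleftrightarrow> (\<exists>N. \<not> p dvd N \<and> algebraic_int (of_int N * z))"

context
  fixes p :: int
  assumes p: "prime p"
begin

lemma p_integral_algebraic_int: "algebraic_int z \<Longrightarrow> p_integral p z"
  unfolding p_integral_def using p by (intro exI[of _ 1]) (auto dest: not_prime_unit)

lemma p_integral_add:
  assumes "p_integral p x" "p_integral p y" shows "p_integral p (x + y)"
proof -
  obtain M N where "\<not> p dvd M" "\<not> p dvd N" and MN: "algebraic_int (of_int M * x)" "algebraic_int (of_int N * y)"
    using assms unfolding p_integral_def by blast
  then have "\<not> p dvd M * N" using p by (simp add: prime_dvd_mult_iff)
  moreover have "algebraic_int (of_int N * (of_int M * x) + of_int M * (of_int N * y))"
    by (intro algebraic_int_add algebraic_int_of_int_mult[OF MN(1)] algebraic_int_of_int_mult[OF MN(2)])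
  then have "algebraic_int (of_int (M * N) * (x + y))" by (simp add: algebra_simps)
  ultimately show ?thesis unfolding p_integral_def by blast
qed

lemma p_integral_mult:
  assumes "p_integral p x" "p_integral p y" shows "p_integral p (x * y)"
proof -
  obtain M N where "\<not> p dvd M" "\<not> p dvd N" and MN: "algebraic_int (of_int M * x)" "algebraic_int (of_int N * y)"
    using assms unfolding p_integral_def by blast
  then have "\<not> p dvd M * N" using p by (simp add: prime_dvd_mult_iff)
  moreover have "algebraic_int ((of_int M * x) * (of_int N * y))" using MN by (rule algebraic_int_mult)
  then have "algebraic_int (of_int (M * N) * (x * y))" by (simp add: mult_ac)
  ultimately show ?thesis unfolding p_integral_def by blast
qed

lemma p_integral_power: "p_integral p x \<Longrightarrow> p_integral p (x ^ n)"
  by (induction n) (auto intro: p_integral_mult p_integral_algebraic_int)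

lemma p_integral_sum: "(\<And>i. i \<in> J \<Longrightarrow> p_integral p (f i)) \<Longrightarrow> p_integral p (\<Sum>i\<in>J. f i)"
  by (induction J rule: infinite_finite_induct) (auto intro: p_integral_add p_integral_algebraic_int)

text \<open>A denominator \<open>N\<close> of the square also clears \<open>x\<close>, since
  \<open>(N x)^2 = N (N x^2)\<close>.\<close>

lemma p_integral_power2_imp:
  assumes "p_integral p (x ^ 2)" shows "p_integral p x"
proof -
  obtain N where N: "\<not> p dvd N" "algebraic_int (of_int N * x ^ 2)"
    using assms unfolding p_integral_def by blast
  have "algebraic_int (of_int N * (of_int N * x ^ 2))"
    using N(2) by (rule algebraic_int_of_int_mult)
  then have "algebraic_int ((of_int N * x) ^ 2)" by (simp add: power2_eq_square mult_ac)
  then show ?thesis using N(1) algebraic_int_power_imp unfolding p_integral_def by blast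
qed

lemma p_integral_of_int: "p_integral p (of_int k)"
  by (rule p_integral_algebraic_int) simp

lemma p_integral_inverse_of_int: "\<not> p dvd k \<Longrightarrow> p_integral p (1 / of_int k)"
  unfolding p_integral_def by (intro exI[of _ k]) auto

lemma not_p_integral_inverse: "\<not> p_integral p (1 / of_int p :: 'a :: field_char_0)"
proof
  assume "p_integral p (1 / of_int p :: 'a)"
  then obtain N where N: "\<not> p dvd N" "algebraic_int (of_int N / of_int p :: 'a)"
    unfolding p_integral_def by auto
  then have "(of_int N / of_int p :: 'a) \<in> \<int>" by (intro rational_algebraic_int_is_int) auto
  then obtain k where "(of_int N / of_int p :: 'a) = of_int k" by (auto elim: Ints_cases)
  then have "(of_int N :: 'a) = of_int (k * p)" using p by (simp add: field_simps)
  then have "N = k * p" by (simp only: of_int_eq_iff)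
  with N show False by simp
qed

text \<open>The \<open>p\<close>-adic valuation of a rational number is an integer, so if it is at
  least one half, it is at least 1. Traces later carry this to fields unramified at
  \<open>p\<close>.\<close>

lemma p_integral_rational_square_div:
  fixes c :: "'a :: field_char_0"
  assumes "c \<in> \<rat>" "p_integral p (c ^ 2 / of_int p)"
  shows "p_integral p (c / of_int p)"
proof -
  obtain a b where ab: "b > 0" "Rings.coprime a b" "c = of_int a / of_int b"
    using assms(1) by (auto elim: Rats_cases')
  have p0: "p \<noteq> 0" using p by auto
  obtain N where N: "\<not> p dvd N" "algebraic_int (of_int N * (c ^ 2 / of_int p))"
    using assms(2) unfolding p_integral_def by blast
  then have "of_int N * (c ^ 2 / of_int p) \<in> \<int>"
    using assms(1) by (intro rational_algebraic_int_is_int) auto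
  then obtain k where "of_int N * (c ^ 2 / of_int p) = of_int k" by (auto elim: Ints_cases)
  then have "(of_int (N * a ^ 2) :: 'a) = of_int (k * p * b ^ 2)"
    using ab(1,3) p0 by (simp add: field_simps)
  then have "N * a ^ 2 = k * p * b ^ 2" by (simp only: of_int_eq_iff)
  then have "p dvd N * a ^ 2" by simp
  then have pa: "p dvd a" using N(1) p by (simp add: prime_dvd_mult_iff prime_dvd_power_iff)
  have "\<not> p dvd b" using pa ab(2) p by (meson coprime_common_divisor not_prime_unit)
  moreover obtain a' where "a = p * a'" using pa by blast
  then have "c / of_int p = of_int a' * (1 / of_int b)" using ab(3) p0 by simp
  ultimately show ?thesis
    by (metis p_integral_mult p_integral_of_int p_integral_inverse_of_int)
qed

end

subsection \<open>Automorphisms of multiquadratic fields\<close>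

abbreviation (input) sdiff :: "'i set \<Rightarrow> 'i set \<Rightarrow> 'i set" (infixl "\<triangle>" 65) where
  "S \<triangle> T \<equiv> (S - T) \<union> (T - S)"

lemma prod_sdiff:
  fixes f :: "'i \<Rightarrow> 'a :: comm_monoid_mult"
  assumes "finite S" "finite T"
  shows "prod f S * prod f T = prod f (S \<triangle> T) * (prod f (S \<inter> T))\<^sup>2"
proof -
  have "prod f S = prod f (S - T) * prod f (S \<inter> T)"
    using assms by (subst prod.union_disjoint[symmetric]) (auto intro: arg_cong[of _ _ "prod f"])
  moreover have "prod f T = prod f (T - S) * prod f (S \<inter> T)"
    using assms by (subst prod.union_disjoint[symmetric]) (auto intro: arg_cong[of _ _ "prod f"])
  moreover have "prod f (S \<triangle> T) = prod f (S - T) * prod f (T - S)"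
    using assms by (subst prod.union_disjoint[symmetric]) auto
  ultimately show ?thesis by (simp add: power2_eq_square mult_ac)
qed

text \<open>Finite subsets form an elementary abelian 2-group under symmetric difference, and this
  is its pairing with itself. \<open>A\<close> stands for a Galois element, \<open>S\<close> for a
  product of square roots; integer values serve both as coefficients and as exponents.\<close>

definition chi :: "'i set \<Rightarrow> 'i set \<Rightarrow> int" where
  "chi A S = (- 1) ^ card (A \<inter> S)"

lemma chi_commute: "chi A S = chi S A"
  by (simp add: chi_def Int_commute)

lemma chi_empty [simp]: "chi {} S = 1" "chi S {} = 1"
  by (simp_all add: chi_def)

lemma chi_singleton: "chi {i} S = (if i \<in> S then - 1 else 1)" "chi S {i} = (if i \<in> S then - 1 else 1)"
  by (auto simp: chi_def)

lemma chi_square [simp]: "chi A S * chi A S = 1"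
  by (simp add: chi_def flip: power_add)

lemma chi_cases: "chi A S = 1 \<or> chi A S = - 1"
  by (cases "even (card (A \<inter> S))") (auto simp: chi_def)

lemma chi_eq_prod: "finite S \<Longrightarrow> chi A S = (\<Prod>i\<in>S. if i \<in> A then - 1 else 1)"
  by (simp add: chi_def prod.If_cases Int_commute flip: Int_def)

lemma chi_sdiff_right:
  assumes "finite S" "finite T" shows "chi A (S \<triangle> T) = chi A S * chi A T"
proof -
  have "(chi A (S \<inter> T))\<^sup>2 = 1" by (simp add: power2_eq_square)
  moreover have "chi A S * chi A T = chi A (S \<triangle> T) * (chi A (S \<inter> T))\<^sup>2"
    using prod_sdiff[OF assms] assms by (simp add: chi_eq_prod)
  ultimately show ?thesis by simp
qed

lemma chi_sdiff_left:
  "finite A \<Longrightarrow> finite B \<Longrightarrow> chi (A \<triangle> B) S = chi A S * chi B S"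
  using chi_sdiff_right[of A B S] by (simp add: chi_commute)

lemma sdiff_cancel [simp]: "(A \<triangle> B) \<triangle> B = A" by blast

lemma bij_betw_sdiff: "B \<subseteq> I \<Longrightarrow> bij_betw (\<lambda>A. A \<triangle> B) (Pow I) (Pow I)"
  by (rule bij_betwI[where g = "\<lambda>A. A \<triangle> B"]) auto

text \<open>Orthogonality: shifting the summation by an element of \<open>A\<close> changes the sign
  of every term.\<close>

lemma sum_chi:
  assumes "finite I" "A \<subseteq> I"
  shows "(\<Sum>S\<in>Pow I. chi A S) = (if A = {} then 2 ^ card I else 0)"
proof (cases "A = {}")
  case True then show ?thesis using assms by (simp add: card_Pow)
next
  case False
  then obtain i where i: "i \<in> A" by blast
  have "(\<Sum>S\<in>Pow I. chi A S) = (\<Sum>S\<in>Pow I. chi A (S \<triangle> {i}))"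
    using i assms by (intro sum.reindex_bij_betw[OF bij_betw_sdiff, symmetric]) auto
  also have "\<dots> = (\<Sum>S\<in>Pow I. - chi A S)"
    using i assms(1) by (intro sum.cong) (auto simp: chi_sdiff_right finite_subset chi_singleton)
  finally show ?thesis using False by (simp add: sum_negf)
qed

text \<open>Independence of all \<open>2 ^ card I\<close> products makes them a basis of the field,
  so automorphisms are given by explicit formulas on coefficients. Each \<open>s i\<close> may be
  either root of its radicand.\<close>

locale multiquadratic =
  fixes I :: "'i set" and d :: "'i \<Rightarrow> int" and s :: "'i \<Rightarrow> complex"
  assumes finite_I [simp]: "finite I"
    and s_square: "i \<in> I \<Longrightarrow> (s i)\<^sup>2 = of_int (d i)"
    and independent: "(\<Sum>S\<in>Pow I. of_rat (c S) * prod s S) = 0 \<Longrightarrow> S \<in> Pow I \<Longrightarrow> c S = 0"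
begin

definition lin :: "('i set \<Rightarrow> rat) \<Rightarrow> complex" where
  "lin c = (\<Sum>S\<in>Pow I. of_rat (c S) * prod s S)"

definition K :: "complex set" where "K = range lin"

text \<open>Coefficients are unique only at subsets of \<open>I\<close>; elsewhere the choice is
  arbitrary, which is why equalities of coefficients are restricted to
  \<open>S \<subseteq> I\<close>.\<close>

definition coord :: "complex \<Rightarrow> 'i set \<Rightarrow> rat" where
  "coord z = (SOME c. lin c = z)"

text \<open>\<open>gal A\<close> is the automorphism of \<open>K\<close> that changes the sign of \<open>s i\<close> exactly for \<open>i \<in> A\<close>.\<close>

definition gal :: "'i set \<Rightarrow> complex \<Rightarrow> complex" where
  "gal A z = lin (\<lambda>S. of_int (chi A S) * coord z S)"

lemma finite_sub: "A \<subseteq> I \<Longrightarrow> finite A" using finite_I finite_subset by blast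

lemma lin_add: "lin c + lin c' = lin (\<lambda>S. c S + c' S)"
  by (simp add: lin_def of_rat_add sum.distrib algebra_simps)

lemma lin_smult: "of_rat a * lin c = lin (\<lambda>S. a * c S)"
  by (simp add: lin_def of_rat_mult sum_distrib_left mult_ac)

lemma lin_inject:
  assumes "lin c = lin c'" "S \<subseteq> I" shows "c S = c' S"
proof -
  have "lin (\<lambda>S. c S - c' S) = 0"
    using assms(1) by (simp add: lin_def of_rat_diff left_diff_distrib sum_subtractf)
  then show ?thesis using independent[of "\<lambda>S. c S - c' S" S] assms(2) by (simp add: lin_def)
qed

lemma lin_cong: "(\<And>S. S \<subseteq> I \<Longrightarrow> c S = c' S) \<Longrightarrow> lin c = lin c'"
  unfolding lin_def by (intro sum.cong) auto

lemma K_cases [consumes 1, case_names lin]: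
  assumes "z \<in> K" obtains c where "z = lin c"
  using assms unfolding K_def by blast

lemma lin_in_K [simp]: "lin c \<in> K" by (simp add: K_def)

lemma coord_lin:
  assumes "S \<subseteq> I" shows "coord (lin c) S = c S"
proof -
  have "lin (coord (lin c)) = lin c" unfolding coord_def by (rule someI[of _ c]) (rule refl)
  then show ?thesis using lin_inject assms by blast
qed

lemma gal_lin: "gal A (lin c) = lin (\<lambda>S. of_int (chi A S) * c S)"
  unfolding gal_def by (rule lin_cong) (simp add: coord_lin)

lemma gal_in_K [simp]: "gal A z \<in> K" by (simp add: gal_def)

lemma gal_add: "z \<in> K \<Longrightarrow> w \<in> K \<Longrightarrow> gal A (z + w) = gal A z + gal A w"
  by (elim K_cases) (simp add: gal_lin lin_add algebra_simps)

lemma gal_smult: "z \<in> K \<Longrightarrow> gal A (of_rat a * z) = of_rat a * gal A z"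
  by (elim K_cases) (simp add: gal_lin lin_smult algebra_simps)

lemma smult_in_K: "z \<in> K \<Longrightarrow> of_rat a * z \<in> K"
  by (elim K_cases) (simp add: lin_smult)

lemma add_in_K: "z \<in> K \<Longrightarrow> w \<in> K \<Longrightarrow> z + w \<in> K"
  by (elim K_cases) (simp add: lin_add)

lemma prod_s_eq_lin: "S \<subseteq> I \<Longrightarrow> prod s S = lin (\<lambda>T. if T = S then 1 else 0)"
  unfolding lin_def by (subst sum.remove[of _ S]) (auto simp: )

lemma prod_s_in_K: "S \<subseteq> I \<Longrightarrow> prod s S \<in> K"
  by (simp add: prod_s_eq_lin)

lemma gal_prod_s:
  assumes "S \<subseteq> I" shows "gal A (prod s S) = of_int (chi A S) * prod s S"
proof -
  have "gal A (prod s S) = lin (\<lambda>T. of_int (chi A S) * (if T = S then 1 else 0))"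
    unfolding prod_s_eq_lin[OF assms] gal_lin by (rule lin_cong) simp
  also have "\<dots> = of_rat (of_int (chi A S)) * prod s S"
    by (simp only: lin_smult[symmetric] prod_s_eq_lin[OF assms])
  finally show ?thesis by simp
qed

lemma zero_in_K [simp]: "0 \<in> K"
  unfolding K_def by (rule range_eqI[of _ _ "\<lambda>_. 0"]) (simp add: lin_def)

lemma sum_in_K: "(\<And>j. j \<in> J \<Longrightarrow> f j \<in> K) \<Longrightarrow> (\<Sum>j\<in>J. f j) \<in> K"
  by (induction J rule: infinite_finite_induct) (auto intro: add_in_K)

lemma gal_0 [simp]: "gal A 0 = 0"
  using gal_smult[OF zero_in_K, of A 0] by simp

lemma gal_sum: "(\<And>j. j \<in> J \<Longrightarrow> f j \<in> K) \<Longrightarrow> gal A (\<Sum>j\<in>J. f j) = (\<Sum>j\<in>J. gal A (f j))"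
  by (induction J rule: infinite_finite_induct) (auto simp: gal_add sum_in_K)

lemma prod_s_mult:
  assumes "S \<subseteq> I" "T \<subseteq> I"
  shows "prod s S * prod s T = of_rat (of_int (prod d (S \<inter> T))) * prod s (S \<triangle> T)"
proof -
  have "(prod s (S \<inter> T))\<^sup>2 = (\<Prod>i\<in>S \<inter> T. of_int (d i))"
    unfolding prod_power_distrib using assms by (intro prod.cong) (auto simp: s_square)
  then have "(prod s (S \<inter> T))\<^sup>2 = of_rat (of_int (prod d (S \<inter> T)))"
    by (simp only: of_rat_of_int_eq) (simp only: of_int_prod)
  then show ?thesis using prod_sdiff[of S T s] assms by (simp only: finite_sub mult.commute)
qed

lemma mult_lin:
  "lin c * lin c' = (\<Sum>S\<in>Pow I. \<Sum>T\<in>Pow I. of_rat (c S * c' T * of_int (prod d (S \<inter> T))) * prod s (S \<triangle> T))"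
  unfolding lin_def sum_product
proof (intro sum.cong refl)
  fix S T assume "S \<in> Pow I" "T \<in> Pow I"
  then have "of_rat (c S) * of_rat (c' T) * (prod s S * prod s T) =
      of_rat (c S * c' T * of_int (prod d (S \<inter> T))) * prod s (S \<triangle> T)"
    by (simp add: prod_s_mult of_rat_mult)
  then show "of_rat (c S) * prod s S * (of_rat (c' T) * prod s T) =
      of_rat (c S * c' T * of_int (prod d (S \<inter> T))) * prod s (S \<triangle> T)"
    by (simp add: mult_ac)
qed

lemma mult_in_K: "z \<in> K \<Longrightarrow> w \<in> K \<Longrightarrow> z * w \<in> K"
  by (elim K_cases) (auto simp: mult_lin intro!: sum_in_K smult_in_K prod_s_in_K)

lemma gal_mult:
  assumes "z \<in> K" "w \<in> K" shows "gal A (z * w) = gal A z * gal A w"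
proof -
  obtain c where "z = lin c" using assms(1) by (rule K_cases)
  moreover obtain c' where "w = lin c'" using assms(2) by (rule K_cases)
  ultimately have c: "z = lin c" "w = lin c'" by simp_all
  let ?a = "\<lambda>S T. c S * c' T * of_int (prod d (S \<inter> T))"
  have K: "of_rat (?a S T) * prod s (S \<triangle> T) \<in> K" if "S \<in> Pow I" "T \<in> Pow I" for S T
    using that by (intro smult_in_K prod_s_in_K) auto
  have "gal A (z * w) = (\<Sum>S\<in>Pow I. \<Sum>T\<in>Pow I. gal A (of_rat (?a S T) * prod s (S \<triangle> T)))"
    unfolding c mult_lin using K by (intro gal_sum[THEN trans] sum_in_K sum.cong gal_sum refl)
  also have "\<dots> = (\<Sum>S\<in>Pow I. \<Sum>T\<in>Pow I. of_rat (?a S T * of_int (chi A S * chi A T)) * prod s (S \<triangle> T))"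
  proof (intro sum.cong refl)
    fix S T assume ST: "S \<in> Pow I" "T \<in> Pow I"
    have "gal A (of_rat (?a S T) * prod s (S \<triangle> T)) = of_rat (?a S T) * (of_int (chi A (S \<triangle> T)) * prod s (S \<triangle> T))"
      using ST by (subst gal_smult[OF prod_s_in_K]) (auto simp del: of_int_prod simp: gal_prod_s intro!: arg_cong2[of _ _ _ _ "(*)"] gal_prod_s)
    then show "gal A (of_rat (?a S T) * prod s (S \<triangle> T)) = of_rat (?a S T * of_int (chi A S * chi A T)) * prod s (S \<triangle> T)"
      using ST by (simp add: chi_sdiff_right finite_sub of_rat_mult del: of_int_prod)
  qed
  also have "\<dots> = gal A z * gal A w"
    unfolding c gal_lin mult_lin by (intro sum.cong refl) (simp add: mult_ac)
  finally show ?thesis .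
qed

lemma one_in_K [simp]: "1 \<in> K" using prod_s_in_K[of "{}"] by simp

lemma gal_1 [simp]: "gal A 1 = 1" using gal_prod_s[of "{}"] by simp

lemma of_rat_in_K [simp]: "of_rat a \<in> K" using smult_in_K[OF one_in_K, of a] by simp

lemma gal_of_rat [simp]: "gal A (of_rat a) = of_rat a" using gal_smult[OF one_in_K, of A a] by simp

lemma of_int_in_K [simp]: "of_int k \<in> K" using of_rat_in_K[of "of_int k"] by simp

lemma gal_of_int [simp]: "gal A (of_int k) = of_int k" using gal_of_rat[of A "of_int k"] by simp

lemma minus_in_K: "z \<in> K \<Longrightarrow> - z \<in> K" using smult_in_K[of z "-1"] by simp

lemma gal_minus: "z \<in> K \<Longrightarrow> gal A (- z) = - gal A z" using gal_smult[of z A "-1"] by simp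

lemma diff_in_K: "z \<in> K \<Longrightarrow> w \<in> K \<Longrightarrow> z - w \<in> K" using add_in_K[of z "- w"] minus_in_K by simp

lemma gal_diff: "z \<in> K \<Longrightarrow> w \<in> K \<Longrightarrow> gal A (z - w) = gal A z - gal A w"
  using gal_add[of z "- w"] minus_in_K gal_minus by simp

lemma prod_in_K: "(\<And>j. j \<in> J \<Longrightarrow> f j \<in> K) \<Longrightarrow> (\<Prod>j\<in>J. f j) \<in> K"
  by (induction J rule: infinite_finite_induct) (auto intro: mult_in_K)

lemma gal_prod: "(\<And>j. j \<in> J \<Longrightarrow> f j \<in> K) \<Longrightarrow> gal A (\<Prod>j\<in>J. f j) = (\<Prod>j\<in>J. gal A (f j))"
  by (induction J rule: infinite_finite_induct) (auto simp: gal_mult prod_in_K)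

lemma power_in_K: "z \<in> K \<Longrightarrow> z ^ n \<in> K"
  by (induction n) (auto intro: mult_in_K)

lemma gal_power: "z \<in> K \<Longrightarrow> gal A (z ^ n) = gal A z ^ n"
  by (induction n) (auto simp: gal_mult power_in_K)

lemma gal_empty [simp]: "z \<in> K \<Longrightarrow> gal {} z = z"
  by (elim K_cases) (simp add: gal_lin)

lemma gal_gal:
  assumes "z \<in> K" "A \<subseteq> I" "B \<subseteq> I" shows "gal A (gal B z) = gal (A \<triangle> B) z"
  using assms(1)
proof (cases rule: K_cases)
  case (lin c)
  show ?thesis unfolding lin gal_lin using assms(2,3)
    by (intro lin_cong) (simp add: chi_sdiff_left finite_sub)
qed

lemma gal_gal_same [simp]: "z \<in> K \<Longrightarrow> A \<subseteq> I \<Longrightarrow> gal A (gal A z) = z"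
  by (simp add: gal_gal)

lemma gal_eq_0_iff: "z \<in> K \<Longrightarrow> A \<subseteq> I \<Longrightarrow> gal A z = 0 \<longleftrightarrow> z = 0"
  by (metis gal_0 gal_gal_same)

text \<open>Sign changes at single indices generate the Galois group, and one at an index in
  \<open>S\<close> negates the coefficient of \<open>S\<close>, so only the constant coefficient
  survives.\<close>

lemma rational_if_fixed:
  assumes "z \<in> K" "\<And>i. i \<in> I \<Longrightarrow> gal {i} z = z" shows "z \<in> \<rat>"
  using assms(1)
proof (cases rule: K_cases)
  case (lin c)
  have "c S = 0" if S: "S \<subseteq> I" "S \<noteq> {}" for S
  proof -
    obtain i where i: "i \<in> S" using S by blast
    have "gal {i} z = z" using assms(2) i S by blast
    then have "of_int (chi {i} S) * c S = c S"
      unfolding lin gal_lin using lin_inject S(1) by blast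
    then show ?thesis using i by (simp add: chi_singleton)
  qed
  then have "z = lin (\<lambda>S. if S = {} then c {} else 0)" unfolding lin by (intro lin_cong) auto
  also have "\<dots> = of_rat (c {})" unfolding lin_def by (subst sum.remove[of _ "{}"]) auto
  finally show ?thesis by simp
qed

lemma prod_gal_reindex:
  assumes "z \<in> K" "B \<subseteq> I"
  shows "(\<Prod>A\<in>Pow I. gal B (gal A z)) = (\<Prod>A\<in>Pow I. gal A z)"
proof -
  have "(\<Prod>A\<in>Pow I. gal B (gal A z)) = (\<Prod>A\<in>Pow I. gal (A \<triangle> B) z)"
    using assms by (intro prod.cong) (auto simp: gal_gal Un_commute)
  also have "\<dots> = (\<Prod>A\<in>Pow I. gal A z)"
    by (rule prod.reindex_bij_betw[OF bij_betw_sdiff[OF assms(2)]])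
  finally show ?thesis .
qed

lemma norm_rational: "z \<in> K \<Longrightarrow> (\<Prod>A\<in>Pow I. gal A z) \<in> \<rat>"
  by (rule rational_if_fixed) (auto simp: gal_prod prod_gal_reindex intro!: prod_in_K)

text \<open>\<open>z\<close> times the product of its other conjugates is the norm, a nonzero
  rational when \<open>z\<close> is nonzero.\<close>

lemma inverse_in_K:
  assumes "z \<in> K" shows "inverse z \<in> K"
proof (cases "z = 0")
  case False
  let ?N = "\<Prod>A\<in>Pow I. gal A z" and ?M = "\<Prod>A\<in>Pow I - {{}}. gal A z"
  have N: "?N = z * ?M" using assms by (subst prod.remove[of _ "{}"]) auto
  obtain a where a: "?N = of_rat a" using norm_rational[OF assms] by (auto elim: Rats_cases)
  have "?N \<noteq> 0" using False assms by (auto simp: prod_zero_iff gal_eq_0_iff)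
  then have "inverse z = inverse ?N * ?M"
    using N by (simp add: field_simps)
  then have "inverse z = of_rat (inverse a) * ?M" by (simp only: a of_rat_inverse)
  then show ?thesis by (auto intro!: smult_in_K prod_in_K)
qed simp

lemma divide_in_K: "z \<in> K \<Longrightarrow> w \<in> K \<Longrightarrow> z / w \<in> K"
  by (simp add: divide_inverse mult_in_K inverse_in_K)

lemma gal_inverse:
  assumes "z \<in> K" shows "gal A (inverse z) = inverse (gal A z)"
proof (cases "z = 0")
  case False
  have "gal A z * gal A (inverse z) = 1"
    using gal_mult[OF assms inverse_in_K[OF assms], of A] False by simp
  then show ?thesis by (metis inverse_unique)
qed simp

lemma gal_divide: "z \<in> K \<Longrightarrow> w \<in> K \<Longrightarrow> gal A (z / w) = gal A z / gal A w"
  by (simp add: divide_inverse gal_mult inverse_in_K gal_inverse)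

lemma gal_of_int_mult: "z \<in> K \<Longrightarrow> gal A (of_int k * z) = of_int k * gal A z"
  by (simp add: gal_mult)

lemma of_int_mult_in_K: "z \<in> K \<Longrightarrow> of_int k * z \<in> K"
  by (simp add: mult_in_K)

lemma gal_ipoly:
  "z \<in> K \<Longrightarrow> poly (map_poly of_int p) z \<in> K \<and>
    gal A (poly (map_poly of_int p) z) = poly (map_poly of_int p) (gal A z)"
  by (induction p) (auto simp: map_poly_pCons gal_add gal_mult mult_in_K add_in_K)

lemma algebraic_int_gal:
  assumes "z \<in> K" "algebraic_int z" shows "algebraic_int (gal A z)"
proof -
  obtain p where "poly (map_poly of_int p) z = 0" "lead_coeff p = 1"
    using assms(2) by (auto simp: algebraic_int_altdef_ipoly)
  then show ?thesis using gal_ipoly[OF assms(1), of p A] by (auto simp: algebraic_int_altdef_ipoly)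
qed

lemma p_integral_gal: "z \<in> K \<Longrightarrow> p_integral p z \<Longrightarrow> p_integral p (gal A z)"
  unfolding p_integral_def using algebraic_int_gal[of "of_int _ * z" A] of_int_mult_in_K
  by (auto simp: gal_of_int_mult)

text \<open>Fourier inversion on the Galois group: \<open>z\<close> is recovered from its twisted
  traces up to the factor \<open>2 ^ card I\<close>, which is harmless at an odd prime.\<close>

lemma sum_chi_gal:
  assumes "z \<in> K"
  shows "(\<Sum>S\<in>Pow I. \<Sum>A\<in>Pow I. of_int (chi A S) * gal A z) = 2 ^ card I * z"
proof -
  have "(\<Sum>S\<in>Pow I. \<Sum>A\<in>Pow I. of_int (chi A S) * gal A z) =
      (\<Sum>A\<in>Pow I. of_int (\<Sum>S\<in>Pow I. chi A S) * gal A z)"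
    by (subst sum.swap) (simp add: sum_distrib_right)
  also have "\<dots> = (\<Sum>A\<in>Pow I. if A = {} then 2 ^ card I * z else 0)"
    using assms by (intro sum.cong) (auto simp: sum_chi[OF finite_I])
  also have "\<dots> = 2 ^ card I * z" by (subst sum.delta) auto
  finally show ?thesis .
qed

end

subsection \<open>Fields generated by square roots\<close>

text \<open>Each vector raises the dimension by one or leaves it unchanged, so the dimension reaches
  the length only if every vector was new.\<close>

lemma (in ring) dimension_Span:
  assumes K: "subfield K R" and "set Us \<subseteq> carrier R"
  shows "\<exists>n \<le> length Us. dimension n K (Span K Us) \<and> (n = length Us \<longrightarrow> independent K Us)"
  using assms(2)
proof (induction Us)
  case Nil then show ?case by auto
next
  case (Cons u Us)
  then obtain n where n: "n \<le> length Us" "dimension n K (Span K Us)" "n = length Us \<longrightarrow> independent K Us"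
    by auto
  have u: "u \<in> carrier R" and Us: "set Us \<subseteq> carrier R" using Cons by auto
  show ?case
  proof (cases "u \<in> Span K Us")
    case True
    have "Span K (u # Us) \<subseteq> Span K Us"
    proof
      fix v assume "v \<in> Span K (u # Us)"
      then obtain k w where "k \<in> K" "w \<in> Span K Us" "v = k \<otimes> u \<oplus> w"
        using line_extension_mem_iff by auto
      then show "v \<in> Span K Us"
        using Span_smult_closed[OF K Us] Span_subgroup_props(3)[OF K Us] True by auto
    qed
    then have "Span K (u # Us) = Span K Us" using mono_Span[OF K Us u] by blast
    then show ?thesis using n(1,2) by (intro exI[of _ n]) simp
  next
    case False
    then have "dimension (Suc n) K (Span K (u # Us))" using n(2) u by (simp add: Suc_dim)
    moreover have "Suc n = length (u # Us) \<longrightarrow> independent K (u # Us)"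
      using n(3) False u by (simp add: li_Cons)
    ultimately show ?thesis using n(1) by (intro exI[of _ "Suc n"]) (simp del: Span.simps)
  qed
qed

lemma (in ring) independent_if_dimension_Span:
  assumes K: "subfield K R" and "set Us \<subseteq> carrier R" "dimension (length Us) K (Span K Us)"
  shows "independent K Us"
  using dimension_Span[OF assms(1,2)] dimension_is_inj[OF K assms(3)] by blast

interpretation C: cring complex_field
  by (rule cring_from_type_algebra)

lemma complex_field_simps [simp]:
  "carrier complex_field = UNIV" "x \<otimes>\<^bsub>complex_field\<^esub> y = x * y" "x \<oplus>\<^bsub>complex_field\<^esub> y = x + y"
  "\<one>\<^bsub>complex_field\<^esub> = 1" "\<zero>\<^bsub>complex_field\<^esub> = 0"
  by (simp_all add: ring_of_type_algebra_def)

lemma complex_field_uminus [simp]: "\<ominus>\<^bsub>complex_field\<^esub> x = - x"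
  by (rule C.minus_equality) simp_all

lemma complex_field_inv: "x \<noteq> 0 \<Longrightarrow> inv\<^bsub>complex_field\<^esub> x = inverse x"
  by (rule C.comm_inv_char) simp_all

lemma subfield_Rats: "subfield \<rat> complex_field"
proof (rule field.subfieldI'[OF field_from_type_algebra])
  show "subring \<rat> complex_field" by (rule C.subringI) auto
qed (auto simp: complex_field_inv)

definition closed_field :: "complex set \<Rightarrow> bool" where
  "closed_field F \<longleftrightarrow> 1 \<in> F \<and> (\<forall>x\<in>F. \<forall>y\<in>F. x - y \<in> F \<and> x * y \<in> F) \<and> (\<forall>x\<in>F. inverse x \<in> F)"

lemma closed_fieldD:
  assumes "closed_field F"
  shows "1 \<in> F" "0 \<in> F" "x \<in> F \<Longrightarrow> - x \<in> F" "x \<in> F \<Longrightarrow> y \<in> F \<Longrightarrow> x + y \<in> F"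
    "x \<in> F \<Longrightarrow> y \<in> F \<Longrightarrow> x - y \<in> F" "x \<in> F \<Longrightarrow> y \<in> F \<Longrightarrow> x * y \<in> F" "x \<in> F \<Longrightarrow> inverse x \<in> F"
proof -
  show 1: "1 \<in> F" and d: "\<And>x y. x \<in> F \<Longrightarrow> y \<in> F \<Longrightarrow> x - y \<in> F" and "x \<in> F \<Longrightarrow> inverse x \<in> F"
    "x \<in> F \<Longrightarrow> y \<in> F \<Longrightarrow> x * y \<in> F"
    using assms by (auto simp: closed_field_def)
  show 0: "0 \<in> F" using d[OF 1 1] by simp
  show m: "\<And>x. x \<in> F \<Longrightarrow> - x \<in> F" using d[OF 0] by simp
  show "x \<in> F \<Longrightarrow> y \<in> F \<Longrightarrow> x + y \<in> F" using d[of x "- y"] m by simp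
qed

lemma rat_adjoin_subset:
  assumes F: "closed_field F" and "\<rat> \<subseteq> F" "S \<subseteq> F"
  shows "rat_adjoin S \<subseteq> F"
proof
  fix x assume "x \<in> rat_adjoin S"
  then have "x \<in> generate_field complex_field (\<rat> \<union> S)" by (simp add: rat_adjoin_def)
  then show "x \<in> F"
    by induction (use assms in \<open>auto simp: complex_field_inv intro: closed_fieldD\<close>)
qed

lemma closed_field_rat_adjoin: "closed_field (rat_adjoin S)"
proof -
  have "x - y \<in> rat_adjoin S" if "x \<in> rat_adjoin S" "y \<in> rat_adjoin S" for x y
    using generate_field.eng_add[of x complex_field _ "- y"] generate_field.a_inv[of y complex_field] that
    unfolding rat_adjoin_def by fastforce
  moreover have "x * y \<in> rat_adjoin S" if "x \<in> rat_adjoin S" "y \<in> rat_adjoin S" for x y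
    using generate_field.eng_mult[of x complex_field _ y] that unfolding rat_adjoin_def by fastforce
  moreover have "1 \<in> rat_adjoin S"
    using generate_field.one[of complex_field] unfolding rat_adjoin_def by fastforce
  moreover have "inverse x \<in> rat_adjoin S" if "x \<in> rat_adjoin S" for x
  proof (cases "x = 0")
    case True
    then show ?thesis using that by simp
  next
    case False
    then show ?thesis using generate_field.m_inv[of x complex_field] that
      unfolding rat_adjoin_def by (auto simp: complex_field_inv)
  qed
  ultimately show ?thesis by (simp add: closed_field_def)
qed

lemma rat_adjoin_incl: "\<rat> \<union> S \<subseteq> rat_adjoin S"
  unfolding rat_adjoin_def by (auto intro: generate_field.incl)

lemma closed_field_quadratic_extension:
  assumes F: "closed_field F" and t: "t\<^sup>2 \<in> F"
  shows "closed_field {a + b * t | a b. a \<in> F \<and> b \<in> F}" (is "closed_field ?E")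
proof -
  note D = closed_fieldD[OF F]
  have EI: "x \<in> ?E" if "x = a + b * t" "a \<in> F" "b \<in> F" for x a b using that by blast
  have "x - y \<in> ?E \<and> x * y \<in> ?E" if xy: "x \<in> ?E" "y \<in> ?E" for x y
  proof -
    obtain a b c e where x: "x = a + b * t" "a \<in> F" "b \<in> F" and y: "y = c + e * t" "c \<in> F" "e \<in> F"
      using xy by blast
    have "x - y = (a - c) + (b - e) * t" using x y by (simp add: algebra_simps)
    then have "x - y \<in> ?E" using x y by (intro EI[of _ "a - c" "b - e"]) (auto intro: D)
    moreover have "x * y = (a * c + b * e * t\<^sup>2) + (a * e + b * c) * t"
      using x y by (simp add: algebra_simps power2_eq_square)
    then have "x * y \<in> ?E" using x y t by (intro EI[of _ "a * c + b * e * t\<^sup>2" "a * e + b * c"]) (auto intro!: D)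
    ultimately show ?thesis by blast
  qed
  moreover have "inverse x \<in> ?E" if xE: "x \<in> ?E" for x
  proof -
    obtain a b where x: "x = a + b * t" "a \<in> F" "b \<in> F" using xE by blast
    show ?thesis
    proof (cases "a\<^sup>2 - b\<^sup>2 * t\<^sup>2 = 0")
      \<comment> \<open>A vanishing norm with \<open>b\<close> nonzero means that \<open>t\<close>
        already lies in \<open>F\<close>.\<close>
      case True
      have "x \<in> F"
      proof (cases "b = 0")
        case False
        have "(a / b)\<^sup>2 = t\<^sup>2" using True False by (simp add: power_divide field_simps)
        then have "t = a / b \<or> t = - (a / b)" by (metis power2_eq_iff)
        moreover have "a / b \<in> F" using x D by (simp add: divide_inverse)
        ultimately have "t \<in> F" using D by auto
        then show ?thesis using x D by auto
      qed (use x in simp)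
      then show ?thesis using EI[of _ "inverse x" 0] D by simp
    next
      case False
      let ?n = "a\<^sup>2 - b\<^sup>2 * t\<^sup>2"
      have "?n = x * (a - b * t)" using x by (simp add: algebra_simps power2_eq_square)
      then have "x \<noteq> 0" "inverse x * ?n = a - b * t" using False by auto
      then have "inverse x = (a - b * t) / ?n" using False by (simp add: eq_divide_eq)
      then have "inverse x = a * inverse ?n + (- b * inverse ?n) * t"
        by (simp add: divide_inverse algebra_simps)
      moreover have "inverse ?n \<in> F" using x t by (auto intro!: D simp: power2_eq_square)
      ultimately show ?thesis
        using x by (intro EI[of _ "a * inverse ?n" "- b * inverse ?n"]) (auto intro!: D)
    qed
  qed
  moreover have "1 \<in> ?E" using EI[of 1 1 0] D by simp
  ultimately show ?thesis unfolding closed_field_def by blast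
qed

definition sqrt_span :: "'i set \<Rightarrow> ('i \<Rightarrow> complex) \<Rightarrow> complex set" where
  "sqrt_span I s = range (\<lambda>c. \<Sum>S\<in>Pow I. of_rat (c S) * prod s S)"

lemma sqrt_span_insert:
  assumes "finite I" "i \<notin> I"
  shows "sqrt_span (insert i I) s = {a + b * s i | a b. a \<in> sqrt_span I s \<and> b \<in> sqrt_span I s}"
proof -
  have split: "(\<Sum>S\<in>Pow (insert i I). of_rat (c S) * prod s S) =
      (\<Sum>S\<in>Pow I. of_rat (c S) * prod s S) + (\<Sum>S\<in>Pow I. of_rat (c (insert i S)) * prod s S) * s i"
    for c :: "'a set \<Rightarrow> rat"
  proof -
    have "(\<Sum>S\<in>insert i ` Pow I. of_rat (c S) * prod s S) =
        (\<Sum>S\<in>Pow I. of_rat (c (insert i S)) * prod s (insert i S))"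
      using assms(2) by (subst sum.reindex) (auto simp: inj_on_def)
    also have "\<dots> = (\<Sum>S\<in>Pow I. of_rat (c (insert i S)) * prod s S) * s i"
      unfolding sum_distrib_right
    proof (rule sum.cong)
      fix S assume "S \<in> Pow I"
      then have "finite S" "i \<notin> S" using assms finite_subset by auto
      then show "of_rat (c (insert i S)) * prod s (insert i S) = of_rat (c (insert i S)) * prod s S * s i"
        by (simp add: mult_ac)
    qed simp
    finally show ?thesis unfolding Pow_insert
      using assms by (subst sum.union_disjoint) auto
  qed
  show ?thesis
  proof (intro Set.set_eqI iffI)
    fix x assume "x \<in> sqrt_span (insert i I) s"
    then obtain c where x: "x = (\<Sum>S\<in>Pow (insert i I). of_rat (c S) * prod s S)"
      unfolding sqrt_span_def by blast
    have m: "(\<Sum>S\<in>Pow I. of_rat (a S) * prod s S) \<in> sqrt_span I s" for a :: "'a set \<Rightarrow> rat"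
      unfolding sqrt_span_def by blast
    show "x \<in> {a + b * s i | a b. a \<in> sqrt_span I s \<and> b \<in> sqrt_span I s}"
      unfolding x split[of c] using m[of c] m[of "\<lambda>S. c (insert i S)"] by blast
  next
    fix x assume "x \<in> {a + b * s i | a b. a \<in> sqrt_span I s \<and> b \<in> sqrt_span I s}"
    then obtain c e where x: "x = (\<Sum>S\<in>Pow I. of_rat (c S) * prod s S) + (\<Sum>S\<in>Pow I. of_rat (e S) * prod s S) * s i"
      unfolding sqrt_span_def by blast
    let ?f = "\<lambda>S. if i \<in> S then e (S - {i}) else c S"
    have e1: "(\<Sum>S\<in>Pow I. of_rat (?f S) * prod s S) = (\<Sum>S\<in>Pow I. of_rat (c S) * prod s S)"
      using assms(2) by (intro sum.cong) auto
    have e2: "(\<Sum>S\<in>Pow I. of_rat (?f (insert i S)) * prod s S) = (\<Sum>S\<in>Pow I. of_rat (e S) * prod s S)"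
    proof (intro sum.cong refl)
      fix S assume "S \<in> Pow I"
      then have "insert i S - {i} = S" using assms(2) by auto
      then show "of_rat (?f (insert i S)) * prod s S = of_rat (e S) * prod s S" by simp
    qed
    have "x = (\<Sum>S\<in>Pow (insert i I). of_rat (?f S) * prod s S)"
      unfolding split[of ?f] e1 e2 by (rule x)
    then show "x \<in> sqrt_span (insert i I) s" unfolding sqrt_span_def by (rule range_eqI[of _ _ ?f])
  qed
qed

lemma closed_field_sqrt_span:
  assumes "finite I" "\<And>i. i \<in> I \<Longrightarrow> (s i)\<^sup>2 \<in> \<rat>"
  shows "closed_field (sqrt_span I s) \<and> \<rat> \<subseteq> sqrt_span I s \<and> s ` I \<subseteq> sqrt_span I s"
  using assms
proof (induction I rule: finite_induct)
  case empty
  have "sqrt_span {} s = \<rat>" by (auto simp: sqrt_span_def Rats_def)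
  then show ?case by (auto simp: closed_field_def)
next
  case (insert i I)
  then have F: "closed_field (sqrt_span I s)" "\<rat> \<subseteq> sqrt_span I s" "s ` I \<subseteq> sqrt_span I s" by auto
  have i: "(s i)\<^sup>2 \<in> sqrt_span I s" using insert.prems F(2) by blast
  have sub: "a \<in> sqrt_span (insert i I) s" if "a \<in> sqrt_span I s" for a
    unfolding sqrt_span_insert[OF insert.hyps] using that closed_fieldD(2)[OF F(1)]
    by (intro CollectI exI[of _ a] exI[of _ 0]) simp
  have "s i \<in> sqrt_span (insert i I) s"
    unfolding sqrt_span_insert[OF insert.hyps] using closed_fieldD(1,2)[OF F(1)]
    by (intro CollectI exI[of _ 0] exI[of _ 1]) simp
  then show ?case
    using closed_field_quadratic_extension[OF F(1) i] F(2,3) sub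
    unfolding sqrt_span_insert[OF insert.hyps] by blast
qed

lemma rat_adjoin_eq_sqrt_span:
  assumes "finite I" "\<And>i. i \<in> I \<Longrightarrow> (s i)\<^sup>2 \<in> \<rat>"
  shows "rat_adjoin (s ` I) = sqrt_span I s"
proof
  show "rat_adjoin (s ` I) \<subseteq> sqrt_span I s"
    using closed_field_sqrt_span[of I s] assms by (intro rat_adjoin_subset) auto
  note D = closed_fieldD[OF closed_field_rat_adjoin[of "s ` I"]]
  have sum: "(\<Sum>j\<in>J. f j) \<in> rat_adjoin (s ` I)" if "\<And>j. j \<in> J \<Longrightarrow> f j \<in> rat_adjoin (s ` I)"
    for f and J :: "'a set set" using that by (induction J rule: infinite_finite_induct) (auto intro: D)
  have prod: "prod s S \<in> rat_adjoin (s ` I)" if "S \<subseteq> I" for S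
    using that rat_adjoin_incl[of "s ` I"] by (induction S rule: infinite_finite_induct) (auto intro: D)
  have "of_rat q \<in> rat_adjoin (s ` I)" for q using rat_adjoin_incl[of "s ` I"] by auto
  then show "sqrt_span I s \<subseteq> rat_adjoin (s ` I)"
    unfolding sqrt_span_def by (auto intro!: sum D prod)
qed

lemma combine_map:
  "C.combine (map f xs) (map g xs) = (\<Sum>x\<leftarrow>xs. f x * g x)"
  by (induction xs) auto

text \<open>The products of square roots form a spanning list of length \<open>2 ^ card I\<close>,
  and a spanning list as long as the dimension is independent.\<close>

lemma multiquadratic_if_rat_degree:
  assumes I: "finite I" and sq: "\<And>i. i \<in> I \<Longrightarrow> (s i)\<^sup>2 = of_int (d i)"
    and deg: "rat_degree (rat_adjoin (s ` I)) (2 ^ card I)"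
  shows "multiquadratic I d s"
proof
  fix c S assume sum0: "(\<Sum>S\<in>Pow I. complex_of_rat (c S) * prod s S) = 0" and S: "S \<in> Pow I"
  obtain xs where xs: "set xs = Pow I" "distinct xs" using finite_distinct_list[of "Pow I"] I by auto
  let ?Us = "map (prod s) xs"
  have len: "length ?Us = 2 ^ card I" using distinct_card[OF xs(2)] xs(1) I by (simp add: card_Pow)
  have to_sum: "(\<Sum>S\<leftarrow>xs. of_rat (a S) * prod s S) = (\<Sum>S\<in>Pow I. of_rat (a S) * prod s S)" for a
    using sum_list_distinct_conv_sum_set[OF xs(2)] xs(1) by simp
  have "C.Span \<rat> ?Us = sqrt_span I s"
  proof (intro Set.set_eqI iffI)
    fix x assume "x \<in> C.Span \<rat> ?Us"
    then obtain Ks where Ks: "set Ks \<subseteq> \<rat>" "length Ks = length xs" "x = C.combine Ks ?Us"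
      using C.Span_mem_iff_length_version[OF subfield_Rats, of ?Us] by auto
    have "\<forall>k\<in>set Ks. \<exists>q. k = of_rat q" using Ks(1) by (auto simp: Rats_def)
    then obtain r where r: "\<And>k. k \<in> set Ks \<Longrightarrow> k = of_rat (r k)" by metis
    define a where "a = (\<lambda>S. r (the (map_of (zip xs Ks) S)))"
    have "map (\<lambda>S. of_rat (a S)) xs = Ks"
    proof (rule nth_equalityI)
      fix i assume "i < length (map (\<lambda>S. complex_of_rat (a S)) xs)"
      then have i: "i < length xs" by simp
      then have "map_of (zip xs Ks) (xs ! i) = Some (Ks ! i)"
        using Ks(2) xs(2) by (simp add: map_of_zip_nth)
      then have "a (xs ! i) = r (Ks ! i)" by (simp add: a_def)
      then show "map (\<lambda>S. complex_of_rat (a S)) xs ! i = Ks ! i"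
        using r[of "Ks ! i"] i Ks(2) by simp
    qed (use Ks(2) in simp)
    then have "x = (\<Sum>S\<leftarrow>xs. of_rat (a S) * prod s S)"
      using Ks(3) combine_map[of "\<lambda>S. of_rat (a S)" xs "prod s"] by simp
    then show "x \<in> sqrt_span I s" unfolding to_sum sqrt_span_def by blast
  next
    fix x assume "x \<in> sqrt_span I s"
    then obtain a where "x = (\<Sum>S\<leftarrow>xs. of_rat (a S) * prod s S)" unfolding sqrt_span_def to_sum by blast
    then have "x = C.combine (map (\<lambda>S. of_rat (a S)) xs) ?Us" by (simp add: combine_map)
    moreover have "set (map (\<lambda>S. complex_of_rat (a S)) xs) \<subseteq> \<rat>" by auto
    ultimately show "x \<in> C.Span \<rat> ?Us"
      by (intro C.Span_mem_iff_length_version[OF subfield_Rats, THEN iffD2]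
          exI[of _ "map (\<lambda>S. complex_of_rat (a S)) xs"]) simp_all
  qed
  also have "sqrt_span I s = rat_adjoin (s ` I)"
    using I sq by (intro rat_adjoin_eq_sqrt_span[symmetric]) auto
  finally have "C.dimension (length ?Us) \<rat> (C.Span \<rat> ?Us)"
    using deg len unfolding rat_degree_def by simp
  then have "C.independent \<rat> ?Us" by (intro C.independent_if_dimension_Span subfield_Rats) simp
  moreover have "C.combine (map (\<lambda>S. of_rat (c S)) xs) ?Us = 0" using sum0 by (simp only: combine_map to_sum)
  moreover have "set (map (\<lambda>S. complex_of_rat (c S)) xs) \<subseteq> \<rat>" by auto
  ultimately have "set (take (length ?Us) (map (\<lambda>S. complex_of_rat (c S)) xs)) \<subseteq> {0}"
    using C.independent_imp_trivial_combine[OF subfield_Rats, of ?Us]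
    by (simp only: complex_field_simps)
  then show "c S = 0" using S xs(1) by auto
qed (use I sq in auto)

section \<open>Embeddings and the norm\<close>

context multiquadratic
begin

lemma K_eq_sqrt_span: "K = sqrt_span I s"
  unfolding K_def sqrt_span_def lin_def ..

lemma s_nonzero: "i \<in> I \<Longrightarrow> s i \<noteq> 0"
proof
  assume i: "i \<in> I" and "s i = 0"
  then have "lin (\<lambda>T. if T = {i} then 1 else 0) = lin (\<lambda>_. 0)"
    using prod_s_eq_lin[of "{i}"] by (simp add: lin_def)
  from lin_inject[OF this, of "{i}"] i show False by simp
qed

lemma s_in_K: "i \<in> I \<Longrightarrow> s i \<in> K"
  using prod_s_in_K[of "{i}"] by simp

lemma gal_s: "i \<in> I \<Longrightarrow> gal A (s i) = (if i \<in> A then - s i else s i)"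
  using gal_prod_s[of "{i}" A] by (simp add: chi_singleton)

text \<open>An embedding fixes the rationals, so it sends each \<open>s i\<close> to one of the two
  square roots of \<open>d i\<close>, and the indices with a sign change determine it.\<close>

lemma embedding_eq_gal:
  assumes hom: "\<sigma> \<in> Ring.ring_hom (complex_field\<lparr>carrier := K\<rparr>) complex_field"
  shows "\<exists>A\<subseteq>I. \<forall>z\<in>K. \<sigma> z = gal A z"
proof -
  have add: "\<sigma> (x + y) = \<sigma> x + \<sigma> y" and mult: "\<sigma> (x * y) = \<sigma> x * \<sigma> y" if "x \<in> K" "y \<in> K" for x y
    using ring_hom_memE(2,3)[OF hom] that by simp_all
  have one: "\<sigma> 1 = 1" using ring_hom_memE(4)[OF hom] by simp
  have zero: "\<sigma> 0 = 0" using add[of 0 0] by simp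
  have "\<sigma> (of_nat n) = of_nat n" for n
  proof (induction n)
    case (Suc n)
    have "of_nat n \<in> K" using of_int_in_K[of "int n"] by simp
    then show ?case using Suc add one by simp
  qed (simp add: zero)
  then have nat: "\<sigma> (of_int (int n)) = of_int (int n)" for n by simp
  have int: "\<sigma> (of_int k) = of_int k" for k
  proof (cases k)
    case (neg n)
    have "\<sigma> (of_int (int (Suc n)) + of_int k) = 0" using neg zero by simp
    then have "of_int (int (Suc n)) + \<sigma> (of_int k) = 0"
      using add[OF of_int_in_K of_int_in_K] nat by metis
    then have "\<sigma> (of_int k) = - of_int (int (Suc n))" by (metis add_eq_0_iff)
    also have "\<dots> = of_int k" using neg by simp
    finally show ?thesis .
  qed (use nat in simp)
  have rat: "\<sigma> (of_rat q) = of_rat q" for q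
  proof -
    obtain a b where quot: "quotient_of q = (a, b)" by (cases "quotient_of q")
    note b = quotient_of_denom_pos[OF quot]
    have q: "complex_of_rat q = of_int a / of_int b"
      unfolding quotient_of_div[OF quot] by (simp add: of_rat_divide)
    have "of_int b * \<sigma> (of_rat q) = \<sigma> (of_int b * of_rat q)" using mult int by simp
    also have "of_int b * complex_of_rat q = of_int a" using b by (simp add: q)
    also have "\<sigma> (of_int a) = of_int a" by (rule int)
    finally show ?thesis using b by (simp add: q eq_divide_eq mult.commute)
  qed
  have sum: "\<sigma> (\<Sum>j\<in>J. f j) = (\<Sum>j\<in>J. \<sigma> (f j))" if "\<And>j. j \<in> J \<Longrightarrow> f j \<in> K" for f and J :: "'i set set"
    using that by (induction J rule: infinite_finite_induct) (auto simp: zero add sum_in_K)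
  define A where "A = {i \<in> I. \<sigma> (s i) \<noteq> s i}"
  have s: "\<sigma> (s i) = (if i \<in> A then - 1 else 1) * s i" if i: "i \<in> I" for i
  proof -
    have "(\<sigma> (s i))\<^sup>2 = \<sigma> ((s i)\<^sup>2)" using mult s_in_K[OF i] by (simp add: power2_eq_square)
    also have "\<dots> = (s i)\<^sup>2" using int s_square[OF i] by simp
    finally show ?thesis using i by (auto simp: A_def power2_eq_iff)
  qed
  have prod: "\<sigma> (prod s S) = of_int (chi A S) * prod s S" if "S \<subseteq> I" for S
  proof -
    have "\<sigma> (prod s S) = (\<Prod>i\<in>S. (if i \<in> A then - 1 else 1) * s i)"
      using that by (induction S rule: infinite_finite_induct) (auto simp: one mult s s_in_K prod_s_in_K)
    also have "\<dots> = (\<Prod>i\<in>S. of_int (if i \<in> A then - 1 else 1) * s i)"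
      by (intro prod.cong) auto
    also have "\<dots> = of_int (chi A S) * prod s S"
      by (simp only: prod.distrib chi_eq_prod[OF finite_sub[OF that]] of_int_prod)
    finally show ?thesis .
  qed
  have "\<sigma> z = gal A z" if "z \<in> K" for z
    using that
  proof (cases rule: K_cases)
    case (lin c)
    have "\<sigma> z = (\<Sum>S\<in>Pow I. of_rat (c S) * (of_int (chi A S) * prod s S))"
      unfolding lin lin_def using prod_s_in_K
      by (subst sum) (auto simp: mult rat prod intro!: smult_in_K sum.cong)
    also have "\<dots> = gal A z" unfolding lin gal_lin unfolding lin_def
      by (intro sum.cong) (auto simp: of_rat_mult)
    finally show ?thesis .
  qed
  then show ?thesis by (intro exI[of _ A]) (auto simp: A_def)
qed

lemma embeddings_K: "embeddings K = (\<lambda>A. restrict (gal A) K) ` Pow I"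
proof (intro Set.set_eqI iffI)
  fix \<sigma> assume \<sigma>: "\<sigma> \<in> embeddings K"
  then obtain A where A: "A \<subseteq> I" "\<forall>z\<in>K. \<sigma> z = gal A z"
    using embedding_eq_gal unfolding embeddings_def by blast
  have "\<sigma> = restrict (gal A) K"
    using \<sigma> A(2) by (intro extensionalityI[of _ K]) (auto simp: embeddings_def)
  then show "\<sigma> \<in> (\<lambda>A. restrict (gal A) K) ` Pow I" using A by blast
next
  fix \<sigma> assume "\<sigma> \<in> (\<lambda>A. restrict (gal A) K) ` Pow I"
  then obtain A where A: "\<sigma> = restrict (gal A) K" by blast
  have "\<sigma> \<in> Ring.ring_hom (complex_field\<lparr>carrier := K\<rparr>) complex_field"
    by (rule ring_hom_memI) (auto simp: A gal_add gal_mult add_in_K mult_in_K)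
  then show "\<sigma> \<in> embeddings K" by (simp add: embeddings_def A)
qed

lemma rat_norm_eq:
  assumes z: "z \<in> K" shows "rat_norm K z = (\<Prod>A\<in>Pow I. gal A z)"
proof -
  have "inj_on (\<lambda>A. restrict (gal A) K) (Pow I)"
  proof (rule inj_onI)
    fix A B assume AB: "A \<in> Pow I" "B \<in> Pow I" and eq: "restrict (gal A) K = restrict (gal B) K"
    have "i \<in> A \<longleftrightarrow> i \<in> B" if i: "i \<in> I" for i
    proof -
      have "gal A (s i) = gal B (s i)" using fun_cong[OF eq, of "s i"] s_in_K[OF i] by simp
      then show ?thesis using gal_s[OF i] s_nonzero[OF i] by (auto split: if_splits)
    qed
    then show "A = B" using AB by blast
  qed
  then show ?thesis unfolding rat_norm_def embeddings_K by (subst prod.reindex) (use z in auto)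
qed

end

subsection \<open>Units\<close>

text \<open>With \<open>a = \<bar>v\<bar>\<close> and \<open>b = \<bar>1 / v\<bar>\<close>, the
  bound \<open>ln 2\<close> puts both below 2, and \<open>(2 - a) * (2 - b) > 0\<close> gives
  \<open>a + b < 5 / 2\<close>. The integer \<open>a + b\<close> is at least 2 since
  \<open>(a + b)^2 = (a - b)^2 + 4\<close>, so it equals 2 and \<open>a = b = 1\<close>.\<close>

lemma norm_one_if_small_trace:
  fixes v :: real
  assumes "v \<noteq> 0" "v + 1 / v \<in> \<int>" "\<bar>ln \<bar>v\<bar>\<bar> < ln 2"
  shows "ln \<bar>v\<bar> = 0"
proof -
  define a b where "a = \<bar>v\<bar>" and "b = \<bar>1 / v\<bar>"
  have ab: "a > 0" "b > 0" "a * b = 1" using assms(1) by (simp_all add: a_def b_def)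
  have "ln a + ln b = 0" using ln_mult[of a b] ab by simp
  then have "ln a < ln 2" "ln b < ln 2" using assms(3) unfolding a_def by linarith+
  then have "a < 2" "b < 2" using ab by simp_all
  then have "(2 - a) * (2 - b) > 0" by simp
  then have up: "2 * (a + b) < 5" using ab(3) by (simp add: algebra_simps)
  obtain k where k: "v + 1 / v = of_int k" using assms(2) by (auto elim: Ints_cases)
  have "a + b = v + 1 / v \<or> a + b = - (v + 1 / v)"
    by (cases "v > 0") (auto simp: a_def b_def)
  then have "a + b = of_int k \<or> a + b = of_int (- k)" using k by simp
  then obtain l where l: "a + b = of_int l" by blast
  have sq: "(a + b)\<^sup>2 = (a - b)\<^sup>2 + 4" using ab(3) by (simp add: power2_eq_square algebra_simps)
  have "real_of_int (2 * l) < real_of_int 5" using up l by simp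
  then have "2 * l < 5" by (simp only: of_int_less_iff)
  then have "l < 3" by simp
  moreover have "\<not> l \<le> 1"
  proof
    assume "l \<le> 1"
    then have "a + b \<le> 1" using l by linarith
    then have "(a + b)\<^sup>2 \<le> 1\<^sup>2" using ab by (intro power_mono) auto
    then show False using sq zero_le_power2[of "a - b"] by simp
  qed
  ultimately have "l = 2" by linarith
  then have "(a - b)\<^sup>2 = 0" using sq l by simp
  then have "a * a = 1" using ab(3) by simp
  then have "a = 1" using ab(1) square_eq_1_iff[of a] by auto
  then show ?thesis by (simp add: a_def)
qed

text \<open>
  A discrete subgroup of the reals is cyclic, so passing from a group to the kernel of a
  homomorphism with discrete image at most halves the number of square classes.
\<close>

lemma card_square_classes:
  fixes f :: "'p \<Rightarrow> 'a :: Fields.field \<Rightarrow> real"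
  assumes "finite P" and one: "1 \<in> E" and mult: "\<And>u v. u \<in> E \<Longrightarrow> v \<in> E \<Longrightarrow> u * v \<in> E"
    and inv: "\<And>u. u \<in> E \<Longrightarrow> inverse u \<in> E" and nz: "0 \<notin> E"
    and hom: "\<And>p u v. p \<in> P \<Longrightarrow> u \<in> E \<Longrightarrow> v \<in> E \<Longrightarrow> f p (u * v) = f p u + f p v"
    and disc: "\<And>p u. p \<in> P \<Longrightarrow> u \<in> E \<Longrightarrow> \<bar>f p u\<bar> < \<delta> \<Longrightarrow> f p u = 0" and "\<delta> > 0"
    and ker: "\<And>u. u \<in> E \<Longrightarrow> (\<And>p. p \<in> P \<Longrightarrow> f p u = 0) \<Longrightarrow> u = 1 \<or> u = - 1"
  shows "\<exists>Y \<subseteq> E. finite Y \<and> card Y \<le> 2 ^ Suc (card P) \<and> (\<forall>u\<in>E. \<exists>x\<in>Y. \<exists>v\<in>E. u = x * v\<^sup>2)"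
  using assms
proof (induction P arbitrary: E rule: finite_induct)
  case empty
  \<comment> \<open>The signs \<open>1\<close> and \<open>- 1\<close> give at most two classes; they
    account for the \<open>Suc\<close> in the exponent.\<close>
  have E: "E \<subseteq> {1, -1}" using empty.prems(8) by auto
  then have "finite E" "card E \<le> card {1, -1 :: 'a}" by (auto intro: finite_subset card_mono)
  moreover have "card {1, -1 :: 'a} \<le> 2" by (simp add: card_insert_if)
  moreover have "\<exists>x\<in>E. \<exists>v\<in>E. u = x * v\<^sup>2" if "u \<in> E" for u
    using that empty.prems(1) by (intro bexI[of _ u] bexI[of _ 1]) simp_all
  ultimately show ?case by (intro exI[of _ E]) auto
next
  case (insert p P)
  note one = insert.prems(1) and mult = insert.prems(2) and inv = insert.prems(3) and nz = insert.prems(4)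
    and hom = insert.prems(5) and disc = insert.prems(6) and delta = insert.prems(7) and ker = insert.prems(8)
  have f1: "f p 1 = 0" using hom[of p 1 1] one by simp
  have finv: "f p (inverse u) = - f p u" if "u \<in> E" for u
  proof -
    have "u \<noteq> 0" using that nz by auto
    then show ?thesis using hom[of p u "inverse u"] that inv[OF that] f1 by simp
  qed
  define E' where "E' = {u \<in> E. f p u = 0}"
  have "\<exists>Y \<subseteq> E'. finite Y \<and> card Y \<le> 2 ^ Suc (card P) \<and> (\<forall>u\<in>E'. \<exists>x\<in>Y. \<exists>v\<in>E'. u = x * v\<^sup>2)"
  proof (rule insert.IH)
    show "u = 1 \<or> u = - 1" if "u \<in> E'" "\<And>q. q \<in> P \<Longrightarrow> f q u = 0" for u
      using that ker[of u] by (auto simp: E'_def)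
    show "f q u = 0" if "q \<in> P" "u \<in> E'" "\<bar>f q u\<bar> < \<delta>" for q u
      using that disc[of q u] by (auto simp: E'_def)
  qed (use one mult inv nz hom delta f1 finv in \<open>auto simp: E'_def\<close>)
  then obtain Y where Y: "Y \<subseteq> E'" "finite Y" "card Y \<le> 2 ^ Suc (card P)"
    and XE: "\<And>u. u \<in> E' \<Longrightarrow> \<exists>x\<in>Y. \<exists>v\<in>E'. u = x * v\<^sup>2" by blast
  show ?case
  proof (cases "\<forall>u\<in>E. f p u = 0")
    case True
    then have "E' = E" by (auto simp: E'_def)
    then show ?thesis using Y XE insert.hyps by (intro exI[of _ Y]) auto
  next
    case False
    then obtain b where "b \<in> E" "f p b \<noteq> 0" by blast
    then have ex: "\<exists>b. b \<in> E \<and> f p b > 0"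
      using finv[of b] inv[of b] by (cases "f p b > 0") (auto intro: exI[of _ b] exI[of _ "inverse b"])
    \<comment> \<open>Distinct values of \<open>f p\<close> differ by at least
      \<open>\<delta>\<close>, so a positive value with least rounded quotient is the least positive
      value.\<close>
    let ?g = "\<lambda>u. nat \<lfloor>f p u / \<delta>\<rfloor>"
    obtain a where a: "a \<in> E" "f p a > 0" and least: "\<And>u. u \<in> E \<Longrightarrow> f p u > 0 \<Longrightarrow> ?g a \<le> ?g u"
      using ex_has_least_nat[of "\<lambda>u. u \<in> E \<and> f p u > 0" _ ?g] ex by blast
    have min: "f p a \<le> f p u" if u: "u \<in> E" "f p u > 0" for u
    proof (rule ccontr)
      assume "\<not> f p a \<le> f p u"
      then have less: "f p u < f p a" by simp
      have eq: "f p (a * inverse u) = f p a - f p u" using hom[of p a "inverse u"] a u inv finv by simp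
      then have "f p a - f p u \<ge> \<delta>"
        using disc[of p "a * inverse u"] less a u inv mult by (cases "\<bar>f p (a * inverse u)\<bar> < \<delta>") auto
      then have "f p u / \<delta> + 1 \<le> f p a / \<delta>" using delta by (simp add: field_simps)
      then have "\<lfloor>f p u / \<delta>\<rfloor> + 1 \<le> \<lfloor>f p a / \<delta>\<rfloor>" by linarith
      moreover have "\<lfloor>f p u / \<delta>\<rfloor> \<ge> 0" using u delta by simp
      ultimately show False using least[OF u] by linarith
    qed
    have a0: "a \<noteq> 0" using a(1) nz by auto
    have pow: "a ^ n \<in> E \<and> f p (a ^ n) = of_nat n * f p a" for n
      by (induction n) (use one f1 a mult hom in \<open>auto simp: algebra_simps\<close>)
    have pint: "a powi k \<in> E \<and> f p (a powi k) = of_int k * f p a" for k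
      using pow[of "nat k"] pow[of "nat (- k)"] inv finv by (auto simp: power_int_def power_inverse)
    \<comment> \<open>Every element is a kernel element times a power of \<open>a\<close>; modulo
      squares only the parity of the exponent matters, which at most doubles the number of
      classes.\<close>
    let ?Y = "Y \<union> (\<lambda>x. x * a) ` Y"
    have "\<exists>x\<in>?Y. \<exists>v\<in>E. u = x * v\<^sup>2" if u: "u \<in> E" for u
    proof -
      define k where "k = \<lfloor>f p u / f p a\<rfloor>"
      let ?w = "u * a powi (- k)"
      have w: "?w \<in> E" "f p ?w = f p u - of_int k * f p a" using u pint[of "- k"] mult hom[of p u] by auto
      have "of_int k * f p a \<le> f p u" "f p u < (of_int k + 1) * f p a"
        using a(2) floor_divide_lower[of "f p a" "f p u"] floor_divide_upper[of "f p a" "f p u"] by (auto simp: k_def)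
      then have "f p ?w = 0" using min[OF w(1)] w(2) by (cases "f p ?w > 0") (auto simp: algebra_simps)
      then obtain x v where xv: "x \<in> Y" "v \<in> E" "?w = x * v\<^sup>2" using XE[of ?w] w(1) by (auto simp: E'_def)
      have u_eq: "u = x * v\<^sup>2 * a powi k"
        using a0 by (simp add: xv(3)[symmetric] power_int_minus)
      obtain l where "k = 2 * l \<or> k = 2 * l + 1" by (metis oddE evenE)
      have even: "a powi (2 * l) = (a powi l)\<^sup>2"
        using power_int_add[of a l l] a0 by (simp add: power2_eq_square)
      have odd: "a powi (2 * l + 1) = (a powi l)\<^sup>2 * a"
        using power_int_add[of a "2 * l" 1] a0 even by simp
      have vl: "v * a powi l \<in> E" using xv(2) pint[of l] mult by (auto simp: E'_def)
      from \<open>k = 2 * l \<or> k = 2 * l + 1\<close> show ?thesis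
      proof
        assume "k = 2 * l"
        then have "u = x * (v * a powi l)\<^sup>2"
          using u_eq even by (simp add: power_mult_distrib mult.assoc)
        then show ?thesis using xv(1) vl by blast
      next
        assume "k = 2 * l + 1"
        then have "u = (x * a) * (v * a powi l)\<^sup>2"
          using u_eq odd by (simp add: power_mult_distrib mult_ac)
        then show ?thesis using xv(1) vl by blast
      qed
    qed
    moreover have "card ?Y \<le> card Y + card Y" using Y(2) by (meson card_Un_le card_image_le add_left_mono le_trans)
    then have "card ?Y \<le> 2 ^ Suc (card (insert p P))" using Y(3) insert.hyps by simp
    moreover have "?Y \<subseteq> E" using Y(1) a mult by (auto simp: E'_def)
    ultimately show ?thesis using Y(2) by (intro exI[of _ ?Y]) auto
  qed
qed

section \<open>The unit group and complex conjugation\<close>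

context multiquadratic
begin

definition units :: "complex set" where
  "units = {u \<in> K. u \<noteq> 0 \<and> algebraic_int u \<and> algebraic_int (inverse u)}"

lemma unitsD:
  assumes "u \<in> units"
  shows "u \<in> K" "u \<noteq> 0" "algebraic_int u" "algebraic_int (inverse u)"
  using assms by (auto simp: units_def)

lemma Units_ring_of_integers: "Units (ring_of_integers K) \<subseteq> units"
proof
  fix u assume "u \<in> Units (ring_of_integers K)"
  then obtain v where v: "u \<in> K" "algebraic_int u" "v \<in> K" "algebraic_int v" "u * v = 1"
    by (auto simp: Units_def ring_of_integers_def)
  then have "inverse u = v" by (metis inverse_unique)
  then show "u \<in> units" using v by (auto simp: units_def)
qed

lemma one_units [simp]: "1 \<in> units" by (simp add: units_def)

lemma mult_units: "u \<in> units \<Longrightarrow> v \<in> units \<Longrightarrow> u * v \<in> units"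
  by (auto simp: units_def mult_in_K intro: algebraic_int_mult)

lemma inverse_units: "u \<in> units \<Longrightarrow> inverse u \<in> units"
  by (auto simp: units_def inverse_in_K)

lemma divide_units: "u \<in> units \<Longrightarrow> v \<in> units \<Longrightarrow> u / v \<in> units"
  by (simp add: divide_inverse mult_units inverse_units)

lemma gal_units: "u \<in> units \<Longrightarrow> A \<subseteq> I \<Longrightarrow> gal A u \<in> units"
  using algebraic_int_gal[of "inverse u" A]
  by (auto simp: units_def gal_eq_0_iff algebraic_int_gal inverse_in_K gal_inverse)

lemma prod_units: "(\<And>j. j \<in> J \<Longrightarrow> f j \<in> units) \<Longrightarrow> (\<Prod>j\<in>J. f j) \<in> units"
  by (induction J rule: infinite_finite_induct) (auto intro: mult_units)

text \<open>Each \<open>s i\<close> is real or purely imaginary according to the sign of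
  \<open>d i\<close>, so conjugation negates exactly those with negative radicand.\<close>

lemma cnj_eq_gal:
  assumes "z \<in> K"
  shows "cnj z = gal {i \<in> I. d i < 0} z"
proof -
  let ?B = "{i \<in> I. d i < 0}"
  have s: "cnj (s i) = of_int (if i \<in> ?B then - 1 else 1) * s i" if i: "i \<in> I" for i
  proof (cases "d i < 0")
    case True
    let ?y = "\<i> * of_real (sqrt (- of_int (d i)))"
    have "?y\<^sup>2 = (s i)\<^sup>2" using s_square[OF i] True by (simp add: power_mult_distrib flip: of_real_power)
    then have "s i = ?y \<or> s i = - ?y" by (metis power2_eq_iff)
    then show ?thesis using True i by auto
  next
    case False
    let ?y = "complex_of_real (sqrt (of_int (d i)))"
    have "?y\<^sup>2 = (s i)\<^sup>2" using s_square[OF i] False by (simp flip: of_real_power)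
    then have "s i = ?y \<or> s i = - ?y" by (metis power2_eq_iff)
    then show ?thesis using False i by auto
  qed
  have prod: "cnj (prod s S) = of_int (chi ?B S) * prod s S" if "S \<subseteq> I" for S
  proof -
    have "cnj (prod s S) = (\<Prod>i\<in>S. of_int (if i \<in> ?B then - 1 else 1) * s i)"
      unfolding cnj_prod using s that by (intro prod.cong) auto
    then show ?thesis by (simp only: prod.distrib chi_eq_prod[OF finite_sub[OF that]] of_int_prod)
  qed
  have rat: "cnj (of_rat q) = of_rat q" for q by (cases q) (simp add: of_rat_rat)
  from assms show ?thesis
  proof (cases rule: K_cases)
    case (lin c)
    have "cnj z = (\<Sum>S\<in>Pow I. of_rat (c S) * (of_int (chi ?B S) * prod s S))"
      unfolding lin lin_def cnj_sum by (intro sum.cong) (auto simp: rat prod simp del: cnj_prod)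
    also have "\<dots> = gal ?B z"
      unfolding lin gal_lin unfolding lin_def by (intro sum.cong) (auto simp: of_rat_mult)
    finally show ?thesis .
  qed
qed

text \<open>Pairs each \<open>A\<close> with its translate by \<open>A0\<close> and takes the
  partner avoiding \<open>i\<close> as representative. It serves both for complex conjugation and
  for the involution in the Hilbert 90 statement.\<close>

lemma prod_gal_split:
  assumes A0: "A0 \<subseteq> I" "i \<in> A0" and T: "T \<subseteq> Pow I" "(\<lambda>A. A \<triangle> A0) ` T = T"
  shows "(\<Prod>A\<in>T. g A) = (\<Prod>A\<in>{A \<in> T. i \<notin> A}. g A) * (\<Prod>A\<in>{A \<in> T. i \<notin> A}. g (A \<triangle> A0))"
proof -
  let ?T0 = "{A \<in> T. i \<notin> A}"
  have fin: "finite T" using finite_subset[OF T(1)] by simp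
  have img: "{A \<in> T. i \<in> A} = (\<lambda>A. A \<triangle> A0) ` ?T0"
  proof (intro Set.set_eqI iffI)
    fix A assume A: "A \<in> {A \<in> T. i \<in> A}"
    then have "A \<triangle> A0 \<in> ?T0" using A0 T(2) by blast
    moreover have "A = (A \<triangle> A0) \<triangle> A0" by simp
    ultimately show "A \<in> (\<lambda>A. A \<triangle> A0) ` ?T0" by (rule rev_image_eqI)
  next
    fix A assume "A \<in> (\<lambda>A. A \<triangle> A0) ` ?T0"
    then show "A \<in> {A \<in> T. i \<in> A}" using A0 T(2) by blast
  qed
  have inj: "inj_on (\<lambda>A. A \<triangle> A0) ?T0" by (rule inj_on_inverseI[of _ "\<lambda>A. A \<triangle> A0"]) simp
  have "T = ?T0 \<union> {A \<in> T. i \<in> A}" by blast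
  then have "(\<Prod>A\<in>T. g A) = (\<Prod>A\<in>?T0. g A) * (\<Prod>A\<in>{A \<in> T. i \<in> A}. g A)"
    using fin by (subst (1) \<open>T = _\<close>, subst prod.union_disjoint) auto
  then show ?thesis unfolding img using inj by (simp add: prod.reindex)
qed

text \<open>If complex conjugation acts nontrivially, the conjugates of \<open>z\<close> come in
  complex conjugate pairs, so the norm is a squared absolute value.\<close>

lemma norm_nonneg_if_imaginary:
  assumes z: "z \<in> K" and i: "i \<in> I" "d i < 0"
  shows "(\<Prod>A\<in>Pow I. gal A z) \<noteq> - 1"
proof -
  let ?B = "{i \<in> I. d i < 0}" and ?T0 = "{A \<in> Pow I. i \<notin> A}"
  have img: "(\<lambda>A. A \<triangle> ?B) ` Pow I = Pow I" using bij_betw_sdiff[of ?B I] by (auto simp: bij_betw_def)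
  have "(\<Prod>A\<in>Pow I. gal A z) = (\<Prod>A\<in>?T0. gal A z) * (\<Prod>A\<in>?T0. gal (A \<triangle> ?B) z)"
    using i by (intro prod_gal_split img) auto
  also have "(\<Prod>A\<in>?T0. gal (A \<triangle> ?B) z) = (\<Prod>A\<in>?T0. cnj (gal A z))"
    using z by (intro prod.cong refl) (auto simp: cnj_eq_gal gal_gal Un_commute)
  also have "\<dots> = cnj (\<Prod>A\<in>?T0. gal A z)" by (rule cnj_prod[symmetric])
  finally have "(\<Prod>A\<in>Pow I. gal A z) = of_real ((cmod (\<Prod>A\<in>?T0. gal A z))\<^sup>2)"
    by (simp only: complex_norm_square)
  then have eq: "(\<Prod>A\<in>Pow I. gal A z) = of_real ((cmod (\<Prod>A\<in>?T0. gal A z))\<^sup>2)" .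
  show ?thesis
  proof
    assume "(\<Prod>A\<in>Pow I. gal A z) = - 1"
    then have "complex_of_real ((cmod (\<Prod>A\<in>?T0. gal A z))\<^sup>2) = of_real (- 1)" using eq by simp
    then have "(cmod (\<Prod>A\<in>?T0. gal A z))\<^sup>2 = - 1" by (simp only: of_real_eq_iff)
    then show False using zero_le_power2[of "cmod (\<Prod>A\<in>?T0. gal A z)"] by linarith
  qed
qed

end

subsection \<open>Units of norm minus one\<close>

locale real_multiquadratic = multiquadratic I d s
  for I :: "'i set" and d :: "'i \<Rightarrow> int" and s :: "'i \<Rightarrow> complex" +
  assumes d_pos: "i \<in> I \<Longrightarrow> d i > 0"
begin

lemma K_real:
  assumes "z \<in> K" shows "z \<in> \<real>"
proof -
  have "{i \<in> I. d i < 0} = {}" using d_pos by force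
  then have "cnj z = z" using cnj_eq_gal[OF assms] gal_empty[OF assms] by metis
  then show ?thesis by (simp add: Reals_cnj_iff)
qed

text \<open>Fourier coefficient of the logarithmic embedding at a character. A single logarithm need
  not take discrete values on the units, but each of these coefficients does; this cuts the unit
  lattice into one-dimensional pieces.\<close>

definition log_char :: "'i set \<Rightarrow> complex \<Rightarrow> real" where
  "log_char S u = (\<Sum>A\<in>Pow I. of_int (chi A S) * ln (cmod (gal A u)))"

text \<open>Multiplicative counterpart of \<open>log_char\<close>. For a unit and nonempty
  \<open>S \<subseteq> I\<close> it is a unit of relative norm 1 in the quadratic field generated by
  \<open>prod s S\<close>.\<close>

definition twisted_norm :: "'i set \<Rightarrow> complex \<Rightarrow> complex" where
  "twisted_norm S u = (\<Prod>A\<in>Pow I. gal A u powi chi A S)"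

lemma powi_chi_cases:
  fixes x :: complex
  shows "x powi chi A S = (if chi A S = 1 then x else inverse x)"
  using chi_cases[of A S] by (auto simp: power_int_minus)

lemma log_char_mult:
  assumes "u \<in> units" "v \<in> units"
  shows "log_char S (u * v) = log_char S u + log_char S v"
proof -
  have "ln (cmod (gal A (u * v))) = ln (cmod (gal A u)) + ln (cmod (gal A v))" if "A \<in> Pow I" for A
    using that assms by (simp add: gal_mult norm_mult ln_mult gal_eq_0_iff unitsD)
  then show ?thesis by (simp add: log_char_def sum.distrib distrib_left)
qed

lemma twisted_norm_units: "u \<in> units \<Longrightarrow> twisted_norm S u \<in> units"
  unfolding twisted_norm_def powi_chi_cases
  by (auto intro!: prod_units gal_units inverse_units)

lemma ln_twisted_norm:
  assumes "u \<in> units" shows "ln (cmod (twisted_norm S u)) = log_char S u"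
proof -
  have g: "gal A u \<noteq> 0" if "A \<in> Pow I" for A using that assms by (simp add: gal_eq_0_iff unitsD)
  have "ln (cmod (twisted_norm S u)) = ln (\<Prod>A\<in>Pow I. cmod (gal A u powi chi A S))"
    by (simp add: twisted_norm_def prod_norm)
  also have "\<dots> = (\<Sum>A\<in>Pow I. ln (cmod (gal A u powi chi A S)))"
    using g by (intro ln_prod) (auto simp: powi_chi_cases norm_inverse)
  also have "\<dots> = log_char S u"
    unfolding log_char_def
  proof (intro sum.cong refl)
    fix A assume "A \<in> Pow I"
    then show "ln (cmod (gal A u powi chi A S)) = of_int (chi A S) * ln (cmod (gal A u))"
      using g[of A] chi_cases[of A S] by (auto simp: powi_chi_cases norm_inverse ln_inverse)
  qed
  finally show ?thesis .
qed

text \<open>Translating the index \<open>A\<close> by \<open>B\<close> multiplies every exponent by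
  the same sign \<open>chi B S\<close>.\<close>

lemma gal_twisted_norm:
  assumes u: "u \<in> units" and B: "B \<subseteq> I"
  shows "gal B (twisted_norm S u) = twisted_norm S u powi chi B S"
proof -
  have uK: "u \<in> K" using u by (rule unitsD)
  have inK: "gal A u powi chi A S \<in> K" for A by (auto simp: powi_chi_cases intro: inverse_in_K)
  have galp: "gal B (gal A u powi chi A S) = gal B (gal A u) powi chi A S" for A
    by (simp add: powi_chi_cases gal_inverse)
  have "gal B (twisted_norm S u) = (\<Prod>A\<in>Pow I. gal B (gal A u) powi chi A S)"
    unfolding twisted_norm_def using inK by (simp add: gal_prod galp)
  also have "\<dots> = (\<Prod>A\<in>Pow I. (gal (A \<triangle> B) u powi chi (A \<triangle> B) S) powi chi B S)"
  proof (intro prod.cong refl)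
    fix A assume A: "A \<in> Pow I"
    have "chi (A \<triangle> B) S * chi B S = chi A S * (chi B S * chi B S)"
      using A B by (simp add: chi_sdiff_left finite_sub mult.assoc del: chi_square)
    then have "chi (A \<triangle> B) S * chi B S = chi A S" by simp
    then show "gal B (gal A u) powi chi A S = (gal (A \<triangle> B) u powi chi (A \<triangle> B) S) powi chi B S"
      using A B uK by (simp add: gal_gal Un_commute flip: power_int_mult)
  qed
  also have "\<dots> = (\<Prod>A\<in>Pow I. (gal A u powi chi A S) powi chi B S)"
    by (rule prod.reindex_bij_betw[OF bij_betw_sdiff[OF B]])
  also have "\<dots> = twisted_norm S u powi chi B S"
    unfolding twisted_norm_def powi_chi_cases[of _ B] by (auto simp: prod_inversef[symmetric] o_def)
  finally show ?thesis .
qed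

text \<open>Every automorphism sends the twisted norm to itself or to its inverse, so its sum with
  the inverse is a rational algebraic integer.\<close>

lemma log_char_discrete:
  assumes u: "u \<in> units" and "\<bar>log_char S u\<bar> < ln 2"
  shows "log_char S u = 0"
proof -
  let ?v = "twisted_norm S u"
  have v: "?v \<in> units" using u by (rule twisted_norm_units)
  have "gal {i} (?v + inverse ?v) = ?v + inverse ?v" if "i \<in> I" for i
    using gal_twisted_norm[OF u, of "{i}" S] that v
    by (auto simp: gal_add gal_inverse inverse_in_K unitsD powi_chi_cases)
  then have "?v + inverse ?v \<in> \<rat>" using v
    by (intro rational_if_fixed) (auto intro: add_in_K inverse_in_K dest: unitsD)
  then have int: "?v + inverse ?v \<in> \<int>"
    using v by (intro rational_algebraic_int_is_int algebraic_int_add) (auto dest: unitsD)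
  obtain r where r: "?v = of_real r" using K_real[of ?v] v by (auto elim: Reals_cases dest: unitsD)
  obtain k where "?v + inverse ?v = of_int k" using int by (auto elim: Ints_cases)
  then have "complex_of_real (r + 1 / r) = of_real (of_int k)" by (simp add: r divide_inverse)
  then have "r + 1 / r = of_int k" by (simp only: of_real_eq_iff)
  moreover have "r \<noteq> 0" using v r by (auto dest: unitsD)
  moreover have "ln \<bar>r\<bar> = log_char S u" using ln_twisted_norm[OF u, of S] r by simp
  ultimately show ?thesis using norm_one_if_small_trace[of r] assms(2) by simp
qed

lemma log_char_empty:
  assumes "u \<in> units" shows "log_char {} u = 0"
proof -
  let ?v = "twisted_norm {} u"
  have v: "?v \<in> units" using assms by (rule twisted_norm_units)
  have "gal {i} ?v = ?v" if "i \<in> I" for i using gal_twisted_norm[OF assms, of "{i}" "{}"] that by simp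
  then have "?v \<in> \<rat>" using v by (intro rational_if_fixed) (auto dest: unitsD)
  then have "?v \<in> \<int>" "inverse ?v \<in> \<int>"
    using v by (auto intro!: rational_algebraic_int_is_int dest: unitsD)
  then obtain k l where kl: "?v = of_int k" "inverse ?v = of_int l" by (auto elim!: Ints_cases)
  have "?v * inverse ?v = 1" using v by (auto dest: unitsD)
  then have "complex_of_int (k * l) = of_int 1"
    unfolding of_int_mult kl(1)[symmetric] kl(2)[symmetric] by simp
  then have "k * l = 1" by (simp only: of_int_eq_iff)
  then have "\<bar>k\<bar> = 1" by (auto simp: zmult_eq_1_iff)
  then have "cmod ?v = 1" by (simp add: kl)
  then show ?thesis using ln_twisted_norm[OF assms, of "{}"] by simp
qed

lemma sum_log_char: "(\<Sum>S\<in>Pow I. log_char S u) = 2 ^ card I * ln (cmod (gal {} u))"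
proof -
  have "(\<Sum>S\<in>Pow I. log_char S u) = (\<Sum>A\<in>Pow I. of_int (\<Sum>S\<in>Pow I. chi A S) * ln (cmod (gal A u)))"
    unfolding log_char_def by (subst sum.swap) (simp add: sum_distrib_right)
  also have "\<dots> = (\<Sum>A\<in>Pow I. if A = {} then 2 ^ card I * ln (cmod (gal {} u)) else 0)"
    by (intro sum.cong) (auto simp: sum_chi)
  also have "\<dots> = 2 ^ card I * ln (cmod (gal {} u))" by (subst sum.delta) auto
  finally show ?thesis .
qed

text \<open>There are \<open>2 ^ card I - 1\<close> nontrivial characters, and the factor for the
  signs completes the exponent. If all coefficients vanish, Fourier inversion gives absolute value
  1, and the only such real numbers are \<open>1\<close> and \<open>- 1\<close>.\<close>

lemma square_classes_units:
  "\<exists>Y \<subseteq> units. finite Y \<and> card Y \<le> 2 ^ 2 ^ card I \<and> (\<forall>u\<in>units. \<exists>x\<in>Y. \<exists>v\<in>units. u = x * v\<^sup>2)"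
proof -
  have "\<exists>Y \<subseteq> units. finite Y \<and> card Y \<le> 2 ^ Suc (card (Pow I - {{}})) \<and>
      (\<forall>u\<in>units. \<exists>x\<in>Y. \<exists>v\<in>units. u = x * v\<^sup>2)"
  proof (rule card_square_classes[where f = log_char and \<delta> = "ln 2"])
    show "u = 1 \<or> u = - 1" if u: "u \<in> units" and S: "\<And>S. S \<in> Pow I - {{}} \<Longrightarrow> log_char S u = 0" for u
    proof -
      have "log_char S u = 0" if "S \<in> Pow I" for S using S[of S] log_char_empty[OF u] that by blast
      then have "(\<Sum>S\<in>Pow I. log_char S u) = 0" by simp
      then have "ln (cmod u) = 0" using sum_log_char[of u] u by (simp add: unitsD)
      then have 1: "cmod u = 1" using u by (simp add: unitsD)
      obtain r where r: "u = of_real r" using K_real[of u] u by (auto elim: Reals_cases dest: unitsD)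
      then have "\<bar>r\<bar> = 1" using 1 by simp
      then have "r = 1 \<or> r = - 1" by linarith
      then show ?thesis using r by auto
    qed
    show "log_char S u = 0" if "S \<in> Pow I - {{}}" "u \<in> units" "\<bar>log_char S u\<bar> < ln 2" for S u
      by (rule log_char_discrete[OF that(2,3)])
    show "0 \<notin> units" by (simp add: units_def)
  qed (simp_all add: mult_units inverse_units log_char_mult)
  moreover have "Suc (card (Pow I - {{}})) = 2 ^ card I"
    by (simp add: card_Diff_singleton card_Pow)
  ultimately show ?thesis by (simp only:)
qed

section \<open>Signs of real units\<close>

definition sg :: "complex \<Rightarrow> real" where "sg z = sgn (Re z)"

lemma sg_mult:
  assumes "z \<in> K" "w \<in> K" shows "sg (z * w) = sg z * sg w"
proof -
  have "Im z = 0" "Im w = 0" using K_real[OF assms(1)] K_real[OF assms(2)] by (simp_all add: complex_is_Real_iff)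
  then show ?thesis by (simp add: sg_def sgn_mult)
qed

lemma sg_1 [simp]: "sg 1 = 1" by (simp add: sg_def)

lemma sg_prod: "(\<And>j. j \<in> J \<Longrightarrow> f j \<in> K) \<Longrightarrow> sg (\<Prod>j\<in>J. f j) = (\<Prod>j\<in>J. sg (f j))"
  by (induction J rule: infinite_finite_induct) (auto simp: sg_mult prod_in_K)

lemma sg_cases:
  assumes "u \<in> units" shows "sg u = 1 \<or> sg u = - 1"
proof -
  obtain r where "u = of_real r" using K_real[of u] assms by (auto elim: Reals_cases dest: unitsD)
  then show ?thesis using assms by (auto simp: sg_def sgn_if dest: unitsD)
qed

lemma sg_square: "u \<in> units \<Longrightarrow> sg (u\<^sup>2) = 1"
  using sg_cases[of u] sg_mult[of u u] by (auto simp: power2_eq_square dest: unitsD)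

end

text \<open>
  In the group ring of an elementary abelian 2-group over the field with two elements, an element
  of augmentation 1 is its own inverse. Applied to the sign pattern of a unit of norm \<open>-1\<close>, this
  shows that its conjugates have independent signatures.
\<close>

locale norm_minus_one = real_multiquadratic I d s
  for I :: "'i set" and d :: "'i \<Rightarrow> int" and s :: "'i \<Rightarrow> complex" +
  fixes \<epsilon> :: complex
  assumes eps_units: "\<epsilon> \<in> units" and eps_norm: "(\<Prod>A\<in>Pow I. gal A \<epsilon>) = - 1"
begin

lemma eps_K: "\<epsilon> \<in> K" using eps_units by (rule unitsD)

text \<open>\<open>T\<close> is read as an element of the group ring over the field with two
  elements, acting on \<open>\<epsilon>\<close> modulo squares.\<close>

definition conj_prod :: "'i set set \<Rightarrow> complex" where
  "conj_prod T = (\<Prod>A\<in>T. gal A \<epsilon>)"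

lemma conj_prod_units: "T \<subseteq> Pow I \<Longrightarrow> conj_prod T \<in> units"
  unfolding conj_prod_def using eps_units by (auto intro!: prod_units gal_units)

lemma gal_conj_prod:
  assumes "T \<subseteq> Pow I" "B \<subseteq> I"
  shows "gal B (conj_prod T) = (\<Prod>A\<in>T. gal (A \<triangle> B) \<epsilon>)"
proof -
  have "gal B (conj_prod T) = (\<Prod>A\<in>T. gal B (gal A \<epsilon>))" unfolding conj_prod_def by (rule gal_prod) simp
  also have "\<dots> = (\<Prod>A\<in>T. gal (A \<triangle> B) \<epsilon>)"
    using assms eps_K by (intro prod.cong refl) (auto simp: gal_gal Un_commute)
  finally show ?thesis .
qed

lemma signature_independent:
  assumes T: "T \<subseteq> Pow I" and pos: "\<And>B. B \<subseteq> I \<Longrightarrow> sg (gal B (conj_prod T)) = 1"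
  shows "T = {}"
proof (rule ccontr)
  assume "T \<noteq> {}"
  then obtain C where C: "C \<in> T" by blast
  then have CI: "C \<subseteq> I" using T by blast
  let ?s = "\<lambda>A. sg (gal A \<epsilon>)"
  have finT: "finite T" using finite_subset[OF T] by simp
  have s: "?s A = 1 \<or> ?s A = - 1" if "A \<subseteq> I" for A using sg_cases gal_units[OF eps_units that] by blast
  \<comment> \<open>The sign pattern of \<open>\<epsilon>\<close> translated by \<open>C\<close>.
    Multiplying the relation given by \<open>T\<close> with this pattern isolates the coefficient of
    \<open>C\<close>; the double product over \<open>N\<close> and \<open>T\<close> is evaluated in
    both orders.\<close>
  define N where "N = {B \<in> Pow I. ?s (B \<triangle> C) = - 1}"
  have finN: "finite N" by (simp add: N_def)
  have sub: "A \<triangle> B \<subseteq> I" if "A \<in> Pow I" "B \<in> Pow I" for A B using that by blast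
  have "(\<Prod>B\<in>N. \<Prod>A\<in>T. ?s (A \<triangle> B)) = 1"
  proof (rule prod.neutral, rule ballI)
    fix B assume "B \<in> N"
    then have B: "B \<subseteq> I" by (simp add: N_def)
    show "(\<Prod>A\<in>T. ?s (A \<triangle> B)) = 1"
      using pos[OF B] gal_conj_prod[OF T B] by (simp add: sg_prod)
  qed
  then have "(\<Prod>A\<in>T. \<Prod>B\<in>N. ?s (A \<triangle> B)) = 1" by (subst prod.swap)
  \<comment> \<open>For \<open>A \<noteq> C\<close> the sets \<open>B\<close> that contribute a
    negative factor are paired by translation with \<open>A \<triangle> C\<close>, which has no
    fixed points and exchanges the two sign conditions.\<close>
  moreover have "(\<Prod>B\<in>N. ?s (A \<triangle> B)) = 1" if A: "A \<in> T - {C}" for A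
  proof -
    have AI: "A \<subseteq> I" and "A \<noteq> C" using A T by auto
    then obtain i where i: "i \<in> A \<triangle> C" by blast
    define Z where "Z = {B \<in> N. ?s (A \<triangle> B) = - 1}"
    have finZ: "finite Z" using finN by (simp add: Z_def)
    have "(\<Prod>B\<in>N. ?s (A \<triangle> B)) = (\<Prod>B\<in>N. if B \<in> Z then - 1 else 1)"
    proof (intro prod.cong refl)
      fix B assume "B \<in> N"
      then show "?s (A \<triangle> B) = (if B \<in> Z then - 1 else 1)"
        using s[of "A \<triangle> B"] AI by (auto simp: Z_def N_def)
    qed
    also have "\<dots> = (- 1) ^ card Z"
    proof -
      have "N \<inter> {B. B \<in> Z} = Z" by (auto simp: Z_def)
      then show ?thesis using finN by (simp add: prod.If_cases)
    qed
    also have "card Z = card {B \<in> Z. i \<in> B} + card {B \<in> Z. i \<notin> B}"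
      using finZ by (subst card_Un_disjoint[symmetric]) (auto intro: arg_cong[of _ _ card])
    also have "card {B \<in> Z. i \<in> B} = card {B \<in> Z. i \<notin> B}"
    proof (rule bij_betw_same_card)
      have inv: "B \<triangle> (A \<triangle> C) \<in> Z" if "B \<in> Z" for B
      proof -
        have "(B \<triangle> (A \<triangle> C)) \<triangle> C = A \<triangle> B" "A \<triangle> (B \<triangle> (A \<triangle> C)) = B \<triangle> C" by blast+
        moreover have "B \<triangle> (A \<triangle> C) \<subseteq> I" using that AI CI by (auto simp: Z_def N_def)
        ultimately show ?thesis using that by (simp add: Z_def N_def)
      qed
      show "bij_betw (\<lambda>B. B \<triangle> (A \<triangle> C)) {B \<in> Z. i \<in> B} {B \<in> Z. i \<notin> B}"
        by (rule bij_betwI[where g = "\<lambda>B. B \<triangle> (A \<triangle> C)"]) (use inv i in \<open>simp_all only: sdiff_cancel, blast+\<close>)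
    qed
    finally show ?thesis by (simp flip: mult_2)
  qed
  then have "(\<Prod>A\<in>T - {C}. \<Prod>B\<in>N. ?s (A \<triangle> B)) = 1" by (rule prod.neutral[OF ballI])
  \<comment> \<open>For \<open>A = C\<close> each negative conjugate is counted once, so the total
    is the sign of the norm.\<close>
  moreover have "(\<Prod>B\<in>N. ?s (C \<triangle> B)) = - 1"
  proof -
    have "(\<Prod>B\<in>N. ?s (C \<triangle> B)) = (\<Prod>B\<in>Pow I. ?s (B \<triangle> C))"
    proof (rule prod.mono_neutral_cong_left)
      show "\<forall>B\<in>Pow I - N. ?s (B \<triangle> C) = 1"
      proof
        fix B assume "B \<in> Pow I - N"
        then show "?s (B \<triangle> C) = 1" using s[OF sub[of B C]] CI by (auto simp: N_def)
      qed
    qed (auto simp: N_def Un_commute)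
    also have "\<dots> = (\<Prod>A\<in>Pow I. ?s A)" by (rule prod.reindex_bij_betw[OF bij_betw_sdiff[OF CI]])
    also have "\<dots> = sg (\<Prod>A\<in>Pow I. gal A \<epsilon>)" by (simp add: sg_prod)
    also have "\<dots> = - 1" by (simp add: eps_norm sg_def)
    finally show ?thesis .
  qed
  ultimately show False using C finT by (simp add: prod.remove)
qed

lemma conj_prod_mult:
  "T \<subseteq> Pow I \<Longrightarrow> T' \<subseteq> Pow I \<Longrightarrow>
    conj_prod T * conj_prod T' = conj_prod (T \<triangle> T') * (conj_prod (T \<inter> T'))\<^sup>2"
  unfolding conj_prod_def by (rule prod_sdiff) (auto dest: finite_subset)

text \<open>Modulo squares the product is the one over the symmetric difference; being a square,
  that one is totally positive.\<close>

lemma conj_prod_eq_if_square: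
  assumes T: "T \<subseteq> Pow I" "T' \<subseteq> Pow I" and v: "v \<in> units" "conj_prod T * conj_prod T' = v\<^sup>2"
  shows "T = T'"
proof -
  have TT: "T \<inter> T' \<subseteq> Pow I" "T \<triangle> T' \<subseteq> Pow I" using T by auto
  let ?w = "v / conj_prod (T \<inter> T')"
  have c: "conj_prod (T \<inter> T') \<in> units" using conj_prod_units[OF TT(1)] .
  have w: "?w \<in> units" using v c by (simp add: divide_units)
  have "conj_prod (T \<triangle> T') = ?w\<^sup>2"
    using conj_prod_mult[OF T] v(2) unitsD(2)[OF c] by (simp add: power_divide eq_divide_eq)
  then have "sg (gal B (conj_prod (T \<triangle> T'))) = 1" if "B \<subseteq> I" for B
    using w that by (simp add: gal_power unitsD sg_square gal_units del: power_divide)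
  then have "T \<triangle> T' = {}" by (rule signature_independent[OF TT(2)])
  then show ?thesis by blast
qed

text \<open>
  By signature independence the products of conjugates of \<open>\<epsilon>\<close> occupy as many square classes as there are in total.
\<close>

lemma unit_eq_conj_prod_square:
  assumes "u \<in> units"
  shows "\<exists>T \<subseteq> Pow I. \<exists>v\<in>units. u = conj_prod T * v\<^sup>2"
proof -
  obtain Y where Y: "Y \<subseteq> units" "finite Y" "card Y \<le> 2 ^ 2 ^ card I"
    and cls': "\<forall>u\<in>units. \<exists>x\<in>Y. \<exists>v\<in>units. u = x * v\<^sup>2"
    using square_classes_units by (elim exE conjE)
  note cls = cls'[rule_format]
  have all: "\<forall>T\<in>Pow (Pow I). \<exists>x. x \<in> Y \<and> (\<exists>v\<in>units. conj_prod T = x * v\<^sup>2)"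
  proof
    fix T assume "T \<in> Pow (Pow I)"
    then show "\<exists>x. x \<in> Y \<and> (\<exists>v\<in>units. conj_prod T = x * v\<^sup>2)"
      using cls[OF conj_prod_units[of T]] by blast
  qed
  obtain F where "\<forall>T\<in>Pow (Pow I). F T \<in> Y \<and> (\<exists>v\<in>units. conj_prod T = F T * v\<^sup>2)"
    using bchoice[OF all] by (rule exE)
  then have F: "F T \<in> Y \<and> (\<exists>v\<in>units. conj_prod T = F T * v\<^sup>2)" if "T \<in> Pow (Pow I)" for T
    using that by (rule bspec)
  \<comment> \<open>Two products with the same representative multiply to a square.\<close>
  have "inj_on F (Pow (Pow I))"
  proof (rule inj_onI)
    fix T T' assume TT: "T \<in> Pow (Pow I)" "T' \<in> Pow (Pow I)" and eq: "F T = F T'"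
    obtain v where v: "v \<in> units" "conj_prod T = F T * v\<^sup>2" using F[OF TT(1)] by blast
    obtain v' where v': "v' \<in> units" "conj_prod T' = F T * v'\<^sup>2"
      using F[OF TT(2)] unfolding eq[symmetric] by blast
    have "F T \<in> units" using F[OF TT(1)] Y(1) by blast
    then have "F T * v * v' \<in> units" using v(1) v'(1) by (intro mult_units)
    moreover have "conj_prod T * conj_prod T' = (F T * v * v')\<^sup>2"
      unfolding v(2) v'(2) by (simp add: power2_eq_square mult_ac)
    ultimately show "T = T'" using conj_prod_eq_if_square[of T T'] TT by simp
  qed
  then have "card (F ` Pow (Pow I)) = 2 ^ 2 ^ card I" by (simp add: card_image card_Pow)
  moreover have "F ` Pow (Pow I) \<subseteq> Y" using F by blast
  ultimately have img: "F ` Pow (Pow I) = Y" using Y(2,3) by (intro card_seteq) auto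
  obtain x w where x: "x \<in> Y" "w \<in> units" "u = x * w\<^sup>2" using cls[OF assms] by blast
  then obtain T where T: "T \<in> Pow (Pow I)" "x = F T" using img by blast
  obtain v where v: "v \<in> units" "conj_prod T = F T * v\<^sup>2" using F[OF T(1)] by blast
  then have "u = conj_prod T * (w / v)\<^sup>2" using x T unitsD(2)[OF v(1)] by (simp add: power_divide)
  moreover have "w / v \<in> units" using x(2) v(1) by (rule divide_units)
  ultimately show ?thesis using T(1) by blast
qed

text \<open>The relation on \<open>u\<close> makes the set \<open>T\<close> that represents
  \<open>u\<close> modulo squares invariant under translation by \<open>A0\<close>, so
  \<open>conj_prod T\<close> is a norm to the fixed field of \<open>gal A0\<close>. Taking a square
  root of the relation leaves the ambiguity of sign.\<close>

lemma unit_hilbert_90: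
  assumes A0: "A0 \<subseteq> I" "A0 \<noteq> {}" and u: "u \<in> units" "u * gal A0 u = 1"
  shows "\<exists>w\<in>units. u = gal A0 w / w \<or> u = - (gal A0 w / w)"
proof -
  obtain T v where T: "T \<subseteq> Pow I" and v: "v \<in> units" "u = conj_prod T * v\<^sup>2"
    using unit_eq_conj_prod_square[OF u(1)] by blast
  obtain i where i: "i \<in> A0" using A0(2) by blast
  let ?T' = "(\<lambda>A. A \<triangle> A0) ` T"
  have T': "?T' \<subseteq> Pow I" using T A0 by blast
  have inj: "inj_on (\<lambda>A. A \<triangle> A0) T" by (rule inj_on_inverseI[of _ "\<lambda>A. A \<triangle> A0"]) simp
  have "conj_prod ?T' = (\<Prod>A\<in>T. gal (A \<triangle> A0) \<epsilon>)"
    unfolding conj_prod_def using inj by (simp add: prod.reindex)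
  then have gT: "gal A0 (conj_prod T) = conj_prod ?T'"
    using gal_conj_prod[OF T A0(1)] by (simp only:)
  have vg: "gal A0 v \<in> units" using v A0 by (simp add: gal_units)
  have "gal A0 u = conj_prod ?T' * (gal A0 v)\<^sup>2"
    using v conj_prod_units[OF T] by (simp add: gal_mult gal_power power_in_K unitsD gT)
  then have "conj_prod T * conj_prod ?T' * (v * gal A0 v)\<^sup>2 = 1"
    using u(2) v(2) by (simp add: power_mult_distrib mult_ac)
  then have "conj_prod T * conj_prod ?T' = (inverse (v * gal A0 v))\<^sup>2"
    using inverse_unique[of "(v * gal A0 v)\<^sup>2" "conj_prod T * conj_prod ?T'"]
    by (simp only: power_inverse mult.commute)
  moreover have "inverse (v * gal A0 v) \<in> units" using v vg by (simp add: inverse_units mult_units)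
  ultimately have TT: "?T' = T" using conj_prod_eq_if_square[OF T T'] by metis
  define w where "w = conj_prod {A \<in> T. i \<notin> A}"
  have T0: "{A \<in> T. i \<notin> A} \<subseteq> Pow I" using T by auto
  have w: "w \<in> units" unfolding w_def by (rule conj_prod_units[OF T0])
  have wg: "gal A0 w \<in> units" using w A0 by (simp add: gal_units)
  have "conj_prod T = w * gal A0 w"
    unfolding w_def gal_conj_prod[OF T0 A0(1)] unfolding conj_prod_def
    by (rule prod_gal_split[OF A0(1) i T TT])
  then have u_eq: "u = w * gal A0 w * v\<^sup>2" using v by simp
  let ?v = "w * v"
  have v1: "?v \<in> units" "gal A0 ?v \<in> units" using w v A0 by (auto intro: mult_units gal_units)
  have gv: "gal A0 ?v = gal A0 w * gal A0 v" using w v by (simp add: gal_mult unitsD)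
  have gu: "gal A0 u = gal A0 w * w * (gal A0 v)\<^sup>2"
    unfolding u_eq using w v(1) A0(1) by (simp add: gal_mult gal_power power_in_K mult_in_K unitsD)
  have "u * gal A0 u = (?v * gal A0 ?v)\<^sup>2"
    unfolding gu gv by (subst u_eq) (simp only: power2_eq_square mult_ac)
  then have "(?v * gal A0 ?v)\<^sup>2 = 1" using u(2) by simp
  then have pm: "?v * gal A0 ?v = 1 \<or> ?v * gal A0 ?v = - 1" by (simp add: power2_eq_1_iff)
  have nz: "w \<noteq> 0" "v \<noteq> 0" "gal A0 w \<noteq> 0" "gal A0 v \<noteq> 0"
    using unitsD(2) w v(1) wg vg by auto
  \<comment> \<open>Since \<open>?v * gal A0 ?v\<close> is a sign, what remains of \<open>u\<close>
    is \<open>v / gal A0 v\<close>; hence the wanted unit is the inverse of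
    \<open>v\<close>.\<close>
  let ?z = "inverse v"
  have z: "?z \<in> units" using v by (simp add: inverse_units)
  have gz: "gal A0 ?z / ?z = v / gal A0 v" 
    by (simp add: gal_inverse[OF unitsD(1)[OF v(1)]] divide_inverse mult.commute)
  have "u = (w * v * (gal A0 w * gal A0 v)) * (v / gal A0 v)" using nz by (simp add: u_eq power2_eq_square)
  then have "u = (?v * gal A0 ?v) * (gal A0 ?z / ?z)" by (simp only: gz gv)
  then have "u = gal A0 ?z / ?z \<or> u = - (gal A0 ?z / ?z)" using pm by (elim disjE) simp_all
  then show ?thesis using z by blast
qed

end

subsection \<open>Periods of permutations and fractional ideals\<close>

lemma even_card_if_involution:
  assumes "finite M" "\<And>x. x \<in> M \<Longrightarrow> g x \<in> M \<and> g (g x) = x \<and> g x \<noteq> x"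
  shows "even (card M)"
  using assms
proof (induction M rule: finite_psubset_induct)
  case (psubset M)
  show ?case
  proof (cases "M = {}")
    case False
    then obtain x where x: "x \<in> M" by blast
    let ?N = "M - {x, g x}"
    have "even (card ?N)"
    proof (rule psubset.IH)
      show "?N \<subset> M" using x by blast
      show "g y \<in> ?N \<and> g (g y) = y \<and> g y \<noteq> y" if "y \<in> ?N" for y
        using that psubset.prems[of y] psubset.prems[OF x] by auto
    qed
    moreover have "card M = card ?N + 2"
    proof -
      have "card {x, g x} = 2" "{x, g x} \<subseteq> M" using psubset.prems[OF x] x by auto
      then show ?thesis using card_Diff_subset[of "{x, g x}" M] card_mono[of M "{x, g x}"] psubset.hyps(1) by simp
    qed
    ultimately show ?thesis by simp
  qed simp
qed

lemma funpow_in: "(\<And>x. x \<in> M \<Longrightarrow> f x \<in> M) \<Longrightarrow> x \<in> M \<Longrightarrow> (f ^^ n) x \<in> M"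
  by (induction n) auto

text \<open>In the induction step \<open>f ^^ (2 ^ e)\<close> is an involution; the points that it
  moves pair up, so its fixed points are odd in number, and \<open>f\<close> acts on them with
  smaller order.\<close>

lemma fixed_point_if_two_power_order:
  fixes f :: "'b \<Rightarrow> 'b"
  assumes "finite M" "odd (card M)" "\<And>x. x \<in> M \<Longrightarrow> f x \<in> M" "\<And>x. x \<in> M \<Longrightarrow> (f ^^ (2 ^ e)) x = x"
  shows "\<exists>x\<in>M. f x = x"
  using assms
proof (induction e arbitrary: M)
  case 0
  then obtain x where "x \<in> M" by (metis card.empty even_zero ex_in_conv)
  with 0 show ?case by auto
next
  case (Suc e)
  let ?g = "f ^^ (2 ^ e)"
  have gg: "?g (?g x) = (f ^^ (2 ^ Suc e)) x" for x
    by (simp add: mult_2 funpow_add)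
  have gM: "?g x \<in> M" if "x \<in> M" for x using funpow_in[of M f] Suc.prems(3) that by blast
  let ?F = "{x \<in> M. ?g x = x}"
  have "even (card (M - ?F))"
    by (rule even_card_if_involution[of _ ?g]) (use Suc.prems(1,4) gM gg in auto)
  moreover have "card M = card ?F + card (M - ?F)"
    using Suc.prems(1) by (subst card_Un_disjoint[symmetric]) (auto intro: arg_cong[of _ _ card])
  ultimately have odd: "odd (card ?F)" using Suc.prems(2) by simp
  have "\<exists>x\<in>?F. f x = x"
  proof (rule Suc.IH)
    show "f x \<in> ?F" if "x \<in> ?F" for x
      using that Suc.prems(3)[of x] funpow_swap1[of f "2 ^ e" x] by auto
  qed (use Suc.prems(1) odd in auto)
  then show ?case by blast
qed

text \<open>Some iterate \<open>f ^^ N\<close> is the identity on \<open>M\<close>. Writing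
  \<open>N = 2 ^ e * h\<close> with \<open>h\<close> odd, \<open>f ^^ h\<close> acts with 2-power
  order and so fixes a point of an odd set. For ideal classes this extracts an odd exponent from
  counting alone.\<close>

lemma odd_period:
  assumes fin: "finite M" and odd: "odd (card M)" and f: "\<And>x. x \<in> M \<Longrightarrow> f x \<in> M" and inj: "inj_on f M"
  shows "\<exists>h. odd h \<and> (\<exists>x\<in>M. (f ^^ h) x = x)"
proof -
  have fM: "(f ^^ n) x \<in> M" if "x \<in> M" for n x using funpow_in[of M f x n] f that by blast
  have injn: "inj_on (f ^^ n) M" for n
  proof (induction n)
    case (Suc n)
    then show ?case using inj fM by (auto simp: inj_on_def)
  qed simp
  let ?r = "\<lambda>n. restrict (f ^^ n) M"
  have "range ?r \<subseteq> PiE M (\<lambda>_. M)" using fM by auto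
  then have "finite (range ?r)" using fin by (meson finite_PiE finite_subset)
  then have "\<not> inj ?r" using finite_imageD infinite_UNIV_nat by blast
  then obtain a b where ab: "a < b" "?r a = ?r b" unfolding inj_on_def by (metis UNIV_I linorder_neqE_nat)
  define N where "N = b - a"
  have N: "N > 0" "b = a + N" using ab by (auto simp: N_def)
  have fN: "(f ^^ N) x = x" if x: "x \<in> M" for x
  proof -
    have "(f ^^ a) x = (f ^^ b) x" using fun_cong[OF ab(2), of x] x by simp
    then have "(f ^^ a) x = (f ^^ a) ((f ^^ N) x)" by (simp add: N funpow_add)
    then show ?thesis using injn[of a] x fM[OF x] by (auto dest: inj_onD)
  qed
  obtain h where h: "N = 2 ^ multiplicity 2 N * h" "odd h"
    using multiplicity_decompose'[of N 2] N(1) by auto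
  define e where "e = multiplicity 2 N"
  note eh = h[folded e_def]
  have "\<exists>x\<in>M. (f ^^ h) x = x"
  proof (rule fixed_point_if_two_power_order[OF fin odd])
    show "((f ^^ h) ^^ 2 ^ e) x = x" if "x \<in> M" for x
      using fN[OF that] by (simp add: funpow_mult eh mult.commute)
  qed (use fM in auto)
  then show ?thesis using eh by blast
qed

text \<open>The same sums of products as in \<open>ideal_prod\<close>, freed from the ring argument,
  so that commutativity and associativity hold for arbitrary sets of complex numbers.\<close>

inductive_set mprod :: "complex set \<Rightarrow> complex set \<Rightarrow> complex set" for A B where
  prod: "a \<in> A \<Longrightarrow> b \<in> B \<Longrightarrow> a * b \<in> mprod A B"
| sum: "x \<in> mprod A B \<Longrightarrow> y \<in> mprod A B \<Longrightarrow> x + y \<in> mprod A B"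

lemma ideal_prod_eq_mprod: "ideal_prod (ring_of_integers K) A B = mprod A B"
proof (intro Set.set_eqI iffI)
  fix x assume "x \<in> ideal_prod (ring_of_integers K) A B"
  then show "x \<in> mprod A B"
    by induction (auto simp: ring_of_integers_def intro: mprod.intros)
next
  fix x assume "x \<in> mprod A B"
  then show "x \<in> ideal_prod (ring_of_integers K) A B"
  proof induction
    case (prod a b)
    then show ?case using ideal_prod.prod[of a A b B "ring_of_integers K"] by (simp add: ring_of_integers_def)
  next
    case (sum x y)
    then show ?case using ideal_prod.sum[of x "ring_of_integers K" A B y] by (simp add: ring_of_integers_def)
  qed
qed

lemma mprod_subset:
  assumes "\<And>a b. a \<in> A \<Longrightarrow> b \<in> B \<Longrightarrow> a * b \<in> D" "\<And>x y. x \<in> D \<Longrightarrow> y \<in> D \<Longrightarrow> x + y \<in> D"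
  shows "mprod A B \<subseteq> D"
proof
  fix x assume "x \<in> mprod A B" then show "x \<in> D" by induction (auto intro: assms)
qed

lemma mprod_commute_subset: "mprod A B \<subseteq> mprod B A"
  by (rule mprod_subset) (metis mprod.prod mult.commute, rule mprod.sum)

lemma mprod_commute: "mprod A B = mprod B A"
  using mprod_commute_subset by blast

lemma mprod_mono: "A \<subseteq> A' \<Longrightarrow> B \<subseteq> B' \<Longrightarrow> mprod A B \<subseteq> mprod A' B'"
  by (rule mprod_subset) (auto intro: mprod.intros)

lemma mprod_assoc_subset: "mprod (mprod A B) D \<subseteq> mprod A (mprod B D)"
proof (rule mprod_subset)
  fix x c assume "x \<in> mprod A B" and c: "c \<in> D"
  then show "x * c \<in> mprod A (mprod B D)"
  proof induction
    case (prod a b)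
    then show ?case using mprod.prod[of a A "b * c" "mprod B D"] mprod.prod[of b B c D] c by (simp add: mult.assoc)
  next
    case (sum x y)
    then show ?case by (simp add: distrib_right mprod.sum)
  qed
qed (rule mprod.sum)

lemma mprod_assoc: "mprod (mprod A B) D = mprod A (mprod B D)"
proof
  have "mprod A (mprod B D) = mprod (mprod D B) A" by (metis mprod_commute)
  also have "\<dots> \<subseteq> mprod D (mprod B A)" by (rule mprod_assoc_subset)
  also have "\<dots> = mprod (mprod A B) D" by (metis mprod_commute)
  finally show "mprod A (mprod B D) \<subseteq> mprod (mprod A B) D" .
qed (rule mprod_assoc_subset)

lemma mprod_left_commute: "mprod A (mprod B D) = mprod B (mprod A D)"
  unfolding mprod_assoc[symmetric] mprod_commute[of A B] ..

definition scale :: "complex \<Rightarrow> complex set \<Rightarrow> complex set" where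
  "scale c A = (\<lambda>x. c * x) ` A"

lemma scale_1 [simp]: "scale 1 A = A" by (simp add: scale_def)

lemma scale_scale [simp]: "scale a (scale b A) = scale (a * b) A"
  by (auto simp: scale_def image_image mult.assoc)

lemma mprod_scale_subset: "mprod (scale c A) B \<subseteq> scale c (mprod A B)"
proof (rule mprod_subset)
  fix a b assume "a \<in> scale c A" "b \<in> B"
  then obtain a' where "a = c * a'" "a' * b \<in> mprod A B" by (auto simp: scale_def intro: mprod.prod)
  then show "a * b \<in> scale c (mprod A B)"
    unfolding scale_def by (intro image_eqI[of _ _ "a' * b"]) (simp_all add: mult.assoc)
next
  fix x y assume "x \<in> scale c (mprod A B)" "y \<in> scale c (mprod A B)"
  then obtain x' y' where "x = c * x'" "y = c * y'" "x' \<in> mprod A B" "y' \<in> mprod A B"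
    by (auto simp: scale_def)
  then show "x + y \<in> scale c (mprod A B)"
    using mprod.sum[of x' A B y'] by (auto simp: scale_def simp flip: distrib_left)
qed

lemma mprod_scale_left:
  assumes "c \<noteq> 0" shows "mprod (scale c A) B = scale c (mprod A B)"
proof
  have "mprod A B = mprod (scale (1 / c) (scale c A)) B" using assms by simp
  also have "\<dots> \<subseteq> scale (1 / c) (mprod (scale c A) B)" by (rule mprod_scale_subset)
  finally have "scale c (mprod A B) \<subseteq> scale c (scale (1 / c) (mprod (scale c A) B))"
    by (auto simp: scale_def)
  then show "scale c (mprod A B) \<subseteq> mprod (scale c A) B" using assms by simp
qed (rule mprod_scale_subset)

lemma mprod_scale_right: "c \<noteq> 0 \<Longrightarrow> mprod A (scale c B) = scale c (mprod A B)"
  by (metis mprod_commute mprod_scale_left)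

section \<open>Fractional ideals and the class number as a number of orbits\<close>

context multiquadratic
begin

definition Ok :: "complex set" where "Ok = {x \<in> K. algebraic_int x}"

lemma carrier_ring_of_integers: "carrier (ring_of_integers K) = Ok"
  by (simp add: ring_of_integers_def Ok_def)

lemma Ok_closed:
  "1 \<in> Ok" "0 \<in> Ok" "x \<in> Ok \<Longrightarrow> y \<in> Ok \<Longrightarrow> x + y \<in> Ok" "x \<in> Ok \<Longrightarrow> y \<in> Ok \<Longrightarrow> x * y \<in> Ok" "x \<in> Ok \<Longrightarrow> - x \<in> Ok"
  by (auto simp: Ok_def add_in_K mult_in_K minus_in_K algebraic_int_add algebraic_int_mult)

lemma ring_ring_of_integers: "ring (ring_of_integers K)"
proof -
  have "subring Ok complex_field" by (rule C.subringI) (auto simp: Ok_closed)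
  then have "ring (complex_field\<lparr>carrier := Ok\<rparr>)" by (rule C.subring_is_ring)
  then show ?thesis by (simp add: ring_of_integers_def Ok_def)
qed

definition submod :: "complex set \<Rightarrow> bool" where
  "submod B \<longleftrightarrow> B \<subseteq> K \<and> 0 \<in> B \<and> (\<forall>x\<in>B. \<forall>y\<in>B. x + y \<in> B) \<and> (\<forall>r\<in>Ok. \<forall>x\<in>B. r * x \<in> B)"

definition fractional :: "complex set \<Rightarrow> bool" where
  "fractional F \<longleftrightarrow> submod F \<and> (\<exists>x\<in>F. x \<noteq> 0) \<and> (\<exists>e\<in>Ok. e \<noteq> 0 \<and> scale e F \<subseteq> Ok)"

lemma submodD:
  assumes "submod B"
  shows "B \<subseteq> K" "0 \<in> B" "x \<in> B \<Longrightarrow> y \<in> B \<Longrightarrow> x + y \<in> B" "r \<in> Ok \<Longrightarrow> x \<in> B \<Longrightarrow> r * x \<in> B"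
  using assms by (auto simp: submod_def)

lemma submod_Ok: "submod Ok"
  by (auto simp: submod_def Ok_closed) (auto simp: Ok_def)

lemma submod_scale: "submod B \<Longrightarrow> c \<in> K \<Longrightarrow> submod (scale c B)"
  unfolding submod_def scale_def
  by (auto simp: mult_in_K subset_iff simp flip: distrib_left mult.left_commute[of c])

lemma submod_mprod:
  assumes A: "submod A" and B: "submod B" shows "submod (mprod A B)"
proof -
  have "mprod A B \<subseteq> K"
    using submodD(1)[OF A] submodD(1)[OF B] by (intro mprod_subset) (auto intro: mult_in_K add_in_K)
  moreover have "0 \<in> mprod A B" using mprod.prod[of 0 A 0 B] submodD(2) A B by simp
  moreover have "r * x \<in> mprod A B" if "r \<in> Ok" "x \<in> mprod A B" for r x
    using that(2)
  proof induction
    case (prod a b)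
    then show ?case using mprod.prod[of "r * a" A b B] submodD(4)[OF A that(1)] by (simp add: mult.assoc)
  next
    case (sum x y)
    then show ?case by (simp add: distrib_left mprod.sum)
  qed
  ultimately show ?thesis by (auto simp: submod_def intro: mprod.sum)
qed

lemma mprod_Ok: "submod B \<Longrightarrow> mprod Ok B = B"
proof
  assume B: "submod B"
  show "mprod Ok B \<subseteq> B" using submodD[OF B] by (intro mprod_subset) auto
  show "B \<subseteq> mprod Ok B"
    using mprod.prod[of 1 Ok _ B] Ok_closed(1) by auto
qed

lemma ideal_iff_submod: "ideal J (ring_of_integers K) \<longleftrightarrow> submod J \<and> J \<subseteq> Ok"
proof
  assume J: "ideal J (ring_of_integers K)"
  interpret ideal J "ring_of_integers K" by (rule J)
  have sub: "J \<subseteq> Ok" using a_subset by (simp add: carrier_ring_of_integers)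
  have "0 \<in> J" using additive_subgroup.zero_closed[OF is_additive_subgroup] by (simp add: ring_of_integers_def)
  moreover have "x + y \<in> J" if "x \<in> J" "y \<in> J" for x y
    using additive_subgroup.a_closed[OF is_additive_subgroup that] by (simp add: ring_of_integers_def)
  moreover have "r * x \<in> J" if "r \<in> Ok" "x \<in> J" for r x
    using I_l_closed[of x r] that by (simp add: carrier_ring_of_integers) (simp add: ring_of_integers_def)
  ultimately show "submod J \<and> J \<subseteq> Ok" using sub by (auto simp: submod_def Ok_def)
next
  assume J: "submod J \<and> J \<subseteq> Ok"
  then have D: "0 \<in> J" "\<And>x y. x \<in> J \<Longrightarrow> y \<in> J \<Longrightarrow> x + y \<in> J" "\<And>r x. r \<in> Ok \<Longrightarrow> x \<in> J \<Longrightarrow> r * x \<in> J" "J \<subseteq> Ok"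
    by (auto simp: submod_def)
  have neg: "- x \<in> J" if "x \<in> J" for x using D(3)[of "- 1" x] that Ok_closed by simp
  interpret R: ring "ring_of_integers K" by (rule ring_ring_of_integers)
  show "ideal J (ring_of_integers K)"
  proof (rule idealI[OF ring_ring_of_integers])
    show "subgroup J (add_monoid (ring_of_integers K))"
    proof (rule R.add.subgroupI)
      show "J \<subseteq> carrier (ring_of_integers K)" using D(4) by (simp add: carrier_ring_of_integers)
      show "J \<noteq> {}" using D(1) by blast
      fix x assume x: "x \<in> J"
      have "\<ominus>\<^bsub>ring_of_integers K\<^esub> x = - x"
        using x neg[OF x] D(4) by (intro R.minus_equality) (auto simp: carrier_ring_of_integers, auto simp: ring_of_integers_def)
      then show "\<ominus>\<^bsub>ring_of_integers K\<^esub> x \<in> J" using neg[OF x] by simp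
      fix y assume "y \<in> J"
      then show "x \<oplus>\<^bsub>ring_of_integers K\<^esub> y \<in> J" using D(2)[OF x] by (simp add: ring_of_integers_def)
    qed
    show "x \<otimes>\<^bsub>ring_of_integers K\<^esub> a \<in> J" "a \<otimes>\<^bsub>ring_of_integers K\<^esub> x \<in> J"
      if "a \<in> J" "x \<in> carrier (ring_of_integers K)" for a x
      using D(3)[of x a] that by (simp_all add: carrier_ring_of_integers, simp_all add: ring_of_integers_def mult.commute)
  qed
qed

lemma fractional_ideals_eq: "fractional_ideals K = {F. fractional F}"
proof (intro Set.set_eqI iffI)
  fix F assume "F \<in> fractional_ideals K"
  then obtain a J where aJ: "F = (\<lambda>x. x / a) ` J" "a \<in> Ok" "a \<noteq> 0" "submod J" "J \<subseteq> Ok" "J \<noteq> {0}"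
    by (auto simp: fractional_ideals_def carrier_ring_of_integers ideal_iff_submod)
  then have F: "F = scale (1 / a) J" by (simp add: scale_def)
  have aK: "1 / a \<in> K" using aJ(2) by (auto simp: Ok_def intro: divide_in_K)
  obtain x where "x \<in> J" "x \<noteq> 0" using aJ(4,6) submodD(2) by blast
  then have "\<exists>x\<in>F. x \<noteq> 0" using aJ(3) by (auto simp: F scale_def)
  moreover have "scale a F \<subseteq> Ok" using aJ(3,5) by (simp add: F)
  ultimately show "F \<in> {F. fractional F}"
    using aJ(2,3) submod_scale[OF aJ(4) aK] unfolding fractional_def F by blast
next
  fix F assume "F \<in> {F. fractional F}"
  then obtain x e where F: "submod F" "x \<in> F" "x \<noteq> 0" "e \<in> Ok" "e \<noteq> 0" "scale e F \<subseteq> Ok"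
    by (auto simp: fractional_def)
  have "F = (\<lambda>x. x / e) ` scale e F" using F(5) by (simp add: scale_def image_image)
  moreover have "submod (scale e F)" using F(1,4) by (intro submod_scale) (auto simp: Ok_def)
  moreover have "e * x \<in> scale e F" "e * x \<noteq> 0" using F by (auto simp: scale_def)
  then have "scale e F \<noteq> {0}" by blast
  ultimately show "F \<in> fractional_ideals K"
    unfolding fractional_ideals_def carrier_ring_of_integers ideal_iff_submod using F(4-6) by blast
qed

definition ideal_class :: "complex set \<Rightarrow> complex set set" where
  "ideal_class F = (\<lambda>c. scale c F) ` (K - {0})"

text \<open>Multiplying \<open>F\<close> by all principal fractional ideals yields its orbit under
  scaling, so cosets of the principal ideals are such orbits.\<close>

lemma class_number_eq: "class_number K = card (ideal_class ` {F. fractional F})"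
proof -
  have "principal_fractional_ideals K #>\<^bsub>fractional_ideal_group K\<^esub> F = ideal_class F" if "fractional F" for F
  proof -
    have F: "submod F" using that by (simp add: fractional_def)
    have pf: "principal_fractional_ideals K = (\<lambda>c. scale c Ok) ` (K - {0})"
      by (auto simp: principal_fractional_ideals_def scale_def carrier_ring_of_integers)
    have "principal_fractional_ideals K #>\<^bsub>fractional_ideal_group K\<^esub> F = (\<lambda>c. mprod (scale c Ok) F) ` (K - {0})"
      by (auto simp: r_coset_def fractional_ideal_group_def ideal_prod_eq_mprod pf)
    also have "\<dots> = (\<lambda>c. scale c F) ` (K - {0})"
      using F by (intro image_cong) (auto simp: mprod_scale_left mprod_Ok)
    finally show ?thesis by (simp add: ideal_class_def)
  qed
  then have "carrier (class_group K) = ideal_class ` {F. fractional F}"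
    by (auto simp: class_group_def FactGroup_def RCOSETS_def)
      (auto simp: fractional_ideal_group_def fractional_ideals_eq)
  then show ?thesis by (simp add: class_number_def Coset.order_def)
qed

end

subsection \<open>Ideal classes\<close>

context multiquadratic
begin

text \<open>Complete integrality: all powers of \<open>z\<close> share one denominator. A fractional
  ideal comes with a common denominator rather than with a finite set of generators, so this, and
  not the determinant trick, is the condition its multipliers are seen to satisfy.\<close>

definition almost_integral :: "complex \<Rightarrow> bool" where
  "almost_integral z \<longleftrightarrow> z \<in> K \<and> (\<exists>e\<in>K. e \<noteq> 0 \<and> (\<forall>j::nat. algebraic_int (e * z ^ j)))"

lemma almost_integral_gal:
  assumes "almost_integral z" "A \<subseteq> I" shows "almost_integral (gal A z)"
proof -
  obtain e where e: "z \<in> K" "e \<in> K" "e \<noteq> 0" "\<And>j. algebraic_int (e * z ^ j)"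
    using assms(1) by (auto simp: almost_integral_def)
  have "algebraic_int (gal A e * gal A z ^ j)" for j
    using algebraic_int_gal[OF _ e(4)[of j], of A] e(1,2) by (simp add: gal_mult gal_power mult_in_K power_in_K)
  then show ?thesis using e assms(2) unfolding almost_integral_def
    by (intro conjI bexI[of _ "gal A e"]) (auto simp: gal_eq_0_iff)
qed

lemma almost_integral_mult:
  assumes "almost_integral z" "almost_integral w" shows "almost_integral (z * w)"
proof -
  obtain e where e: "z \<in> K" "e \<in> K" "e \<noteq> 0" "\<And>j. algebraic_int (e * z ^ j)"
    using assms(1) by (auto simp: almost_integral_def)
  obtain f where f: "w \<in> K" "f \<in> K" "f \<noteq> 0" "\<And>j. algebraic_int (f * w ^ j)"
    using assms(2) by (auto simp: almost_integral_def)
  have "algebraic_int (e * f * (z * w) ^ j)" for j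
    using algebraic_int_mult[OF e(4)[of j] f(4)[of j]] by (simp add: power_mult_distrib mult_ac)
  then show ?thesis using e f unfolding almost_integral_def
    by (intro conjI bexI[of _ "e * f"]) (auto simp: mult_in_K)
qed

lemma almost_integral_add:
  assumes "almost_integral z" "almost_integral w" shows "almost_integral (z + w)"
proof -
  obtain e where e: "z \<in> K" "e \<in> K" "e \<noteq> 0" "\<And>j. algebraic_int (e * z ^ j)"
    using assms(1) by (auto simp: almost_integral_def)
  obtain f where f: "w \<in> K" "f \<in> K" "f \<noteq> 0" "\<And>j. algebraic_int (f * w ^ j)"
    using assms(2) by (auto simp: almost_integral_def)
  have "algebraic_int (e * f * (z + w) ^ j)" for j
  proof -
    have "e * f * (z + w) ^ j = (\<Sum>k\<le>j. of_int (int (j choose k)) * ((e * z ^ k) * (f * w ^ (j - k))))"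
      by (simp add: binomial_ring sum_distrib_left mult_ac)
    then show ?thesis
      using algebraic_int_sum[of "{..j}" "\<lambda>k. of_int (int (j choose k)) * ((e * z ^ k) * (f * w ^ (j - k)))"]
        algebraic_int_of_int_mult[OF algebraic_int_mult[OF e(4) f(4)]] by metis
  qed
  then show ?thesis using e f unfolding almost_integral_def
    by (intro conjI bexI[of _ "e * f"]) (auto simp: mult_in_K add_in_K)
qed

lemma algebraic_int_if_almost_integral_rational:
  assumes z: "almost_integral z" "z \<in> \<rat>" shows "algebraic_int z"
proof -
  obtain e where e: "e \<in> K" "e \<noteq> 0" "\<And>j. algebraic_int (e * z ^ j)"
    using z(1) by (auto simp: almost_integral_def)
  \<comment> \<open>Multiplication by its other conjugates turns the common denominator
    \<open>e\<close> into a rational integer.\<close>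
  let ?N = "\<Prod>A\<in>Pow I. gal A e" and ?M = "\<Prod>A\<in>Pow I - {{}}. gal A e"
  have N: "?N = ?M * e" using e(1) by (subst prod.remove[of _ "{}"]) auto
  have eint: "algebraic_int e" using e(3)[of 0] by simp
  have M: "algebraic_int ?M" using e(1) eint by (auto intro!: algebraic_int_prod algebraic_int_gal)
  have NQ: "?N \<in> \<rat>" using e(1) by (rule norm_rational)
  have Nz: "?N * z ^ j \<in> \<int>" for j
  proof (rule rational_algebraic_int_is_int)
    show "?N * z ^ j \<in> \<rat>" using NQ z(2) by simp
    show "algebraic_int (?N * z ^ j)" unfolding N mult.assoc by (rule algebraic_int_mult[OF M e(3)])
  qed
  obtain n where n: "?N = of_int n" using Nz[of 0] by (auto elim: Ints_cases)
  have n0: "n \<noteq> 0" using n e(1,2) by (auto simp: gal_eq_0_iff)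
  obtain a b where ab: "b > 0" "Rings.coprime a b" "z = of_int a / of_int b"
    using z(2) by (auto elim: Rats_cases')
  \<comment> \<open>All powers of the denominator \<open>b\<close> divide one nonzero integer, which
    forces \<open>b = 1\<close>.\<close>
  have "b ^ j dvd n" for j
  proof -
    obtain k where "?N * z ^ j = of_int k" using Nz[of j] by (auto elim: Ints_cases)
    then have "complex_of_int (n * a ^ j) = of_int (k * b ^ j)"
      using ab(1,3) by (simp add: n power_divide field_simps)
    then have "n * a ^ j = k * b ^ j" by (simp only: of_int_eq_iff)
    then have "b ^ j dvd n * a ^ j" by simp
    moreover have "Rings.coprime (b ^ j) (a ^ j)" using ab(2) by (simp add: coprime_commute)
    ultimately show ?thesis using coprime_dvd_mult_left_iff by blast
  qed
  then have "b ^ nat \<bar>n\<bar> \<le> \<bar>n\<bar>" using n0 by (intro zdvd_imp_le) auto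
  moreover have "\<bar>n\<bar> < b ^ nat \<bar>n\<bar>" if "b \<ge> 2"
  proof -
    have "\<bar>n\<bar> < 2 ^ nat \<bar>n\<bar>"
      using of_nat_less_two_power[of "nat \<bar>n\<bar>", where ?'a = int] by simp
    also have "\<dots> \<le> b ^ nat \<bar>n\<bar>" using that by (intro power_mono) auto
    finally show ?thesis .
  qed
  ultimately have "b = 1" using ab(1) by force
  then show ?thesis using ab(3) by simp
qed

text \<open>
  Descends along the tower of quadratic extensions: \<open>z\<close> is a root of a monic quadratic polynomial
  whose coefficients are the trace and the norm of \<open>z\<close> to the next smaller field.
\<close>

lemma algebraic_int_if_almost_integral_fixed:
  assumes "J \<subseteq> I" "almost_integral z" "\<And>i. i \<in> I - J \<Longrightarrow> gal {i} z = z"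
  shows "algebraic_int z"
proof -
  have "finite J" using assms(1) by (rule finite_sub)
  then show ?thesis using assms
  proof (induction J arbitrary: z rule: finite_induct)
    case empty
    then have "z \<in> \<rat>" by (intro rational_if_fixed) (auto simp: almost_integral_def)
    then show ?case using algebraic_int_if_almost_integral_rational empty by blast
  next
    case (insert i J)
    have i: "{i} \<subseteq> I" and zK: "z \<in> K" using insert.prems by (auto simp: almost_integral_def)
    have ai: "almost_integral (gal {i} z)" using insert.prems(2) i by (rule almost_integral_gal)
    let ?t = "z + gal {i} z" and ?n = "z * gal {i} z"
    have fixed: "gal {i'} ?t = ?t \<and> gal {i'} ?n = ?n" if i': "i' \<in> I - J" for i'
    proof (cases "i' = i")
      case True
      then show ?thesis using zK i by (simp add: gal_add gal_mult add.commute mult.commute)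
    next
      case False
      have z: "gal {i'} z = z" using insert.prems(3) i' False by blast
      have "gal {i'} (gal {i} z) = gal {i} (gal {i'} z)"
        using zK i i' by (simp add: gal_gal Un_commute)
      then show ?thesis using zK by (simp add: gal_add gal_mult z)
    qed
    have "algebraic_int ?t" "algebraic_int ?n"
      using insert.prems fixed insert.IH[of ?t] insert.IH[of ?n]
        almost_integral_add[OF insert.prems(2) ai] almost_integral_mult[OF insert.prems(2) ai] by auto
    then show ?case by (rule algebraic_int_monic_quadratic) (simp add: algebra_simps)
  qed
qed

lemma algebraic_int_if_almost_integral: "almost_integral z \<Longrightarrow> algebraic_int z"
  by (rule algebraic_int_if_almost_integral_fixed[of I]) auto

text \<open>For nonzero \<open>x \<in> F\<close> every \<open>x * a ^ j\<close> stays in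
  \<open>F\<close>, so \<open>x\<close> times a denominator of \<open>F\<close> is a common
  denominator for the powers of \<open>a\<close>.\<close>

lemma stabiliser_subset_Ok:
  assumes F: "fractional F" and A: "A \<subseteq> K" "mprod A F \<subseteq> F"
  shows "A \<subseteq> Ok"
proof
  fix a assume a: "a \<in> A"
  obtain x e where x: "submod F" "x \<in> F" "x \<noteq> 0" and e: "e \<in> Ok" "e \<noteq> 0" "scale e F \<subseteq> Ok"
    using F by (auto simp: fractional_def)
  have pw: "x * a ^ j \<in> F" for j
  proof (induction j)
    case (Suc j)
    have "a * (x * a ^ j) \<in> F" using A(2) mprod.prod[OF a Suc] by blast
    then show ?case by (simp add: mult.left_commute)
  qed (use x in simp)
  have "e * (x * a ^ j) \<in> Ok" for j using e(3) pw[of j] unfolding scale_def by (meson image_subset_iff)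
  then have "\<forall>j. algebraic_int (e * x * a ^ j)" by (simp add: Ok_def mult.assoc)
  moreover have "e * x \<in> K" using submodD(1)[OF x(1)] x(2) e(1) by (auto simp: Ok_def intro: mult_in_K)
  ultimately have "almost_integral a"
    unfolding almost_integral_def using a A(1) x(3) e(2) by (intro conjI bexI[of _ "e * x"]) auto
  then show "a \<in> Ok" using algebraic_int_if_almost_integral a A(1) by (auto simp: Ok_def)
qed

section \<open>The action of an ideal on the set of ideal classes\<close>

lemma ideal_class_self: "F \<in> ideal_class F"
  unfolding ideal_class_def by (rule image_eqI[of _ _ 1]) simp_all

lemma ideal_class_eqD:
  assumes "ideal_class F = ideal_class G" shows "\<exists>c\<in>K. c \<noteq> 0 \<and> F = scale c G"
proof -
  have "F \<in> ideal_class G" using ideal_class_self[of F] assms by (simp only:)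
  then show ?thesis by (auto simp: ideal_class_def)
qed

lemma ideal_class_scale:
  assumes "c \<in> K" "c \<noteq> 0" shows "ideal_class (scale c F) = ideal_class F"
proof -
  have "(\<lambda>b. b * c) ` (K - {0}) = K - {0}"
  proof (intro Set.set_eqI iffI)
    fix x assume "x \<in> K - {0}"
    then show "x \<in> (\<lambda>b. b * c) ` (K - {0})"
      using assms by (intro image_eqI[of _ _ "x / c"]) (auto intro: divide_in_K)
  qed (use assms in \<open>auto intro: mult_in_K\<close>)
  then have "(\<lambda>b. scale b F) ` (K - {0}) = (\<lambda>b. scale b F) ` (\<lambda>b. b * c) ` (K - {0})"
    by (simp only:)
  then show ?thesis by (simp add: ideal_class_def image_image)
qed

lemma mprod_image_ideal_class: "mprod A ` ideal_class F = ideal_class (mprod A F)"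
  unfolding ideal_class_def image_image by (intro image_cong refl) (simp add: mprod_scale_right)

lemma fractional_mprod:
  assumes P: "submod P" "P \<subseteq> Ok" "x \<in> P" "x \<noteq> 0" and F: "fractional F"
  shows "fractional (mprod P F)"
proof -
  obtain y e where y: "submod F" "y \<in> F" "y \<noteq> 0" and e: "e \<in> Ok" "e \<noteq> 0" "scale e F \<subseteq> Ok"
    using F by (auto simp: fractional_def)
  have "x * y \<in> mprod P F" "x * y \<noteq> 0" using P y by (auto intro: mprod.prod)
  moreover have "scale e (mprod P F) = mprod P (scale e F)" using e(2) by (simp add: mprod_scale_right)
  moreover have "mprod P (scale e F) \<subseteq> Ok" using mprod_mono[OF P(2) e(3)] mprod_Ok[OF submod_Ok] by simp
  ultimately show ?thesis
    unfolding fractional_def using e(1,2) submod_mprod[OF P(1) y(1)]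
    by (intro conjI bexI[of _ "x * y"] bexI[of _ e]) simp_all
qed

definition mpower :: "complex set \<Rightarrow> nat \<Rightarrow> complex set" where
  "mpower A n = (mprod A ^^ n) Ok"

lemma mpower_0 [simp]: "mpower A 0 = Ok" and mpower_Suc [simp]: "mpower A (Suc n) = mprod A (mpower A n)"
  by (simp_all add: mpower_def)

lemma submod_mpower: "submod A \<Longrightarrow> submod (mpower A n)"
  by (induction n) (auto intro: submod_Ok submod_mprod)

lemma funpow_mprod: "submod F \<Longrightarrow> (mprod A ^^ n) F = mprod (mpower A n) F"
  by (induction n) (auto simp: mprod_Ok mprod_assoc)

lemma mprod_mpower:
  assumes "mprod A B = scale p Ok" "p \<noteq> 0"
  shows "mprod (mpower A n) (mpower B n) = scale (p ^ n) Ok"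
proof (induction n)
  case (Suc n)
  have "mprod (mpower A (Suc n)) (mpower B (Suc n)) = mprod (mprod A B) (mprod (mpower A n) (mpower B n))"
    by (simp add: mprod_assoc mprod_left_commute)
  also have "\<dots> = scale p (mprod Ok (scale (p ^ n) Ok))"
    unfolding assms(1) Suc by (rule mprod_scale_left[OF assms(2)])
  also have "\<dots> = scale (p ^ Suc n) Ok"
    using assms(2) by (simp add: mprod_scale_right mprod_Ok submod_Ok)
  finally show ?case .
qed (simp add: mprod_Ok submod_Ok)

text \<open>\<open>mprod P\<close> permutes the ideal classes, with inverse induced by
  \<open>Q\<close> because \<open>mprod P Q\<close> is principal. A class fixed by an odd iterate
  gives \<open>mprod (mpower P h) F = scale c F\<close>, and \<open>F\<close> is then removed by
  looking at its multipliers.\<close>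

lemma odd_power_principal:
  assumes odd: "odd (class_number K)"
    and P: "submod P" "P \<subseteq> Ok" and Q: "submod Q" "Q \<subseteq> Ok"
    and PQ: "mprod P Q = scale p Ok" and p: "p \<in> K" "p \<noteq> 0"
  shows "\<exists>h c. odd h \<and> c \<in> K \<and> c \<noteq> 0 \<and> mpower P h = scale c Ok \<and> mpower Q h = scale (p ^ h / c) Ok"
proof -
  let ?Fr = "{F. fractional F}"
  let ?M = "ideal_class ` ?Fr"
  \<comment> \<open>An infinite set has cardinality 0, which is even.\<close>
  have fin: "finite ?M" by (rule ccontr) (use odd in \<open>simp add: class_number_eq\<close>)
  obtain x where x: "x \<in> P" "x \<noteq> 0"
  proof (rule ccontr)
    assume "\<not> thesis"
    then have "P \<subseteq> {0}" using that by blast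
    then have "mprod P Q \<subseteq> {0}" by (intro mprod_subset) auto
    moreover have "p \<in> scale p Ok" unfolding scale_def using Ok_closed(1) by (intro image_eqI[of _ _ 1]) auto
    ultimately show False using PQ p(2) by auto
  qed
  have PF: "fractional (mprod P F)" if "fractional F" for F using fractional_mprod[OF P x that] .
  have closed: "mprod P ` C \<in> ?M" if "C \<in> ?M" for C
    using that PF by (auto simp: mprod_image_ideal_class)
  have QP: "mprod Q ` (mprod P ` C) = C" if "C \<in> ?M" for C
  proof -
    obtain F where F: "fractional F" "C = ideal_class F" using \<open>C \<in> ?M\<close> by blast
    have "mprod Q (mprod P F) = mprod (mprod P Q) F" by (simp add: mprod_assoc mprod_left_commute)
    also have "\<dots> = scale p F"
      using F(1) p(2) by (simp add: PQ mprod_scale_left mprod_Ok fractional_def)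
    finally show ?thesis using F(2) p by (simp add: mprod_image_ideal_class ideal_class_scale)
  qed
  have inj: "inj_on (image (mprod P)) ?M" by (rule inj_on_inverseI[of _ "image (mprod Q)"]) (rule QP)
  obtain h C where h: "odd h" "C \<in> ?M" "(image (mprod P) ^^ h) C = C"
    using odd_period[OF fin _ closed inj] odd class_number_eq by auto
  obtain F where F: "fractional F" "C = ideal_class F" using h(2) by blast
  have subF: "submod F" using F(1) by (simp add: fractional_def)
  have "(image (mprod P) ^^ n) (ideal_class F) = ideal_class (mprod (mpower P n) F)" for n
  proof -
    have "(image (mprod P) ^^ n) (ideal_class F) = ideal_class ((mprod P ^^ n) F)"
      by (induction n) (auto simp: mprod_image_ideal_class)
    then show ?thesis using subF by (simp add: funpow_mprod)
  qed
  then have "ideal_class (mprod (mpower P h) F) = ideal_class F" using h(3) F(2) by simp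
  then obtain c where c: "c \<in> K" "c \<noteq> 0" "mprod (mpower P h) F = scale c F"
    using ideal_class_eqD by blast
  \<comment> \<open>\<open>mpower P h\<close> divided by \<open>c\<close>, and its inverse ideal;
    both map \<open>F\<close> to itself and are therefore contained in \<open>Ok\<close>. Two such
    ideals with product \<open>Ok\<close> are equal to \<open>Ok\<close>.\<close>
  define A B where "A = scale (1 / c) (mpower P h)" and "B = scale (c / p ^ h) (mpower Q h)"
  have ck: "1 / c \<in> K" "c / p ^ h \<in> K" using c p by (auto intro: divide_in_K power_in_K)
  have subA: "submod A" and subB: "submod B"
    unfolding A_def B_def using P Q ck by (auto intro!: submod_scale submod_mpower)
  have AF: "mprod A F = F" using c by (simp add: A_def mprod_scale_left)
  have AB: "mprod A B = Ok"
    using c(2) p(2) mprod_mpower[OF PQ p(2), of h] by (simp add: A_def B_def mprod_scale_left mprod_scale_right)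
  have "mprod B F = mprod B (mprod A F)" by (simp only: AF)
  also have "\<dots> = mprod (mprod A B) F" by (simp add: mprod_assoc mprod_left_commute)
  finally have "mprod B F = mprod (mprod A B) F" .
  then have BF: "mprod B F = F" using AB subF by (simp add: mprod_Ok)
  have AO: "A \<subseteq> Ok" using stabiliser_subset_Ok[OF F(1) submodD(1)[OF subA]] AF by simp
  have BO: "B \<subseteq> Ok" using stabiliser_subset_Ok[OF F(1) submodD(1)[OF subB]] BF by simp
  have "Ok \<subseteq> mprod A Ok" using mprod_mono[OF subset_refl BO, of A] AB by simp
  then have "A = Ok" using AO mprod_Ok[OF subA] mprod_commute[of A Ok] by auto
  then have "scale c Ok = scale c A" by (simp only:)
  then have "scale c Ok = mpower P h" using c(2) by (simp add: A_def)
  moreover have "Ok \<subseteq> mprod Ok B" using mprod_mono[OF AO subset_refl, of B] AB by simp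
  then have "B = Ok" using BO mprod_Ok[OF subB] by auto
  then have "scale (p ^ h / c) Ok = scale (p ^ h / c) B" by (simp only:)
  then have "scale (p ^ h / c) Ok = mpower Q h" using c(2) p(2) by (simp add: B_def)
  ultimately show ?thesis using h(1) c(1,2) by (intro exI[of _ h] exI[of _ c]) simp
qed

end

subsection \<open>Ramification\<close>

lemma odd_prime_not_dvd_2:
  fixes p :: int
  assumes "prime p" "odd p" shows "\<not> p dvd 2"
proof
  assume "p dvd 2"
  then have "p \<le> 2" by (intro zdvd_imp_le) auto
  then have "p = 2" using prime_gt_1_int[OF assms(1)] by linarith
  then show False using assms(2) by simp
qed

text \<open>Integrality of \<open>x\<^sup>2 / y\<close> says that \<open>x\<close> has at least half
  the valuation of \<open>y\<close>. The cross term \<open>x * z / y\<close> is integral because its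
  square is the product of the two given quotients.\<close>

lemma p_integral_square_div_add:
  assumes p: "prime p" and "p_integral p (x\<^sup>2 / y)" "p_integral p (z\<^sup>2 / y)"
  shows "p_integral p ((x + z)\<^sup>2 / y)"
proof (cases "y = 0")
  case False
  have "(x * z / y)\<^sup>2 = x\<^sup>2 / y * (z\<^sup>2 / y)" by (simp add: power_mult_distrib power2_eq_square)
  then have "p_integral p ((x * z / y)\<^sup>2)" using p_integral_mult[OF p assms(2,3)] by (simp only:)
  then have "p_integral p (x * z / y)" by (rule p_integral_power2_imp[OF p])
  then have "p_integral p (x\<^sup>2 / y + z\<^sup>2 / y + of_int 2 * (x * z / y))"
    using assms by (intro p_integral_add[OF p] p_integral_mult[OF p] p_integral_of_int[OF p])
  moreover have "(x + z)\<^sup>2 / y = x\<^sup>2 / y + z\<^sup>2 / y + of_int 2 * (x * z / y)"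
    by (simp add: power2_sum add_divide_distrib)
  ultimately show ?thesis by simp
qed (use assms in simp)

lemma p_integral_square_div_sum:
  assumes p: "prime p" and "\<And>j. j \<in> J \<Longrightarrow> p_integral p ((f j)\<^sup>2 / y)"
  shows "p_integral p ((\<Sum>j\<in>J. f j)\<^sup>2 / y)"
  using assms(2)
  by (induction J rule: infinite_finite_induct)
    (auto intro: p_integral_square_div_add[OF p] p_integral_algebraic_int[OF p])

section \<open>Inertia and traces at an odd prime\<close>

context multiquadratic
begin

text \<open>For \<open>S \<subseteq> I\<close>, \<open>chi (ram p) S\<close> is the sign given by
  the parity of the \<open>p\<close>-adic valuation of \<open>prod d S\<close>. So for odd
  \<open>p\<close> the automorphism \<open>gal (ram p)\<close> fixes exactly the roots
  \<open>prod s S\<close> that are unramified at \<open>p\<close>, and generates inertia.\<close>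

definition ram :: "int \<Rightarrow> 'i set" where
  "ram p = {i \<in> I. odd (multiplicity p (d i))}"

lemma ram_subset: "ram p \<subseteq> I" by (auto simp: ram_def)

lemma d_nonzero: "i \<in> I \<Longrightarrow> d i \<noteq> 0"
  using s_square[of i] s_nonzero[of i] by auto

lemma even_multiplicity_prod:
  assumes p: "prime p" and S: "S \<subseteq> I" "chi (ram p) S = 1"
  shows "even (multiplicity p (prod d S))"
proof -
  have "multiplicity p (prod d S) = (\<Sum>i\<in>S. multiplicity p (d i))"
    using S(1) p d_nonzero by (intro prime_elem_multiplicity_prod_distrib) (auto intro: finite_sub)
  moreover have "even (\<Sum>i\<in>S. multiplicity p (d i)) \<longleftrightarrow> even (card {i \<in> S. odd (multiplicity p (d i))})"
    using finite_sub[OF S(1)] by (simp add: even_sum_iff)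
  moreover have "{i \<in> S. odd (multiplicity p (d i))} = ram p \<inter> S" using S(1) by (auto simp: ram_def)
  moreover have "even (card (ram p \<inter> S))"
    using S(2) by (cases "even (card (ram p \<inter> S))") (auto simp: chi_def)
  ultimately show ?thesis by simp
qed

lemma sqrt_coprime_part:
  assumes p: "prime p" and S: "S \<subseteq> I" and k: "multiplicity p (prod d S) = 2 * e + k"
  shows "\<exists>a. \<not> p dvd a \<and> (prod s S / of_int p ^ e)\<^sup>2 = of_int (p ^ k * a)"
proof -
  have "prod d S \<noteq> 0" using S d_nonzero by (auto simp: prod_zero_iff finite_sub)
  moreover have "\<not> is_unit p" using p not_prime_unit by blast
  ultimately obtain a where a: "prod d S = p ^ (2 * e + k) * a" "\<not> p dvd a"
    using multiplicity_decompose'[of "prod d S" p] unfolding k by blast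
  have "(prod s S)\<^sup>2 = (\<Prod>i\<in>S. of_int (d i))"
    unfolding prod_power_distrib using S by (intro prod.cong) (auto simp: s_square)
  also have "\<dots> = of_int (prod d S)" by simp
  finally have "(prod s S)\<^sup>2 = of_int p ^ (2 * e) * of_int (p ^ k * a)"
    by (simp only: a of_int_mult of_int_power power_add mult.assoc)
  moreover have "complex_of_int p \<noteq> 0" using p by auto
  ultimately have "(prod s S / of_int p ^ e)\<^sup>2 = of_int (p ^ k * a)"
    by (simp add: power_divide power_mult mult.commute[of 2 e] del: of_int_mult of_int_power)
  then show ?thesis using a by blast
qed

lemma gal_prod_s_div:
  assumes "S \<subseteq> I"
  shows "prod s S / of_int p ^ e \<in> K" "gal A (prod s S / of_int p ^ e) = of_int (chi A S) * (prod s S / of_int p ^ e)"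
proof -
  have "of_int p ^ e \<in> K" "gal A (of_int p ^ e) = of_int p ^ e" by (simp_all add: power_in_K gal_power)
  then show "prod s S / of_int p ^ e \<in> K" "gal A (prod s S / of_int p ^ e) = of_int (chi A S) * (prod s S / of_int p ^ e)"
    using assms by (simp_all add: divide_in_K prod_s_in_K gal_divide gal_prod_s)
qed

text \<open>
  The fixed field of \<open>gal (ram p)\<close> is unramified at the odd prime \<open>p\<close>: traces against the
  elements \<open>prod s S / p ^ e\<close>, whose squares are prime to \<open>p\<close>, detect divisibility by \<open>p\<close>.
\<close>

lemma unramified:
  assumes p: "prime p" "odd p" and z: "z \<in> K" "gal (ram p) z = z" and zp: "p_integral p (z\<^sup>2 / of_int p)"
  shows "p_integral p (z / of_int p)"
proof -
  have p0: "complex_of_int p \<noteq> 0" using p by auto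
  \<comment> \<open>Twisted trace of \<open>z\<close>, its component at the character of
    \<open>S\<close> up to the group order. If \<open>gal (ram p)\<close> negates
    \<open>prod s S\<close>, this component vanishes because \<open>z\<close> is fixed.\<close>
  define zS where "zS S = (\<Sum>A\<in>Pow I. of_int (chi A S) * gal A z)" for S
  have zSp: "p_integral p (zS S / of_int p)" if S: "S \<subseteq> I" for S
  proof (cases "chi (ram p) S = 1")
    case False
    then have c: "chi (ram p) S = - 1" using chi_cases by blast
    have "zS S = (\<Sum>A\<in>Pow I. of_int (chi (A \<triangle> ram p) S) * gal (A \<triangle> ram p) z)"
      unfolding zS_def by (rule sum.reindex_bij_betw[OF bij_betw_sdiff[OF ram_subset], symmetric])
    also have "\<dots> = (\<Sum>A\<in>Pow I. - (of_int (chi A S) * gal A z))"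
    proof (intro sum.cong refl)
      fix A assume "A \<in> Pow I"
      then have "gal (A \<triangle> ram p) z = gal A z" "chi (A \<triangle> ram p) S = - chi A S"
        using gal_gal[OF z(1), of A "ram p"] z(2) ram_subset c by (auto simp: chi_sdiff_left finite_sub)
      then show "of_int (chi (A \<triangle> ram p) S) * gal (A \<triangle> ram p) z = - (of_int (chi A S) * gal A z)" by simp
    qed
    finally have "zS S = 0" by (simp add: zS_def sum_negf)
    then show ?thesis by (simp add: p_integral_algebraic_int[OF p(1)])
  next
    case True
    obtain e where e: "multiplicity p (prod d S) = 2 * e + 0"
      using even_multiplicity_prod[OF p(1) S True] by auto
    define r where "r = prod s S / of_int p ^ e"
    obtain a where a: "\<not> p dvd a" "r\<^sup>2 = of_int a"
      using sqrt_coprime_part[OF p(1) S e] by (auto simp: r_def)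
    have r: "r \<in> K" "\<And>A. gal A r = of_int (chi A S) * r" unfolding r_def using gal_prod_s_div[OF S] by auto
    have a0: "complex_of_int a \<noteq> 0" using a(1) by auto
    \<comment> \<open>The factor \<open>r\<close> turns the twisted trace into an ordinary trace,
      which is rational; it can be removed afterwards because its square \<open>a\<close> is prime
      to \<open>p\<close>.\<close>
    have c_eq: "zS S * r = (\<Sum>A\<in>Pow I. gal A (z * r))"
      unfolding zS_def sum_distrib_right using z r by (intro sum.cong refl) (simp add: gal_mult mult_ac)
    have "zS S * r \<in> \<rat>"
    proof (rule rational_if_fixed)
      have zr: "z * r \<in> K" using z r by (simp add: mult_in_K)
      show "zS S * r \<in> K" unfolding c_eq by (rule sum_in_K) simp
      fix i assume i: "i \<in> I"
      have "gal {i} (zS S * r) = (\<Sum>A\<in>Pow I. gal {i} (gal A (z * r)))"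
        unfolding c_eq by (rule gal_sum) simp
      also have "\<dots> = (\<Sum>A\<in>Pow I. gal (A \<triangle> {i}) (z * r))"
      proof (intro sum.cong refl)
        fix A assume "A \<in> Pow I"
        then show "gal {i} (gal A (z * r)) = gal (A \<triangle> {i}) (z * r)"
          using gal_gal[OF zr, of "{i}" A] i by (simp add: Un_commute)
      qed
      also have "\<dots> = zS S * r"
        unfolding c_eq using i by (intro sum.reindex_bij_betw[OF bij_betw_sdiff]) simp
      finally show "gal {i} (zS S * r) = zS S * r" .
    qed
    moreover have "p_integral p ((zS S * r)\<^sup>2 / of_int p)"
      unfolding c_eq
    proof (rule p_integral_square_div_sum[OF p(1)])
      fix A
      have zK: "z\<^sup>2 / of_int p \<in> K" "z\<^sup>2 / of_int p * of_int a \<in> K"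
        by (intro mult_in_K divide_in_K power_in_K z(1) of_int_in_K)+
      have "(gal A (z * r))\<^sup>2 / of_int p = gal A ((z * r)\<^sup>2 / of_int p)"
        using z r by (simp add: gal_divide gal_power power_in_K mult_in_K)
      also have "(z * r)\<^sup>2 / of_int p = z\<^sup>2 / of_int p * of_int a" by (simp add: power_mult_distrib a)
      finally have eq: "(gal A (z * r))\<^sup>2 / of_int p = gal A (z\<^sup>2 / of_int p * of_int a)" .
      show "p_integral p ((gal A (z * r))\<^sup>2 / of_int p)"
        unfolding eq by (intro p_integral_gal[OF zK(2)] p_integral_mult[OF p(1) zp] p_integral_of_int[OF p(1)])
    qed
    ultimately have "p_integral p (zS S * r / of_int p)" by (rule p_integral_rational_square_div[OF p(1)])
    moreover have "p_integral p (r\<^sup>2)" unfolding a(2) by (rule p_integral_of_int[OF p(1)])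
    then have "p_integral p r" by (rule p_integral_power2_imp[OF p(1)])
    ultimately have "p_integral p (zS S * r / of_int p * r * (1 / of_int a))"
      using p_integral_mult[OF p(1) p_integral_mult[OF p(1)] p_integral_inverse_of_int[OF p(1) a(1)]] by blast
    also have "zS S * r / of_int p * r * (1 / of_int a) = zS S / of_int p * (r\<^sup>2 / of_int a)"
      unfolding power2_eq_square by simp
    also have "r\<^sup>2 / of_int a = 1" unfolding a(2) using a0 by simp
    finally show ?thesis by simp
  qed
  have eq: "2 ^ card I * z = (\<Sum>S\<in>Pow I. zS S)" unfolding zS_def by (rule sum_chi_gal[OF z(1), symmetric])
  have z_eq: "z / of_int p = (\<Sum>S\<in>Pow I. zS S / of_int p) * (1 / of_int (2 ^ card I))"
    unfolding sum_divide_distrib[symmetric] eq[symmetric] by simp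
  have "\<not> p dvd 2 ^ card I"
    using odd_prime_not_dvd_2[OF p] prime_dvd_power[OF p(1)] by blast
  moreover have "p_integral p (\<Sum>S\<in>Pow I. zS S / of_int p)"
    using zSp by (intro p_integral_sum[OF p(1)]) simp
  ultimately show ?thesis
    unfolding z_eq by (intro p_integral_mult[OF p(1)] p_integral_inverse_of_int[OF p(1)])
qed

text \<open>In the unramified fixed field \<open>y * y'\<close> is \<open>p\<close> up to a unit at
  \<open>p\<close>, so \<open>y\<close> has valuation 0 or 1 at each prime above \<open>p\<close>.
  Being a square up to a unit, it has valuation 0, and \<open>y'\<close> absorbs all of
  \<open>p\<close>. The computation applies \<open>unramified\<close> to \<open>z * y'\<close>,
  whose square is \<open>p q y' \<eta>\<close>.\<close>

lemma p_integral_cofactor: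
  assumes p: "prime p" "odd p" and q: "\<not> p dvd q" "y * y' = of_int (p * q)"
    and y': "y' \<in> K" "gal (ram p) y' = y'" "algebraic_int y'"
    and z: "z \<in> K" "gal (ram p) z = z" "z\<^sup>2 = y * \<eta>"
    and eta: "p_integral p \<eta>" "p_integral p (1 / \<eta>)" "\<eta> \<noteq> 0"
  shows "p_integral p (y' / of_int p)"
proof -
  have p0: "complex_of_int p \<noteq> 0" "complex_of_int q \<noteq> 0" using p q by auto
  have "(z * y')\<^sup>2 = (y * y') * (y' * \<eta>)"
    unfolding power_mult_distrib z(3) by (simp only: power2_eq_square mult_ac)
  also have "\<dots> = of_int p * (of_int q * y' * \<eta>)" unfolding q(2) by simp
  finally have sq: "(z * y')\<^sup>2 = of_int p * (of_int q * y' * \<eta>)" .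
  have py: "p_integral p y'" using y'(3) by (rule p_integral_algebraic_int[OF p(1)])
  have "p_integral p (of_int q * y' * \<eta>)"
    by (intro p_integral_mult[OF p(1)] p_integral_of_int[OF p(1)] py eta(1))
  moreover have "(z * y')\<^sup>2 / of_int p = of_int q * y' * \<eta>" unfolding sq using p0(1) by simp
  ultimately have "p_integral p ((z * y')\<^sup>2 / of_int p)" by (simp only:)
  then have "p_integral p (z * y' / of_int p)"
    by (rule unramified[OF p mult_in_K[OF z(1) y'(1)], rotated])
      (simp only: gal_mult[OF z(1) y'(1)] z(2) y'(2))
  then have "p_integral p ((z * y' / of_int p)\<^sup>2)" by (rule p_integral_power[OF p(1)])
  then have "p_integral p ((z * y' / of_int p)\<^sup>2 * (1 / of_int q * (1 / \<eta>)))"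
    by (intro p_integral_mult[OF p(1)] eta(2) p_integral_inverse_of_int[OF p(1) q(1)])
  moreover have "(z * y' / of_int p)\<^sup>2 * (1 / of_int q * (1 / \<eta>)) = y' / of_int p"
    unfolding power_divide sq using p0 eta(3) by (simp add: power2_eq_square)
  ultimately show ?thesis by simp
qed

lemma gal_mpower:
  assumes "A \<subseteq> K" "\<And>x. x \<in> A \<Longrightarrow> gal B x \<in> A"
  shows "mpower A n \<subseteq> K \<and> (\<forall>x\<in>mpower A n. gal B x \<in> mpower A n)"
proof (induction n)
  case 0
  then show ?case by (auto simp: Ok_def algebraic_int_gal)
next
  case (Suc n)
  have sub: "mprod A (mpower A n) \<subseteq> K"
    using assms(1) Suc by (intro mprod_subset) (auto intro: mult_in_K add_in_K)
  moreover have "gal B x \<in> mprod A (mpower A n)" if "x \<in> mprod A (mpower A n)" for x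
    using that
  proof induction
    case (prod a b)
    then have "a \<in> K" "b \<in> K" using assms(1) Suc by auto
    then show ?case using prod assms(2) Suc by (simp add: gal_mult mprod.prod)
  next
    case (sum x y)
    then have "x \<in> K" "y \<in> K" using sub by auto
    then show ?case using sum by (simp add: gal_add mprod.sum)
  qed
  ultimately show ?case by simp
qed

lemma p_integral_mpower:
  assumes p: "prime p" and A: "\<And>x. x \<in> A \<Longrightarrow> p_integral p (x\<^sup>2 / y)"
  shows "z \<in> mpower A n \<Longrightarrow> p_integral p (z\<^sup>2 / y ^ n)"
proof (induction n arbitrary: z)
  case 0
  then show ?case by (simp add: Ok_def algebraic_int_power p_integral_algebraic_int[OF p])
next
  case (Suc n)
  from Suc.prems have "z \<in> mprod A (mpower A n)" by simp
  then show ?case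
  proof induction
    case (prod a b)
    then show ?case using p_integral_mult[OF p A[of a] Suc.IH[of b]] by (simp add: power_mult_distrib)
  next
    case (sum x w)
    then show ?case by (intro p_integral_square_div_add[OF p])
  qed
qed

end

subsection \<open>The contradiction at a ramified prime\<close>

definition madd :: "complex set \<Rightarrow> complex set \<Rightarrow> complex set" where
  "madd A B = {a + b | a b. a \<in> A \<and> b \<in> B}"

lemma maddI: "a \<in> A \<Longrightarrow> b \<in> B \<Longrightarrow> a + b \<in> madd A B"
  unfolding madd_def by blast

lemma maddE:
  assumes "x \<in> madd A B" obtains a b where "x = a + b" "a \<in> A" "b \<in> B"
  using assms unfolding madd_def by blast

lemma mprod_madd_subset:
  assumes "mprod A D \<subseteq> E" "mprod B D \<subseteq> E" "\<And>x y. x \<in> E \<Longrightarrow> y \<in> E \<Longrightarrow> x + y \<in> E"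
  shows "mprod (madd A B) D \<subseteq> E"
proof (rule mprod_subset)
  fix x c assume xAB: "x \<in> madd A B" and c: "c \<in> D"
  obtain a b where x: "x = a + b" "a \<in> A" "b \<in> B" using xAB by (rule maddE)
  have "a * c \<in> E" "b * c \<in> E" using assms(1,2) mprod.prod x(2,3) c by blast+
  then show "x * c \<in> E" unfolding x(1) distrib_right by (rule assms(3))
qed (rule assms(3))

lemma scaleI: "x \<in> A \<Longrightarrow> c * x \<in> scale c A"
  unfolding scale_def by (rule imageI)

lemma scaleE:
  assumes "x \<in> scale c A" obtains a where "x = c * a" "a \<in> A"
  using assms unfolding scale_def by blast

context multiquadratic
begin

lemma submod_madd:
  assumes A: "submod A" and B: "submod B" shows "submod (madd A B)"
  unfolding submod_def
proof (intro conjI ballI)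
  show "madd A B \<subseteq> K"
    using submodD(1)[OF A] submodD(1)[OF B] by (auto elim!: maddE intro!: add_in_K)
  show "0 \<in> madd A B" using maddI[OF submodD(2)[OF A] submodD(2)[OF B]] by simp
  fix x assume "x \<in> madd A B"
  then obtain a b where x: "x = a + b" "a \<in> A" "b \<in> B" by (rule maddE)
  show "x + y \<in> madd A B" if yAB: "y \<in> madd A B" for y
  proof -
    obtain a' b' where y: "y = a' + b'" "a' \<in> A" "b' \<in> B" using yAB by (rule maddE)
    have "x + y = (a + a') + (b + b')" unfolding x y by simp
    then show ?thesis using maddI[OF submodD(3)[OF A x(2) y(2)] submodD(3)[OF B x(3) y(3)]] by simp
  qed
  show "r * x \<in> madd A B" if "r \<in> Ok" for r
    unfolding x distrib_left by (intro maddI submodD(4)[OF A that x(2)] submodD(4)[OF B that x(3)])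
qed

lemma scale_Ok_subset:
  assumes "submod M" "a \<in> M" shows "scale a Ok \<subseteq> M"
proof
  fix x assume "x \<in> scale a Ok"
  then obtain r where "x = a * r" "r \<in> Ok" by (rule scaleE)
  then show "x \<in> M" using submodD(4)[OF assms(1) _ assms(2), of r] by (simp add: mult.commute)
qed

lemma in_scale_Ok: "a \<in> scale a Ok"
  using scaleI[OF Ok_closed(1), of a] by simp

lemma of_int_in_Ok: "of_int k \<in> Ok" by (simp add: Ok_def)

lemma mprod_scale_Ok: "a \<noteq> 0 \<Longrightarrow> b \<noteq> 0 \<Longrightarrow> mprod (scale a Ok) (scale b Ok) = scale (a * b) Ok"
  by (simp add: mprod_scale_left mprod_scale_right mprod_Ok submod_Ok mult.commute)

lemma gal_Ok: "x \<in> Ok \<Longrightarrow> gal A x \<in> Ok"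
  by (simp add: Ok_def algebraic_int_gal)

end

lemma bezout_prime:
  fixes p n :: int
  assumes "prime p" "\<not> p dvd n" shows "\<exists>u v. n * u + p * v = 1"
proof -
  have "gcd n p = 1" using prime_imp_coprime[OF assms] by (simp add: coprime_iff_gcd_eq_1 gcd.commute)
  then show ?thesis using bezout_int[of n p] by (metis mult.commute)
qed

context norm_minus_one
begin

text \<open>
  Let \<open>x\<^sup>2 = a + p q\<close> with \<open>p\<close> prime to \<open>q\<close>. The ideal \<open>(p, t, y)\<close> with \<open>y = x - r\<close> is the square root of
  one of the two conjugate primes into which \<open>p\<close> splits in \<open>\<rat>(r)\<close>. It is fixed by \<open>\<sigma> = gal (ram p)\<close>, and
  an odd power of it has a generator \<open>c\<close>, since the class number is odd. By the Hilbert 90 statement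
  for units, \<open>c\<close> or \<open>c t\<close> can be moved by a unit into the fixed field of \<open>\<sigma>\<close>, where \<open>p\<close> is unramified.
\<close>

lemma no_ramified_split_prime:
  assumes odd: "odd (class_number K)" and p: "prime p" "odd p"
    and t: "t \<in> K" "t\<^sup>2 = of_int (p * D)" "\<not> p dvd D" "gal (ram p) t = - t"
    and r: "r \<in> K" "r\<^sup>2 = of_int a" "gal (ram p) r = r" "gal B r = - r"
    and x: "x * x = a + p * q" "\<not> p dvd q" "\<not> p dvd x"
  shows False
proof -
  let ?p = "complex_of_int p" and ?\<sigma> = "gal (ram p)"
  \<comment> \<open>The product of these two is \<open>x^2 - a = p q\<close>, in which
    \<open>p\<close> occurs exactly once; \<open>gal B\<close> exchanges them.\<close>
  define y y' where "y = of_int x - r" and "y' = of_int x + r"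
  have nz: "?p \<noteq> 0" "complex_of_int q \<noteq> 0" "complex_of_int D \<noteq> 0" using p x(2) t(3) by auto
  have "y * y' = of_int x * of_int x - r\<^sup>2" by (simp add: y_def y'_def algebra_simps power2_eq_square)
  also have "\<dots> = of_int (x * x - a)" unfolding r(2) by simp
  also have "\<dots> = of_int (p * q)" unfolding x(1) by simp
  finally have yy: "y * y' = of_int (p * q)" .
  then have "y * y' \<noteq> 0" using nz by simp
  then have y0: "y \<noteq> 0" "y' \<noteq> 0" by auto
  have "t\<^sup>2 \<noteq> 0" unfolding t(2) using nz by simp
  then have t0: "t \<noteq> 0" by auto
  have algt: "algebraic_int t" and algr: "algebraic_int r"
    by (rule algebraic_int_power_imp, simp only: t(2) r(2) algebraic_int_of_int)+
  have tO: "t \<in> Ok" and rO: "r \<in> Ok" using t(1) r(1) algt algr by (simp_all add: Ok_def)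
  have yK: "y \<in> K" "y' \<in> K" unfolding y_def y'_def using r(1) by (auto intro: diff_in_K add_in_K)
  have yO: "y \<in> Ok" "y' \<in> Ok"
    unfolding y_def y'_def using Ok_closed(3)[OF of_int_in_Ok] Ok_closed(5)[OF rO] rO by (auto simp: diff_conv_add_uminus simp del: add_uminus_conv_diff)
  have algy: "algebraic_int y" "algebraic_int y'" using yO by (auto simp: Ok_def)
  have sy: "?\<sigma> y = y" "?\<sigma> y' = y'"
    unfolding y_def y'_def using r(1) by (simp_all add: gal_diff gal_add r(3))
  have By: "gal B y = y'" "gal B y' = y"
    unfolding y_def y'_def using r(1) by (simp_all add: gal_diff gal_add r(4))
  define P where "P = madd (madd (scale ?p Ok) (scale t Ok)) (scale y Ok)"
  \<comment> \<open>If \<open>P'\<close> is the image of \<open>P\<close> under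
    \<open>gal B\<close>, then \<open>p\<close> generates the square of \<open>P P'\<close>. The
    complement \<open>Q\<close> is \<open>P P'^2\<close> in generators, chosen to make
    \<open>mprod P Q\<close> principal.\<close>
  define Q where "Q = madd (scale ?p Ok) (scale (t * y') Ok)"
  have ty: "t * y' \<in> Ok" "t * y' \<in> K" "t * y' \<noteq> 0"
    using Ok_closed(4)[OF tO yO(2)] mult_in_K[OF t(1) yK(2)] t0 y0 by simp_all
  have subO: "scale c Ok \<subseteq> Ok" if "c \<in> Ok" for c using scale_Ok_subset[OF submod_Ok that] .
  have subs: "submod (scale c Ok)" if "c \<in> K" for c using submod_scale[OF submod_Ok that] .
  have P: "submod P" and Q: "submod Q"
    unfolding P_def Q_def by (intro submod_madd subs of_int_in_K t(1) yK ty)+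
  have maddO: "madd A B \<subseteq> Ok" if "A \<subseteq> Ok" "B \<subseteq> Ok" for A B
    using that Ok_closed(3) by (auto elim!: maddE)
  have PO: "P \<subseteq> Ok" and QO: "Q \<subseteq> Ok"
    unfolding P_def Q_def by (intro maddO subO of_int_in_Ok tO yO ty)+
  have zero: "0 \<in> scale c Ok" for c using scaleI[OF Ok_closed(2), of c] by simp
  have inP: "?p \<in> P" "t \<in> P" "y \<in> P"
  proof -
    have "?p + 0 + 0 \<in> P" "0 + t + 0 \<in> P" "0 + 0 + y \<in> P"
      unfolding P_def by (intro maddI zero in_scale_Ok)+
    then show "?p \<in> P" "t \<in> P" "y \<in> P" by simp_all
  qed
  have inQ: "?p \<in> Q" "t * y' \<in> Q"
  proof -
    have "?p + 0 \<in> Q" "0 + t * y' \<in> Q" unfolding Q_def by (intro maddI zero in_scale_Ok)+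
    then show "?p \<in> Q" "t * y' \<in> Q" by simp_all
  qed
  have subp: "submod (scale ?p Ok)" by (rule subs) simp
  have multp: "scale (c * e) Ok \<subseteq> scale ?p Ok" if "c * e = ?p * f" "f \<in> Ok" for c e f
    unfolding that(1) by (rule scale_Ok_subset[OF subp scaleI[OF that(2)]])
  have prod_sub: "mprod (scale c Ok) (scale e Ok) \<subseteq> scale ?p Ok"
    if "c * e = ?p * f" "f \<in> Ok" "c \<noteq> 0" "e \<noteq> 0" for c e f
    unfolding mprod_scale_Ok[OF that(3,4)] by (rule multp[OF that(1,2)])
  have tt: "t * t = ?p * of_int D" using t(2) by (simp add: power2_eq_square)
  have "mprod P Q \<subseteq> scale ?p Ok"
  proof -
    have add: "\<And>x y. x \<in> scale ?p Ok \<Longrightarrow> y \<in> scale ?p Ok \<Longrightarrow> x + y \<in> scale ?p Ok" by (rule submodD(3)[OF subp])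
    have row: "mprod (scale c Ok) Q \<subseteq> scale ?p Ok"
      if "c \<in> Ok" "c \<noteq> 0" "c * (t * y') = ?p * f" "f \<in> Ok" for c f
    proof -
      have "(t * y') * c = ?p * f" using that(3) by (subst mult.commute)
      then have "mprod (scale (t * y') Ok) (scale c Ok) \<subseteq> scale ?p Ok"
        by (rule prod_sub[OF _ that(4) ty(3) that(2)])
      moreover have "mprod (scale ?p Ok) (scale c Ok) \<subseteq> scale ?p Ok"
        by (rule prod_sub[OF refl that(1) nz(1) that(2)])
      ultimately show ?thesis
        unfolding mprod_commute[of "scale c Ok" Q] unfolding Q_def by (intro mprod_madd_subset add)
    qed
    show ?thesis unfolding P_def
    proof (intro mprod_madd_subset add)
      show "mprod (scale ?p Ok) Q \<subseteq> scale ?p Ok" by (rule row[OF of_int_in_Ok nz(1) refl ty(1)])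
      have "t * (t * y') = ?p * (of_int D * y')" unfolding mult.assoc[symmetric] tt ..
      then show "mprod (scale t Ok) Q \<subseteq> scale ?p Ok"
        by (rule row[OF tO t0]) (intro Ok_closed(4) of_int_in_Ok yO)
      have "y * (t * y') = t * (y * y')" by (rule mult.left_commute)
      also have "\<dots> = ?p * (of_int q * t)" unfolding yy by simp
      finally show "mprod (scale y Ok) Q \<subseteq> scale ?p Ok"
        by (rule row[OF yO(1) y0(1)]) (intro Ok_closed(4) of_int_in_Ok tO)
    qed
  qed
  moreover have "scale ?p Ok \<subseteq> mprod P Q"
  proof (rule scale_Ok_subset)
    show M: "submod (mprod P Q)" by (rule submod_mprod[OF P Q])
    \<comment> \<open>The element \<open>p\<close> is assembled from \<open>p^2\<close>,
      \<open>p y\<close> and \<open>t^2 y' = p D y'\<close>: Bezout for \<open>D\<close> and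
      \<open>p\<close> yields \<open>p y'\<close>, then \<open>p (y + y') = 2 x p\<close>, and
      Bezout for \<open>2 x\<close> and \<open>p\<close> yields \<open>p\<close>.\<close>
    obtain u v where uv: "D * u + p * v = 1" using bezout_prime[OF p(1) t(3)] by blast
    have "\<not> p dvd 2 * x" using odd_prime_not_dvd_2[OF p] x(3) p(1) by (simp add: prime_dvd_mult_iff)
    then obtain w k where wk: "2 * x * w + p * k = 1" using bezout_prime[OF p(1)] by blast
    have e: "?p * ?p \<in> mprod P Q" "y * ?p \<in> mprod P Q" "t * (t * y') \<in> mprod P Q"
      by (intro mprod.prod inP inQ)+
    have "of_int u * (t * (t * y')) + of_int v * y' * (?p * ?p) \<in> mprod P Q"
      by (intro submodD(3)[OF M] submodD(4)[OF M _ e(1)] submodD(4)[OF M _ e(3)] Ok_closed(4) of_int_in_Ok yO)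
    also have "of_int u * (t * (t * y')) + of_int v * y' * (?p * ?p) = ?p * y' * of_int (D * u + p * v)"
      unfolding mult.assoc[symmetric, of t t] tt by (simp add: algebra_simps)
    finally have "y * ?p + ?p * y' \<in> mprod P Q" unfolding uv using submodD(3)[OF M e(2)] by simp
    also have "y * ?p + ?p * y' = of_int (2 * x) * ?p" by (simp add: y_def y'_def algebra_simps)
    finally have e4: "of_int (2 * x) * ?p \<in> mprod P Q" .
    have "of_int w * (of_int (2 * x) * ?p) + of_int k * (?p * ?p) \<in> mprod P Q"
      by (intro submodD(3)[OF M] submodD(4)[OF M _ e(1)] submodD(4)[OF M _ e4] of_int_in_Ok)
    also have "of_int w * (of_int (2 * x) * ?p) + of_int k * (?p * ?p) = ?p * of_int (2 * x * w + p * k)"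
      by (simp add: algebra_simps)
    finally show "?p \<in> mprod P Q" unfolding wk by simp
  qed
  ultimately have PQ: "mprod P Q = scale ?p Ok" by blast
  obtain h c where h: "odd h" and c: "c \<in> K" "c \<noteq> 0" "mpower P h = scale c Ok" "mpower Q h = scale (?p ^ h / c) Ok"
    using odd_power_principal[OF odd P PO Q QO PQ of_int_in_K nz(1)] by blast
  have galP: "?\<sigma> z \<in> P" if zP: "z \<in> P" for z
  proof -
    obtain b1 g where 1: "z = b1 + g" "b1 \<in> madd (scale ?p Ok) (scale t Ok)" "g \<in> scale y Ok"
      using zP unfolding P_def by (rule maddE)
    obtain b2 g2 where 2: "b1 = b2 + g2" "b2 \<in> scale ?p Ok" "g2 \<in> scale t Ok" using 1(2) by (rule maddE)
    obtain \<alpha> where \<alpha>: "b2 = ?p * \<alpha>" "\<alpha> \<in> Ok" using 2(2) by (rule scaleE)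
    obtain \<beta> where \<beta>: "g2 = t * \<beta>" "\<beta> \<in> Ok" using 2(3) by (rule scaleE)
    obtain \<gamma> where \<gamma>: "g = y * \<gamma>" "\<gamma> \<in> Ok" using 1(3) by (rule scaleE)
    have abc: "\<alpha> \<in> K" "\<beta> \<in> K" "\<gamma> \<in> K" using \<alpha> \<beta> \<gamma> by (auto simp: Ok_def)
    have "?\<sigma> z = ?p * ?\<sigma> \<alpha> + t * (- ?\<sigma> \<beta>) + y * ?\<sigma> \<gamma>"
      unfolding 1(1) 2(1) \<alpha>(1) \<beta>(1) \<gamma>(1) using abc t(1) yK
      by (simp add: gal_add gal_mult mult_in_K add_in_K t(4) sy)
    then show ?thesis unfolding P_def
      by (simp only:) (intro maddI scaleI gal_Ok Ok_closed(5) \<alpha>(2) \<beta>(2) \<gamma>(2))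
  qed
  have cP: "c \<in> mpower P h" "?p ^ h / c \<in> mpower Q h" unfolding c(3,4) by (rule in_scale_Ok)+
  have "?\<sigma> c \<in> mpower P h" using gal_mpower[OF submodD(1)[OF P] galP, of h] cP(1) by blast
  then obtain o' where o: "?\<sigma> c = c * o'" "o' \<in> Ok" unfolding c(3) by (rule scaleE)
  have oK: "o' \<in> K" "algebraic_int o'" using o(2) by (auto simp: Ok_def)
  have "c = ?\<sigma> (?\<sigma> c)" using c(1) ram_subset by simp
  also have "\<dots> = c * (o' * ?\<sigma> o')" unfolding o(1) using c(1) oK by (simp add: gal_mult o(1))
  finally have oo: "o' * ?\<sigma> o' = 1" using c(2) by simp
  then have "inverse o' = ?\<sigma> o'" by (rule inverse_unique)
  then have "o' \<in> units" using oo oK algebraic_int_gal[OF oK, of "ram p"] by (auto simp: units_def)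
  moreover have "ram p \<noteq> {}"
  proof
    assume "ram p = {}"
    then have "t = - t" using t(1,4) by simp
    then show False using t0 by simp
  qed
  ultimately obtain w where w: "w \<in> units" "o' = ?\<sigma> w / w \<or> o' = - (?\<sigma> w / w)"
    using unit_hilbert_90[OF ram_subset _ _ oo] by blast
  have wK: "w \<in> K" "w \<noteq> 0" "algebraic_int w" "algebraic_int (inverse w)" using unitsD[OF w(1)] by auto
  have sw0: "?\<sigma> w \<noteq> 0" using wK ram_subset by (simp add: gal_eq_0_iff)
  \<comment> \<open>Dividing by the unit \<open>w\<close> makes the generator invariant up to
    sign.\<close>
  define b where "b = c / w"
  have bK: "b \<in> K" using c(1) wK by (simp add: b_def divide_in_K)
  have "?\<sigma> b = c * o' / ?\<sigma> w" unfolding b_def using c(1) wK by (simp add: gal_divide o(1))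
  then have sb: "?\<sigma> b = b \<or> ?\<sigma> b = - b" using w(2) wK(2) sw0 by (auto simp: b_def)
  \<comment> \<open>Locally at \<open>p\<close>, the square of \<open>P\<close> is generated by
    \<open>y\<close> and that of \<open>Q\<close> by \<open>?p\<^sup>2 / y\<close>. The bound from
    \<open>P\<close> makes \<open>\<eta>0\<close> integral at \<open>p\<close>, and the bound from
    \<open>Q\<close> does the same for its inverse.\<close>
  define \<eta>0 where "\<eta>0 = c\<^sup>2 / y ^ h"
  have intO: "p_integral p z" if "z \<in> Ok" for z
    using that by (intro p_integral_algebraic_int[OF p(1)]) (simp add: Ok_def)
  have qi: "p_integral p (1 / complex_of_int q)" by (rule p_integral_inverse_of_int[OF p(1) x(2)])
  have scale_sq: "p_integral p (z\<^sup>2 / e)" if zg: "z \<in> scale g Ok" and ge: "p_integral p (g\<^sup>2 / e)" for z g e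
  proof -
    obtain a where a: "z = g * a" "a \<in> Ok" using zg by (rule scaleE)
    have "p_integral p (g\<^sup>2 / e * a\<^sup>2)"
      using p_integral_mult[OF p(1) ge p_integral_power[OF p(1) intO[OF a(2)]]] .
    then show ?thesis unfolding a(1) by (simp add: power_mult_distrib)
  qed
  have py: "?p / y = y' * (1 / of_int q)" using yy y0 nz by (simp add: field_simps)
  have p1: "p_integral p (?p\<^sup>2 / y)"
  proof -
    have "?p\<^sup>2 / y = ?p * (?p / y)" by (simp add: power2_eq_square)
    then show ?thesis unfolding py by (simp only:) (intro p_integral_mult[OF p(1)] qi intO of_int_in_Ok yO)
  qed
  have p2: "p_integral p (t\<^sup>2 / y)"
  proof -
    have "t\<^sup>2 / y = of_int D * (?p / y)" unfolding t(2) by simp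
    then show ?thesis unfolding py by (simp only:) (intro p_integral_mult[OF p(1)] qi intO of_int_in_Ok yO)
  qed
  have p3: "p_integral p (y\<^sup>2 / y)" using intO[OF yO(1)] y0 by (simp add: power2_eq_square)
  have madd_sq: "p_integral p (z\<^sup>2 / e)"
    if z: "z \<in> madd A B" and "\<And>a. a \<in> A \<Longrightarrow> p_integral p (a\<^sup>2 / e)" "\<And>b. b \<in> B \<Longrightarrow> p_integral p (b\<^sup>2 / e)"
    for z A B e
  proof -
    obtain a b where ab: "z = a + b" "a \<in> A" "b \<in> B" using z by (rule maddE)
    show ?thesis unfolding ab(1) using ab(2,3) that(2,3) by (intro p_integral_square_div_add[OF p(1)])
  qed
  have valP: "p_integral p (z\<^sup>2 / y)" if "z \<in> P" for z
    using that unfolding P_def by (rule madd_sq) (rule madd_sq, assumption, rule scale_sq, assumption, rule p1,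
      rule scale_sq, assumption, rule p2, rule scale_sq, assumption, rule p3)
  have q1: "p_integral p (?p\<^sup>2 / (?p\<^sup>2 / y))" using intO[OF yO(1)] nz by simp
  have q2: "p_integral p ((t * y')\<^sup>2 / (?p\<^sup>2 / y))"
  proof -
    have "(t * y')\<^sup>2 / (?p\<^sup>2 / y) = (t * t) * y' * (y * y') / ?p\<^sup>2"
      by (simp add: power2_eq_square mult_ac)
    also have "\<dots> = of_int D * y' * of_int q"
      unfolding tt yy using nz by (simp add: power2_eq_square)
    finally show ?thesis by (simp only:) (intro p_integral_mult[OF p(1)] intO of_int_in_Ok yO)
  qed
  have valQ: "p_integral p (z\<^sup>2 / (?p\<^sup>2 / y))" if "z \<in> Q" for z
    using that unfolding Q_def by (rule madd_sq) (rule scale_sq, assumption, rule q1, rule scale_sq, assumption, rule q2)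
  have eta1: "p_integral p \<eta>0" unfolding \<eta>0_def by (rule p_integral_mpower[OF p(1) valP cP(1)])
  have "p_integral p ((?p ^ h / c)\<^sup>2 / (?p\<^sup>2 / y) ^ h)" by (rule p_integral_mpower[OF p(1) valQ cP(2)])
  moreover have "(?p ^ h / c)\<^sup>2 / (?p\<^sup>2 / y) ^ h = 1 / \<eta>0"
    using nz(1) by (simp add: \<eta>0_def power_divide flip: power_mult) (simp add: mult.commute)
  ultimately have eta2: "p_integral p (1 / \<eta>0)" by simp
  have eta0: "\<eta>0 \<noteq> 0" using c(2) y0(1) by (simp add: \<eta>0_def)
  have wi: "p_integral p (w\<^sup>2)" "p_integral p ((inverse w)\<^sup>2)"
    using p_integral_power[OF p(1) p_integral_algebraic_int[OF p(1) wK(3)]]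
      p_integral_power[OF p(1) p_integral_algebraic_int[OF p(1) wK(4)]] by blast+
  \<comment> \<open>Since \<open>h\<close> is odd, \<open>y ^ h\<close> is \<open>y\<close> times a
    square; here the odd class number takes effect.\<close>
  obtain l where l: "h = 2 * l + 1" using h by (auto elim: oddE)
  have c2: "c\<^sup>2 = \<eta>0 * (y * (y ^ l)\<^sup>2)"
    using y0(1) by (simp add: \<eta>0_def l power_mult mult.commute[of 2 l])
  have "p_integral p (y' / ?p) \<or> p_integral p (y / ?p)"
  proof (cases "?\<sigma> b = b")
    case True
    let ?z = "b / y ^ l"
    have "p_integral p (y' / ?p)"
    proof (rule p_integral_cofactor[OF p x(2) yy yK(2) sy(2) algy(2), where z = ?z and \<eta> = "\<eta>0 * (inverse w)\<^sup>2"])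
      show "?z \<in> K" using bK yK by (intro divide_in_K power_in_K)
      show "?\<sigma> ?z = ?z" using bK yK by (simp add: gal_divide gal_power power_in_K True sy)
      have "?z\<^sup>2 = c\<^sup>2 / (w\<^sup>2 * (y ^ l)\<^sup>2)" by (simp add: b_def power_divide power_mult_distrib)
      also have "\<dots> = y * (\<eta>0 * (inverse w)\<^sup>2)"
        unfolding c2 inverse_eq_divide using y0(1) by (simp add: power_divide)
      finally show "?z\<^sup>2 = y * (\<eta>0 * (inverse w)\<^sup>2)" .
      show "p_integral p (\<eta>0 * (inverse w)\<^sup>2)" by (rule p_integral_mult[OF p(1) eta1 wi(2)])
      have "1 / (\<eta>0 * (inverse w)\<^sup>2) = (1 / \<eta>0) * w\<^sup>2" by (simp add: divide_inverse power_inverse)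
      then show "p_integral p (1 / (\<eta>0 * (inverse w)\<^sup>2))"
        using p_integral_mult[OF p(1) eta2 wi(1)] by (simp only:)
      show "\<eta>0 * (inverse w)\<^sup>2 \<noteq> 0" using eta0 wK(2) by simp
    qed
    then show ?thesis ..
  next
    case False
    then have sb': "?\<sigma> b = - b" using sb by blast
    \<comment> \<open>Multiplying by \<open>t\<close> restores invariance and contributes
      \<open>t^2 = p D\<close>. Since \<open>p / y = y' / q\<close>, the square of \<open>?z\<close>
      is now \<open>y'\<close> up to a unit at \<open>p\<close>, and \<open>y\<close> and
      \<open>y'\<close> exchange roles.\<close>
    let ?z = "b * t / y ^ Suc l" and ?\<eta> = "\<eta>0 * (inverse w)\<^sup>2 * (of_int D * (1 / of_int q))"
    have yy': "y' * y = of_int (p * q)" using yy by (simp only: mult.commute)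
    have "p_integral p (y / ?p)"
    proof (rule p_integral_cofactor[OF p x(2) yy' yK(1) sy(1) algy(1), where z = ?z and \<eta> = ?\<eta>])
      show "?z \<in> K" using bK t(1) yK by (intro divide_in_K power_in_K mult_in_K)
      show "?\<sigma> ?z = ?z"
        using bK t(1) yK by (simp add: gal_divide gal_mult gal_power power_in_K mult_in_K sb' t(4) sy del: power_Suc)
      have "?z\<^sup>2 = c\<^sup>2 * t\<^sup>2 / (w\<^sup>2 * (y * y ^ l)\<^sup>2)" by (simp add: b_def power_divide power_mult_distrib)
      also have "\<dots> = \<eta>0 * (inverse w)\<^sup>2 * (of_int D * (?p / y))"
        unfolding c2 t(2) inverse_eq_divide using y0(1)
        by (simp add: power_divide power_mult_distrib power2_eq_square[of y])
      also have "\<dots> = y' * ?\<eta>" unfolding py by simp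
      finally show "?z\<^sup>2 = y' * ?\<eta>" .
      show "p_integral p ?\<eta>"
        by (intro p_integral_mult[OF p(1)] eta1 wi(2) qi p_integral_of_int[OF p(1)])
      have "1 / ?\<eta> = (1 / \<eta>0) * w\<^sup>2 * (of_int q * (1 / of_int D))" by (simp add: divide_inverse power_inverse)
      moreover have "p_integral p ((1 / \<eta>0) * w\<^sup>2 * (of_int q * (1 / of_int D)))"
        by (intro p_integral_mult[OF p(1)] eta2 wi(1) p_integral_of_int[OF p(1)] p_integral_inverse_of_int[OF p(1) t(3)])
      ultimately show "p_integral p (1 / ?\<eta>)" by (simp only:)
      show "?\<eta> \<noteq> 0" using eta0 wK(2) nz by simp
    qed
    then show ?thesis ..
  qed
  \<comment> \<open>Conjugation by \<open>gal B\<close> turns either alternative into the other, so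
    both quotients by \<open>p\<close> are integral at \<open>p\<close>; yet their sum is
    \<open>2 x / p\<close>.\<close>
  moreover have "gal B (y / ?p) = y' / ?p" "gal B (y' / ?p) = y / ?p"
    using yK by (simp_all add: gal_divide By)
  moreover have "y / ?p \<in> K" "y' / ?p \<in> K" using yK by (auto intro: divide_in_K)
  ultimately have both: "p_integral p (y / ?p)" "p_integral p (y' / ?p)"
    using p_integral_gal[of "y / ?p" p B] p_integral_gal[of "y' / ?p" p B] by auto
  have "\<not> p dvd 2 * x" using odd_prime_not_dvd_2[OF p] x(3) p(1) by (simp add: prime_dvd_mult_iff)
  then obtain w k where wk: "2 * x * w + p * k = 1" using bezout_prime[OF p(1)] by blast
  have "p_integral p (of_int w * (y / ?p + y' / ?p) + of_int k)"
    by (intro p_integral_add[OF p(1)] p_integral_mult[OF p(1)] p_integral_of_int[OF p(1)] both)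
  also have "of_int w * (y / ?p + y' / ?p) + of_int k = (of_int w * (y + y') + of_int k * ?p) / ?p"
    using nz(1) by (simp add: add_divide_distrib distrib_left)
  also have "y + y' = of_int (2 * x)" by (simp add: y_def y'_def)
  also have "of_int w * of_int (2 * x) + of_int k * ?p = of_int (2 * x * w + p * k)"
    by (simp only: of_int_mult of_int_add mult.commute)
  finally show False unfolding wk using not_p_integral_inverse[OF p(1), where ?'a = complex] by simp
qed

end

subsection \<open>Choice of the prime\<close>

lemma square_or_twice_square:
  fixes n :: int
  assumes "n > 0" "\<And>p. prime p \<Longrightarrow> odd p \<Longrightarrow> even (multiplicity p n)"
  shows "\<exists>k. n = k\<^sup>2 \<or> n = 2 * k\<^sup>2"
proof -
  have two: "prime (2 :: int)" by simp
  have sq: "\<exists>k. m = k\<^sup>2" if m: "m > 0" "\<And>p. prime p \<Longrightarrow> even (multiplicity p m)" for m :: int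
  proof -
    have "is_nth_power 2 (normalize m)"
      using m(2) by (subst is_nth_power_conv_multiplicity) auto
    then show ?thesis using m(1) by (auto simp: is_nth_power_def)
  qed
  have is2: "p = 2" if "prime p" "even p" for p :: int
    using that primes_dvd_imp_eq[OF two that(1)] by simp
  show ?thesis
  proof (cases "even (multiplicity 2 n)")
    case True
    have "even (multiplicity p n)" if "prime p" for p
      using True assms(2)[OF that] is2[OF that] by blast
    then show ?thesis using sq[OF assms(1)] by blast
  next
    case False
    have "2 dvd n"
    proof (rule ccontr)
      assume "\<not> 2 dvd n"
      then have "multiplicity 2 n = 0" by (rule not_dvd_imp_multiplicity_0)
      then show False using False by simp
    qed
    then obtain m where m: "n = 2 * m" by blast
    have m0: "m > 0" using assms(1) m by simp
    have mult: "multiplicity p n = multiplicity p 2 + multiplicity p m" if "prime p" for p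
      unfolding m using that m0 by (intro prime_elem_multiplicity_mult_distrib) auto
    have "even (multiplicity p m)" if p: "prime p" for p
    proof (cases "p = 2")
      case True
      have "multiplicity (2::int) 2 = 1" by simp
      then show ?thesis using mult[OF two] False True by simp
    next
      case pne: False
      then have "odd p" using is2[OF p] by blast
      moreover have "multiplicity p 2 = 0"
        using primes_dvd_imp_eq[OF p two] pne by (intro not_dvd_imp_multiplicity_0) blast
      ultimately show ?thesis using mult[OF p] assms(2)[OF p] by simp
    qed
    then show ?thesis using sq[OF m0] m by blast
  qed
qed

lemma QuadRes_product_of_nonresidues:
  fixes p :: nat and a b :: int
  assumes p: "prime p" "2 < p" and ab: "\<not> int p dvd a" "\<not> int p dvd b"
    and n: "\<not> QuadRes (int p) a" "\<not> QuadRes (int p) b"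
  shows "QuadRes (int p) (a * b)"
proof (rule ccontr)
  assume nab: "\<not> QuadRes (int p) (a * b)"
  have "\<not> int p dvd a * b" using ab p(1) by (simp add: prime_dvd_mult_iff)
  then have L: "Legendre a (int p) = - 1" "Legendre b (int p) = - 1" "Legendre (a * b) (int p) = - 1"
    using ab n nab by (simp_all add: Legendre_def cong_0_iff)
  let ?e = "(p - 1) div 2"
  have "[Legendre a (int p) * Legendre b (int p) = a ^ ?e * b ^ ?e] (mod int p)"
    by (intro cong_mult euler_criterion p)
  then have "[1 = (a * b) ^ ?e] (mod int p)" by (simp add: L power_mult_distrib)
  moreover have "[Legendre (a * b) (int p) = (a * b) ^ ?e] (mod int p)" by (rule euler_criterion[OF p])
  ultimately have "[1 = - 1] (mod int p)" unfolding L using cong_sym cong_trans by blast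
  then have "int p dvd 2" by (simp add: cong_iff_dvd_diff)
  then have "int p \<le> 2" by (intro zdvd_imp_le) auto
  then show False using p(2) by simp
qed

text \<open>Passing from \<open>x\<close> to \<open>x + p\<close> changes the quotient
  \<open>q\<close> by \<open>2 x + p\<close>, which is prime to \<open>p\<close>. So for one of the
  two choices \<open>p\<close> divides the difference from \<open>a\<close> exactly once.\<close>

lemma exact_square_root_mod:
  fixes p a :: int
  assumes p: "prime p" "odd p" and a: "\<not> p dvd a" "QuadRes p a"
  shows "\<exists>x q. x * x = a + p * q \<and> \<not> p dvd q \<and> \<not> p dvd x"
proof -
  obtain x where "[x\<^sup>2 = a] (mod p)" using a(2) by (auto simp: QuadRes_def)
  then have "p dvd x\<^sup>2 - a" by (simp add: cong_iff_dvd_diff)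
  then obtain q where q: "x\<^sup>2 - a = p * q" by (rule dvdE)
  have px: "\<not> p dvd x"
  proof
    assume "p dvd x"
    then have "p dvd x\<^sup>2 - p * q" by (simp add: power2_eq_square)
    then show False using a(1) q by (simp add: algebra_simps)
  qed
  show ?thesis
  proof (cases "p dvd q")
    case False
    have "x * x = a + p * q" using q by (simp add: power2_eq_square)
    then show ?thesis using False px by blast
  next
    case True
    let ?q = "q + 2 * x + p"
    have "(x + p) * (x + p) = x\<^sup>2 + p * (2 * x + p)" by (simp add: power2_eq_square algebra_simps)
    also have "x\<^sup>2 = a + p * q" using q by simp
    finally have "(x + p) * (x + p) = a + p * ?q" by (simp add: algebra_simps)
    moreover have "\<not> p dvd 2 * x"
      using odd_prime_not_dvd_2[OF p] px p(1) by (simp add: prime_dvd_mult_iff)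
    then have "\<not> p dvd ?q" using True by (simp add: dvd_add_right_iff add.assoc dvd_add_left_iff)
    moreover have "\<not> p dvd x + p" using px by simp
    ultimately show ?thesis by blast
  qed
qed

section \<open>A ramified prime and a quadratic subfield in which it splits\<close>

context real_multiquadratic
begin

lemma zero_if_rational_square:
  assumes z: "z \<in> K" "z\<^sup>2 = of_int (k\<^sup>2)" "gal A z = - z"
  shows "z = 0"
proof -
  have "z\<^sup>2 = (of_int k)\<^sup>2" using z(2) by simp
  then have "z = of_int k \<or> z = - of_int k" by (simp only: power2_eq_iff)
  then have "z = of_int k \<or> z = of_int (- k)" by simp
  then have "gal A z = z" by (elim disjE) (simp_all only: gal_of_int)
  then show ?thesis using z(3) by simp
qed

text \<open>Otherwise every \<open>d l\<close>, being positive and not a square, is twice a square,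
  and then \<open>s i * s j\<close> is rational. Total reality enters by excluding radicands such as
  \<open>- 1\<close> and \<open>- 2\<close>.\<close>

lemma ex_odd_ramified_prime:
  assumes "i \<in> I" "j \<in> I" "i \<noteq> j"
  shows "\<exists>p. prime p \<and> odd p \<and> ram p \<noteq> {}"
proof (rule ccontr)
  assume "\<not> ?thesis"
  then have none: "ram p = {}" if "prime p" "odd p" for p using that by blast
  have sq: "\<exists>k. d l = 2 * k\<^sup>2" if l: "l \<in> I" for l
  proof -
    have "even (multiplicity p (d l))" if "prime p" "odd p" for p
      using none[OF that] l by (auto simp: ram_def)
    then obtain k where "d l = k\<^sup>2 \<or> d l = 2 * k\<^sup>2"
      using square_or_twice_square[OF d_pos[OF l]] by blast
    moreover have "d l \<noteq> k\<^sup>2"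
    proof
      assume "d l = k\<^sup>2"
      then have "(s l)\<^sup>2 = of_int (k\<^sup>2)" using s_square[OF l] by simp
      moreover have "gal {l} (s l) = - s l" using gal_s[OF l, of "{l}"] by simp
      ultimately show False using zero_if_rational_square[OF s_in_K[OF l]] s_nonzero[OF l] by blast
    qed
    ultimately show ?thesis by blast
  qed
  obtain k where k: "d i = 2 * k\<^sup>2" using sq[OF assms(1)] by blast
  obtain l where l: "d j = 2 * l\<^sup>2" using sq[OF assms(2)] by blast
  let ?z = "s i * s j"
  have "?z\<^sup>2 = of_int (d i * d j)" using assms s_square by (simp add: power_mult_distrib)
  also have "d i * d j = (2 * k * l)\<^sup>2" unfolding k l by (simp add: power2_eq_square)
  finally have "?z\<^sup>2 = of_int ((2 * k * l)\<^sup>2)" .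
  moreover have "gal {i} ?z = - ?z" using assms by (simp add: gal_mult s_in_K gal_s)
  moreover have "?z \<in> K" using assms by (simp add: mult_in_K s_in_K)
  ultimately have "?z = 0" using zero_if_rational_square by blast
  then show False using assms s_nonzero by simp
qed

text \<open>If \<open>s j\<close> itself is ramified at \<open>p\<close>, the factor
  \<open>s i0\<close> makes the valuation of the radicand even. The sign change at \<open>j\<close>,
  together with the last clause, keeps the roots for different \<open>j\<close> independent.\<close>

lemma ex_unramified_sqrt:
  assumes p: "prime p" and i0: "i0 \<in> ram p" and j: "j \<in> I" "j \<noteq> i0"
  shows "\<exists>r\<in>K. \<exists>a. r\<^sup>2 = of_int a \<and> \<not> p dvd a \<and> gal (ram p) r = r \<and> gal {j} r = - r \<and>
    (\<forall>j'. j' \<noteq> j \<and> j' \<noteq> i0 \<longrightarrow> gal {j'} r = r)"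
proof -
  define S where "S = (if j \<in> ram p then {j, i0} else {j})"
  have S: "S \<subseteq> I" using i0 j ram_subset by (auto simp: S_def)
  have "card (ram p \<inter> S) = (if j \<in> ram p then 2 else 0)"
    using i0 j(2) by (auto simp: S_def card_insert_if Int_insert_right)
  then have chi: "chi (ram p) S = 1" by (simp add: chi_def)
  obtain e where e: "multiplicity p (prod d S) = 2 * e + 0"
    using even_multiplicity_prod[OF p S chi] by auto
  obtain a where a: "\<not> p dvd a" "(prod s S / of_int p ^ e)\<^sup>2 = of_int (p ^ 0 * a)"
    using sqrt_coprime_part[OF p S e] by blast
  let ?r = "prod s S / of_int p ^ e"
  note r_K = gal_prod_s_div(1)[OF S, where p = p and e = e]
    and g = gal_prod_s_div(2)[OF S, where p = p and e = e]
  have "gal (ram p) ?r = ?r" using g[where A = "ram p"] unfolding chi by simp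
  moreover have "gal {j} ?r = - ?r" using g[where A = "{j}"] by (simp add: chi_singleton S_def)
  moreover have "gal {j'} ?r = ?r" if "j' \<noteq> j \<and> j' \<noteq> i0" for j'
    using g[where A = "{j'}"] that by (simp add: chi_singleton S_def)
  ultimately show ?thesis using a r_K by (intro bexI[of _ ?r] exI[of _ a]) auto
qed

text \<open>Two independent radicands prime to \<open>p\<close> are available, and one of
  \<open>a1\<close>, \<open>a2\<close> and \<open>a1 * a2\<close> is a residue. The product root is
  still moved by \<open>gal {j}\<close>, which negates \<open>r1\<close> and fixes
  \<open>r2\<close>.\<close>

lemma ex_split_sqrt:
  assumes p: "prime p" "odd p" and i0: "i0 \<in> ram p" and j: "j \<in> I" "k \<in> I" "j \<noteq> i0" "k \<noteq> i0" "j \<noteq> k"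
  shows "\<exists>r\<in>K. \<exists>a B. r\<^sup>2 = of_int a \<and> \<not> p dvd a \<and> QuadRes p a \<and> gal (ram p) r = r \<and> gal B r = - r"
proof -
  obtain r1 a1 where r1: "r1 \<in> K" "r1\<^sup>2 = of_int a1" "\<not> p dvd a1" "gal (ram p) r1 = r1" "gal {j} r1 = - r1"
    using ex_unramified_sqrt[OF p(1) i0 j(1,3)] by blast
  obtain r2 a2 where r2: "r2 \<in> K" "r2\<^sup>2 = of_int a2" "\<not> p dvd a2" "gal (ram p) r2 = r2" "gal {k} r2 = - r2"
    and r2j: "\<forall>j'. j' \<noteq> k \<and> j' \<noteq> i0 \<longrightarrow> gal {j'} r2 = r2"
    using ex_unramified_sqrt[OF p(1) i0 j(2,4)] by blast
  have gj: "gal {j} r2 = r2" using r2j j by blast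
  show ?thesis
  proof (cases "QuadRes p a1 \<or> QuadRes p a2")
    case True
    then show ?thesis using r1 r2 by blast
  next
    case False
    have "p > 1" using p(1) by (rule prime_gt_1_int)
    then have pn: "int (nat p) = p" by simp
    have "p \<noteq> 2" using p(2) by auto
    then have "2 < nat p" using \<open>p > 1\<close> by linarith
    moreover have "prime (nat p)" using p(1) by simp
    ultimately have "QuadRes p (a1 * a2)"
      using QuadRes_product_of_nonresidues[of "nat p" a1 a2] False r1(3) r2(3) unfolding pn by blast
    moreover have "\<not> p dvd a1 * a2" using r1(3) r2(3) p(1) by (simp add: prime_dvd_mult_iff)
    moreover have "(r1 * r2)\<^sup>2 = of_int (a1 * a2)" using r1(2) r2(2) by (simp add: power_mult_distrib)
    moreover have "gal (ram p) (r1 * r2) = r1 * r2" by (simp only: gal_mult[OF r1(1) r2(1)] r1(4) r2(4))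
    moreover have "gal {j} (r1 * r2) = - (r1 * r2)" by (simp only: gal_mult[OF r1(1) r2(1)] r1(5) gj mult_minus_left)
    moreover have "r1 * r2 \<in> K" using r1(1) r2(1) by (rule mult_in_K)
    ultimately show ?thesis by blast
  qed
qed

end

context norm_minus_one
begin

lemma even_class_number:
  assumes "3 \<le> card I" shows "even (class_number K)"
proof (rule ccontr)
  assume odd: "odd (class_number K)"
  have "2 \<le> card I" using assms by simp
  then obtain i j where "i \<in> I" "j \<in> I" "i \<noteq> j"
    using card_le_Suc0_iff_eq[OF finite_I] by (metis not_less_eq_eq numeral_2_eq_2)
  then obtain p where p: "prime p" "odd p" "ram p \<noteq> {}" using ex_odd_ramified_prime by blast
  obtain i0 where i0: "i0 \<in> ram p" using p(3) by blast
  have i0I: "{i0} \<subseteq> I" "i0 \<in> I" using i0 ram_subset by auto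
  \<comment> \<open>One index is taken by ramification; the two others supply independent radicands.
    This is the role of \<open>3 \<le> card I\<close>.\<close>
  have "\<not> card (I - {i0}) \<le> Suc 0" using assms i0I(2) by simp
  then obtain j k where jk: "j \<in> I - {i0}" "k \<in> I - {i0}" "j \<noteq> k"
    using card_le_Suc0_iff_eq[of "I - {i0}"] by auto
  obtain r a B where r: "r \<in> K" "r\<^sup>2 = of_int a" "\<not> p dvd a" "QuadRes p a" "gal (ram p) r = r" "gal B r = - r"
    using ex_split_sqrt[OF p(1,2) i0, of j k] jk by blast
  obtain x q where x: "x * x = a + p * q" "\<not> p dvd q" "\<not> p dvd x"
    using exact_square_root_mod[OF p(1,2) r(3,4)] by blast
  have "odd (multiplicity p (d i0))" using i0 by (simp add: ram_def)
  then obtain e where "multiplicity p (d i0) = 2 * e + 1" by (rule oddE)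
  then have e: "multiplicity p (prod d {i0}) = 2 * e + 1" by simp
  obtain D where D: "\<not> p dvd D" "(prod s {i0} / of_int p ^ e)\<^sup>2 = of_int (p ^ 1 * D)"
    using sqrt_coprime_part[OF p(1) i0I(1) e] by blast
  \<comment> \<open>\<open>t\<close> plays the part of \<surd>p: its square is \<open>p\<close>
    times an integer prime to \<open>p\<close>, and inertia negates it.\<close>
  define t where "t = prod s {i0} / of_int p ^ e"
  have t: "t \<in> K" "t\<^sup>2 = of_int (p * D)" "gal (ram p) t = - t"
  proof -
    show "t \<in> K" unfolding t_def by (rule gal_prod_s_div(1)[OF i0I(1)])
    show "t\<^sup>2 = of_int (p * D)" unfolding t_def D(2) by simp
    have "chi (ram p) {i0} = - 1" using i0 by (simp add: chi_singleton)
    then show "gal (ram p) t = - t"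
      using gal_prod_s_div(2)[OF i0I(1), where A = "ram p" and p = p and e = e] unfolding t_def by simp
  qed
  show False
    by (rule no_ramified_split_prime[OF odd p(1,2) t(1,2) D(1) t(3) r(1,2,5,6) x])
qed

end

theorem theorem7p9:
  fixes m :: nat and d :: "nat \<Rightarrow> int" and K :: "complex set"
  assumes "multiquadratic_field m d K"
    and "m \<ge> 3"
    and "odd (class_number K)"
  shows "\<not> (\<exists>\<epsilon> \<in> Units (ring_of_integers K). rat_norm K \<epsilon> = -1)"
proof
  assume "\<exists>\<epsilon> \<in> Units (ring_of_integers K). rat_norm K \<epsilon> = -1"
  then obtain \<epsilon> where eps: "\<epsilon> \<in> Units (ring_of_integers K)" "rat_norm K \<epsilon> = -1" by blast
  let ?I = "{1..m}" and ?s = "\<lambda>i. csqrt (of_int (d i))"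
  have K: "K = rat_adjoin (?s ` ?I)" "rat_degree K (2 ^ m)"
    using assms(1) unfolding multiquadratic_field_def by blast+
  have sq: "(?s i)\<^sup>2 = of_int (d i)" for i by simp
  interpret M: multiquadratic ?I d ?s
  proof (rule multiquadratic_if_rat_degree)
    have "card ?I = m" by simp
    then show "rat_degree (rat_adjoin (?s ` ?I)) (2 ^ card ?I)" using K(2) unfolding K(1) by (simp only:)
  qed simp_all
  have KM: "K = M.K"
    unfolding K(1) M.K_eq_sqrt_span by (rule rat_adjoin_eq_sqrt_span) (simp_all only: sq, simp_all)
  have u: "\<epsilon> \<in> M.units" using eps(1) M.Units_ring_of_integers unfolding KM by blast
  have norm: "(\<Prod>A\<in>Pow ?I. M.gal A \<epsilon>) = - 1"
    using eps(2) unfolding KM M.rat_norm_eq[OF M.unitsD(1)[OF u]] .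
  \<comment> \<open>A negative radicand would make the norm a squared absolute value, so all
    radicands are positive.\<close>
  have pos: "d i > 0" if i: "i \<in> ?I" for i
  proof -
    have "\<not> d i < 0" using M.norm_nonneg_if_imaginary[OF M.unitsD(1)[OF u] i] norm by blast
    then show ?thesis using M.d_nonzero[OF i] by linarith
  qed
  interpret N: norm_minus_one ?I d ?s \<epsilon>
    by unfold_locales (use pos u norm in blast)+
  have "even (class_number M.K)" by (rule N.even_class_number) (use assms(2) in simp)
  then show False using assms(3) unfolding KM by blast
qed

end
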